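(* Let $q$ be a prime power, let $\mathbf{F}_q$ be the finite field with $q$ elements, and let $G=\mathbf{F}_q^+\rtimes\mathbf{F}_q^{\times}$. Then the modular tensor category $\mathcal{Z}(G)$ admits a (braided monoidal) auto-equivalence whose induced permutation on the set of (isomorphism classes of) simple objects has the form $PJ$, where $J$ sends every simple object $X$ to its charge conjugation $X^{\vee}$, and $P$ is the transposition of a chargeon $C$ and a fluxion $F$ with $C\neq F$.
   Context: For a finite group $G$, the Drinfeld (quantum) double $D(G)$ is the Hopf algebra with $\mathbb{C}$-basis $\{gh^{\ast}: g,h\in G\}$, multiplication $(g_1h_1^{\ast})(g_2h_2^{\ast})=\delta_{h_2=g_2^{-1}h_1g_2}\,(g_1g_2)h_2^{\ast}$, comultiplication $\Delta(gh^{\ast})=\sum_{h_1h_2=h} gh_1^{\ast}\otimes gh_2^{\ast}$, counit $\varepsilon(gh^\ast)=\delta_{h=e}$, antipode $\gamma(gh^{\ast})=g^{-1}(gh^{-1}g^{-1})^{\ast}$, and universal $R$-matrix $R=\sum_{g\in G} g^{\ast}\otimes g$ (here $g^\ast=eg^\ast$). $\mathcal{Z}(G)$ denotes the modular tensor category of finite-dimensional complex representations of $D(G)$, with braiding given by $R$. Its simple objects (irreducible representations) are indexed, up to isomorphism, by pairs $(\overline{a},\pi)$, where $\overline{a}$ is a conjugacy class of $G$ with chosen representative $a$ and $\pi$ is an irreducible representation of the centralizer $Z(a)$; the representation $V_{(\overline a,\pi)}$ has basis $|b,w_i\rangle$ ($b\in\overline a$, $w_i$ a basis of $\pi$) and action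 $gh^\ast|b,w_i\rangle=\delta_{h=b}|gbg^{-1},(k_{gbg^{-1}}^{-1}gk_b)w_i\rangle$, where $k_b$ are fixed elements with $b=k_bak_b^{-1}$. The charge conjugation (dual) of $(\overline{a},\pi)$ is $(\overline{a^{-1}},\pi^{\ast})$, with $\pi^\ast$ the complex conjugate representation. A simple object $(\overline a,\pi)$ is called a chargeon if $a=e$, and a fluxion if $\pi$ is the trivial representation. The group $\mathbf{F}_q^+\rtimes\mathbf{F}_q^{\times}$ consists of pairs $(a,\alpha)$ with $a\in\mathbf{F}_q$, $\alpha\in\mathbf{F}_q\setminus\{0\}$, with multiplication $(a,\alpha)(a',\alpha')=(a+\alpha a',\alpha\alpha')$. *)

theory Defs
  imports Complex_Main "Jordan_Normal_Form.Matrix"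
begin

record 'g fgrp =
  gcar :: "'g set"
  gmul :: "'g \<Rightarrow> 'g \<Rightarrow> 'g"
  gone :: "'g"
  ginv :: "'g \<Rightarrow> 'g"

definition affine_grp :: "('k::{finite,field} \<times> 'k) fgrp" where
  "affine_grp = \<lparr> gcar = {(a, \<alpha>). \<alpha> \<noteq> 0},
                  gmul = (\<lambda>(a, \<alpha>) (a', \<alpha>'). (a + \<alpha> * a', \<alpha> * \<alpha>')),
                  gone = (0, 1),
                  ginv = (\<lambda>(a, \<alpha>). (- a / \<alpha>, inverse \<alpha>)) \<rparr>"

text \<open>A representation is given by its dimension n and the matrices by which
  the basis elements g h* (g, h in G) act on C^n (standard basis).\<close>

type_synonym 'g drep = "nat \<times> ('g \<Rightarrow> 'g \<Rightarrow> complex mat)"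

definition ddim :: "'g drep \<Rightarrow> nat" where "ddim X = fst X"
definition dact :: "'g drep \<Rightarrow> 'g \<Rightarrow> 'g \<Rightarrow> complex mat" where "dact X = snd X"

definition msum :: "nat \<Rightarrow> nat \<Rightarrow> 'a set \<Rightarrow> ('a \<Rightarrow> complex mat) \<Rightarrow> complex mat" where
  "msum nr nc A f = mat nr nc (\<lambda>(i, j). \<Sum>a\<in>A. f a $$ (i, j))"

definition kron :: "complex mat \<Rightarrow> complex mat \<Rightarrow> complex mat" where
  "kron A B = mat (dim_row A * dim_row B) (dim_col A * dim_col B)
     (\<lambda>(i, j). A $$ (i div dim_row B, j div dim_col B) * B $$ (i mod dim_row B, j mod dim_col B))"

definition swap_mat :: "nat \<Rightarrow> nat \<Rightarrow> complex mat" where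
  "swap_mat m n = mat (n * m) (m * n)
     (\<lambda>(r, c). if r = (c mod n) * m + c div n then 1 else 0)"

definition is_drep :: "'g fgrp \<Rightarrow> 'g drep \<Rightarrow> bool" where
  "is_drep G X \<longleftrightarrow>
     (\<forall>g\<in>gcar G. \<forall>h\<in>gcar G. dact X g h \<in> carrier_mat (ddim X) (ddim X)) \<and>
     (\<forall>g1\<in>gcar G. \<forall>h1\<in>gcar G. \<forall>g2\<in>gcar G. \<forall>h2\<in>gcar G.
        dact X g1 h1 * dact X g2 h2 =
          (if h2 = gmul G (gmul G (ginv G g2) h1) g2
           then dact X (gmul G g1 g2) h2 else 0\<^sub>m (ddim X) (ddim X))) \<and>
     msum (ddim X) (ddim X) (gcar G) (\<lambda>h. dact X (gone G) h) = 1\<^sub>m (ddim X)"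

definition dhom :: "'g fgrp \<Rightarrow> 'g drep \<Rightarrow> 'g drep \<Rightarrow> complex mat set" where
  "dhom G X Y = {T \<in> carrier_mat (ddim Y) (ddim X).
      \<forall>g\<in>gcar G. \<forall>h\<in>gcar G. T * dact X g h = dact Y g h * T}"

definition is_iso_mor :: "'g fgrp \<Rightarrow> 'g drep \<Rightarrow> 'g drep \<Rightarrow> complex mat \<Rightarrow> bool" where
  "is_iso_mor G X Y T \<longleftrightarrow> T \<in> dhom G X Y \<and>
     (\<exists>S\<in>dhom G Y X. S * T = 1\<^sub>m (ddim X) \<and> T * S = 1\<^sub>m (ddim Y))"

definition diso :: "'g fgrp \<Rightarrow> 'g drep \<Rightarrow> 'g drep \<Rightarrow> bool" where
  "diso G X Y \<longleftrightarrow> (\<exists>T. is_iso_mor G X Y T)"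

text \<open>tensor product via the comultiplication
  Delta(g h*) = sum_{h1 h2 = h} g h1* (x) g h2*\<close>
definition dtensor :: "'g fgrp \<Rightarrow> 'g drep \<Rightarrow> 'g drep \<Rightarrow> 'g drep" where
  "dtensor G X Y = (ddim X * ddim Y,
     \<lambda>g h. msum (ddim X * ddim Y) (ddim X * ddim Y) (gcar G)
              (\<lambda>h1. kron (dact X g h1) (dact Y g (gmul G (ginv G h1) h))))"

definition dunit :: "'g fgrp \<Rightarrow> 'g drep" where
  "dunit G = (1, \<lambda>g h. if h = gone G then 1\<^sub>m 1 else 0\<^sub>m 1 1)"

text \<open>braiding c_{X,Y} = flip o R with R = sum_g g* (x) g, where g* = e g* and
  g = sum_h g h*\<close>
definition dbraid :: "'g fgrp \<Rightarrow> 'g drep \<Rightarrow> 'g drep \<Rightarrow> complex mat" where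
  "dbraid G X Y = swap_mat (ddim X) (ddim Y) *
     msum (ddim X * ddim Y) (ddim X * ddim Y) (gcar G)
       (\<lambda>g. kron (dact X (gone G) g)
                  (msum (ddim Y) (ddim Y) (gcar G) (\<lambda>h. dact Y g h)))"

text \<open>dual (charge conjugate) representation: action of x is the transpose of
  the action of the antipode of x; antipode(g h*) = g^{-1} (g h^{-1} g^{-1})*\<close>
definition ddual :: "'g fgrp \<Rightarrow> 'g drep \<Rightarrow> 'g drep" where
  "ddual G X = (ddim X, \<lambda>g h. transpose_mat
       (dact X (ginv G g) (gmul G (gmul G g (ginv G h)) (ginv G g))))"

definition dsimple :: "'g fgrp \<Rightarrow> 'g drep \<Rightarrow> bool" where
  "dsimple G X \<longleftrightarrow> is_drep G X \<and> ddim X > 0 \<and>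
     (\<forall>W. W \<subseteq> carrier_vec (ddim X) \<and> 0\<^sub>v (ddim X) \<in> W \<and>
          (\<forall>v\<in>W. \<forall>w\<in>W. v + w \<in> W) \<and> (\<forall>c. \<forall>v\<in>W. c \<cdot>\<^sub>v v \<in> W) \<and>
          (\<forall>g\<in>gcar G. \<forall>h\<in>gcar G. \<forall>v\<in>W. dact X g h *\<^sub>v v \<in> W)
        \<longrightarrow> W = {0\<^sub>v (ddim X)} \<or> W = carrier_vec (ddim X))"

text \<open>chargeon: simple object (a-bar, pi) with a = e, i.e. e h* acts as zero
  for every h different from e (the flux support is {e}).\<close>
definition chargeon :: "'g fgrp \<Rightarrow> 'g drep \<Rightarrow> bool" where
  "chargeon G X \<longleftrightarrow> dsimple G X \<and>
     (\<forall>h\<in>gcar G. h \<noteq> gone G \<longrightarrow> dact X (gone G) h = 0\<^sub>m (ddim X) (ddim X))"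

text \<open>fluxion: simple object (a-bar, pi) with pi trivial; unfolded on the basis
  |b,w>: for g commuting with h, g h* acts as e h*.\<close>
definition fluxion :: "'g fgrp \<Rightarrow> 'g drep \<Rightarrow> bool" where
  "fluxion G X \<longleftrightarrow> dsimple G X \<and>
     (\<forall>g\<in>gcar G. \<forall>h\<in>gcar G. gmul G g h = gmul G h g \<longrightarrow>
        dact X g h = dact X (gone G) h)"

text \<open>F: action on objects; Fm X Y T: action on a morphism T : X -> Y;
  Jt X Y : F X (x) F Y -> F (X (x) Y) the tensor structure; phi : 1 -> F 1.
  The associativity and unit constraints of the category of matrix
  representations are given by identity matrices (kron is strictly associative
  and kron (1_1) A = A = kron A (1_1)); F applied to them appears explicitly.\<close>

definition braided_autoequiv ::
  "'g fgrp \<Rightarrow> ('g drep \<Rightarrow> 'g drep) \<Rightarrow> ('g drep \<Rightarrow> 'g drep \<Rightarrow> complex mat \<Rightarrow> complex mat)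
     \<Rightarrow> ('g drep \<Rightarrow> 'g drep \<Rightarrow> complex mat) \<Rightarrow> complex mat \<Rightarrow> bool" where
  "braided_autoequiv G F Fm Jt \<phi> \<longleftrightarrow>
     \<comment> \<open>functor\<close>
     (\<forall>X. is_drep G X \<longrightarrow> is_drep G (F X)) \<and>
     (\<forall>X Y T. is_drep G X \<and> is_drep G Y \<and> T \<in> dhom G X Y \<longrightarrow>
        Fm X Y T \<in> dhom G (F X) (F Y)) \<and>
     (\<forall>X. is_drep G X \<longrightarrow> Fm X X (1\<^sub>m (ddim X)) = 1\<^sub>m (ddim (F X))) \<and>
     (\<forall>X Y Z S T. is_drep G X \<and> is_drep G Y \<and> is_drep G Z \<and>
        T \<in> dhom G X Y \<and> S \<in> dhom G Y Z \<longrightarrow>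
        Fm X Z (S * T) = Fm Y Z S * Fm X Y T) \<and>
     \<comment> \<open>C-linear\<close>
     (\<forall>X Y S T c. is_drep G X \<and> is_drep G Y \<and> S \<in> dhom G X Y \<and> T \<in> dhom G X Y \<longrightarrow>
        Fm X Y (S + T) = Fm X Y S + Fm X Y T \<and> Fm X Y (c \<cdot>\<^sub>m T) = c \<cdot>\<^sub>m Fm X Y T) \<and>
     \<comment> \<open>equivalence: fully faithful and essentially surjective\<close>
     (\<forall>X Y. is_drep G X \<and> is_drep G Y \<longrightarrow>
        bij_betw (Fm X Y) (dhom G X Y) (dhom G (F X) (F Y))) \<and>
     (\<forall>Y. is_drep G Y \<longrightarrow> (\<exists>X. is_drep G X \<and> diso G (F X) Y)) \<and>
     \<comment> \<open>monoidal structure\<close>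
     (\<forall>X Y. is_drep G X \<and> is_drep G Y \<longrightarrow>
        is_iso_mor G (dtensor G (F X) (F Y)) (F (dtensor G X Y)) (Jt X Y)) \<and>
     (\<forall>X X' Y Y' T S. is_drep G X \<and> is_drep G X' \<and> is_drep G Y \<and> is_drep G Y' \<and>
        T \<in> dhom G X X' \<and> S \<in> dhom G Y Y' \<longrightarrow>
        Jt X' Y' * kron (Fm X X' T) (Fm Y Y' S) =
          Fm (dtensor G X Y) (dtensor G X' Y') (kron T S) * Jt X Y) \<and>
     (\<forall>X Y Z. is_drep G X \<and> is_drep G Y \<and> is_drep G Z \<longrightarrow>
        Fm (dtensor G (dtensor G X Y) Z) (dtensor G X (dtensor G Y Z))
             (1\<^sub>m (ddim X * ddim Y * ddim Z)) *
          Jt (dtensor G X Y) Z * kron (Jt X Y) (1\<^sub>m (ddim (F Z))) =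
          Jt X (dtensor G Y Z) * kron (1\<^sub>m (ddim (F X))) (Jt Y Z)) \<and>
     is_iso_mor G (dunit G) (F (dunit G)) \<phi> \<and>
     (\<forall>X. is_drep G X \<longrightarrow>
        Fm (dtensor G (dunit G) X) X (1\<^sub>m (ddim X)) *
          Jt (dunit G) X * kron \<phi> (1\<^sub>m (ddim (F X))) = 1\<^sub>m (ddim (F X)) \<and>
        Fm (dtensor G X (dunit G)) X (1\<^sub>m (ddim X)) *
          Jt X (dunit G) * kron (1\<^sub>m (ddim (F X))) \<phi> = 1\<^sub>m (ddim (F X))) \<and>
     \<comment> \<open>braided\<close>
     (\<forall>X Y. is_drep G X \<and> is_drep G Y \<longrightarrow>
        Fm (dtensor G X Y) (dtensor G Y X) (dbraid G X Y) * Jt X Y =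
          Jt Y X * dbraid G (F X) (F Y))"

definition swap_cls :: "'g fgrp \<Rightarrow> 'g drep \<Rightarrow> 'g drep \<Rightarrow> 'g drep \<Rightarrow> 'g drep" where
  "swap_cls G C D Y = (if diso G Y C then D else if diso G Y D then C else Y)"

end

theory Submission
  imports Defs "Jordan_Normal_Form.Determinant" "HOL-Library.Function_Algebras"
    "HOL-Algebra.Multiplicative_Group"
begin

text \<open>A representation of the double of \<open>G = A \<rtimes> H\<close> is a \<open>G\<close>-graded vector space with a
  compatible action of \<open>G\<close>.  For \<open>A = \<bbbF>\<^sub>q\<^sup>+\<close> the grading by \<open>A\<close> is the same thing as an action \<open>Z\<close>
  of \<open>A\<close>, through an additive character \<open>\<psi>\<close>.  The functor keeps the vector space, inverts the
  \<open>H\<close>-part of both grading and action, and exchanges the roles of \<open>Z\<close> and of the action \<open>U\<close> of \<open>A\<close>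
  (electric-magnetic duality).  Its tensor structure \<open>v \<otimes> w \<mapsto> v \<otimes> U(- b / \<beta>) w\<close>, for \<open>v\<close> of flux
  \<open>(b, \<beta>)\<close>, cancels the \<open>A\<close>-part of the braiding.

  A joint eigenvector of flux \<open>(b, 1)\<close> and character \<open>\<psi>(x \<cdot>)\<close> of \<open>A\<close> is sent to one of flux \<open>(x, 1)\<close>
  and character \<open>\<psi>(b \<cdot>)\<close>, whereas duality gives \<open>(- b, - x)\<close>.  Only the product \<open>b x\<close> is invariant under
  conjugation by \<open>H\<close>, so the two results agree if \<open>b x \<noteq> 0\<close> and differ by the exchange of
  \<open>b \<noteq> 0 = x\<close> and \<open>b = 0 \<noteq> x\<close>, a fluxion and a chargeon.  On all other simple objects both
  invert the \<open>H\<close>-part of the flux and the character of \<open>H\<close>.\<close>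

subsection \<open>Characters of finite abelian groups\<close>

text \<open>The H-part has to be inverted because \<alpha> in H acts on a pair (flux b, character x)
  by (\<alpha> b, x / \<alpha>): after the exchange of b and x this is the action of 1 / \<alpha>,
  and the R-matrix ties the H-part of the flux to the action. The new operators are linear
  combinations of the old ones on the same space, so the functor is the identity on morphisms and
  keeps subrepresentations; applied twice it returns the old operators up to relabelling, which
  gives fullness, simplicity of images and essential surjectivity. The obstacle is that vectors
  homogeneous for the old grading are not so for the new one. Identities are therefore tested on old
  homogeneous vectors, where the new projections are averages over translations, and sums over new
  fluxes are collapsed by Fourier inversion. Simple objects are compared through a single joint
  eigenvector: a shared type makes two simple objects isomorphic, and likewise a simple object and
  one of equal dimension. The second alternative serves for duals.\<close>

definition is_char :: "'a monoid \<Rightarrow> ('a \<Rightarrow> complex) \<Rightarrow> bool" where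
  "is_char G \<chi> \<longleftrightarrow> \<chi> \<one>\<^bsub>G\<^esub> = 1 \<and>
     (\<forall>x\<in>carrier G. \<forall>y\<in>carrier G. \<chi> (x \<otimes>\<^bsub>G\<^esub> y) = \<chi> x * \<chi> y)"

locale finite_comm_group = comm_group G for G :: "'a monoid" (structure) +
  assumes fin: "finite (carrier G)"
begin

text \<open>Weighting the translates of \<open>f\<close> along the powers of \<open>s\<close> by
  powers of a root of unity \<open>z\<close> gives an eigenfunction of translation by
  \<open>s\<close>. An unlucky \<open>z\<close> could annihilate \<open>f\<close>, but the values of
  \<open>f\<close> along the powers of \<open>s\<close> are the coefficients of a nonzero polynomial
  of degree below m, which cannot vanish at all m roots of unity.\<close>

lemma eigenfunction_step:
  fixes f :: "'a \<Rightarrow> complex"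
  assumes s: "s \<in> carrier G"
    and x0: "x0 \<in> carrier G" "f x0 \<noteq> 0"
  obtains z m where "z \<noteq> 0" "s [^] (m::nat) = \<one>" "m > 0" "z ^ m = 1"
    "\<exists>x\<in>carrier G. (\<Sum>k<m. z ^ k * f (x \<otimes> s [^] k)) \<noteq> 0"
    "\<And>x. x \<in> carrier G \<Longrightarrow>
      (\<Sum>k<m. z ^ k * f (x \<otimes> s \<otimes> s [^] k)) = inverse z * (\<Sum>k<m. z ^ k * f (x \<otimes> s [^] k))"
proof -
  define m where "m = order G"
  have m0: "m > 0" using fin by (simp add: m_def order_gt_0_iff_finite)
  have sm: "s [^] m = \<one>" using s by (simp add: m_def pow_order_eq_1)
  define p where "p = (\<Sum>k<m. Polynomial.monom (f (x0 \<otimes> s [^] k)) k)"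
  have cf: "Polynomial.coeff p k = (if k < m then f (x0 \<otimes> s [^] k) else 0)" for k
    by (simp add: p_def coeff_sum)
  have "Polynomial.coeff p 0 \<noteq> 0" using m0 x0 by (simp add: cf)
  then have p0: "p \<noteq> 0" by auto
  have deg: "degree p < m" using m0 by (intro degree_lessI) (auto simp: cf)
  have "\<exists>z. z ^ m = 1 \<and> poly p z \<noteq> 0"
  proof (rule ccontr)
    assume "\<not> ?thesis"
    then have "{z. z ^ m = 1} \<subseteq> {z. poly p z = 0}" by auto
    then have "card {z::complex. z ^ m = 1} \<le> card {z. poly p z = 0}"
      by (intro card_mono poly_roots_finite p0)
    also have "\<dots> \<le> degree p" by (rule card_poly_roots_bound[OF p0])
    finally show False using deg m0 by (simp add: card_roots_unity_eq)
  qed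
  then obtain z where z: "z ^ m = 1" "poly p z \<noteq> 0" by auto
  have z0: "z \<noteq> 0" using z(1) m0 by (metis power_eq_0_iff power_0_left zero_neq_one less_irrefl)
  show thesis
  proof (rule that[OF z0 sm m0 z(1)])
    have "poly p z = (\<Sum>k<m. z ^ k * f (x0 \<otimes> s [^] k))"
      by (simp add: p_def poly_sum poly_monom mult.commute)
    with z x0 show "\<exists>x\<in>carrier G. (\<Sum>k<m. z ^ k * f (x \<otimes> s [^] k)) \<noteq> 0" by auto
  next
    fix x assume x: "x \<in> carrier G"
    define F where "F k = z ^ k * f (x \<otimes> s [^] k)" for k :: nat
    have sft: "x \<otimes> s \<otimes> s [^] k = x \<otimes> s [^] Suc k" for k :: nat
      using x s by (metis m_assoc nat_pow_closed nat_pow_Suc2)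
    \<comment> \<open>The index shift wraps around: z^m = 1 and s^m = 1 make the new top term equal
      to the lost bottom term.\<close>
    have "z * (\<Sum>k<m. z ^ k * f (x \<otimes> s \<otimes> s [^] k)) = (\<Sum>k<m. F (Suc k))"
      unfolding F_def sft by (simp add: sum_distrib_left mult.assoc)
    also have "\<dots> = (\<Sum>k<m. F k) + F m - F 0"
      using sum.lessThan_Suc[of F m] sum.lessThan_Suc_shift[of F m] by simp
    also have "F m = F 0" using x s by (simp add: F_def z sm)
    finally show "(\<Sum>k<m. z ^ k * f (x \<otimes> s \<otimes> s [^] k)) = inverse z * (\<Sum>k<m. z ^ k * f (x \<otimes> s [^] k))"
      using z0 by (simp add: F_def field_simps)
  qed
qed

text \<open>If all Fourier coefficients of \<open>f\<close> vanished, the same would hold for every combination of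
  translates of \<open>f\<close>; averaging over cyclic subgroups turns \<open>f\<close> into a nonzero common
  eigenfunction of all translations, that is, a multiple of a character.\<close>

lemma fourier_nonzero:
  fixes f :: "'a \<Rightarrow> complex"
  assumes x0: "x0 \<in> carrier G" "f x0 \<noteq> 0"
  obtains \<chi> where "is_char G \<chi>" "(\<Sum>x\<in>carrier G. \<chi> (inv x) * f x) \<noteq> 0"
proof (rule ccontr)
  assume "\<not> thesis"
  with that have all0: "\<And>\<chi>. is_char G \<chi> \<Longrightarrow> (\<Sum>x\<in>carrier G. \<chi> (inv x) * f x) = 0" by blast
  define \<Phi> where "\<Phi> h \<longleftrightarrow> (\<forall>\<chi>. is_char G \<chi> \<longrightarrow> (\<Sum>x\<in>carrier G. \<chi> (inv x) * h x) = 0)"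
    for h :: "'a \<Rightarrow> complex"
  have shift: "\<Phi> (\<lambda>x. h (x \<otimes> t))" if h: "\<Phi> h" and t: "t \<in> carrier G" for h t
    unfolding \<Phi>_def
  proof (intro allI impI)
    fix \<chi> assume c: "is_char G \<chi>"
    have "(\<Sum>x\<in>carrier G. \<chi> (inv x) * h (x \<otimes> t)) = (\<Sum>y\<in>carrier G. \<chi> (t \<otimes> inv y) * h y)"
      by (rule sum.reindex_bij_witness[of _ "\<lambda>y. y \<otimes> inv t" "\<lambda>x. x \<otimes> t"])
        (use t in \<open>auto simp: m_assoc inv_mult_group simp flip: m_assoc[of t "inv t"]\<close>)
    also have "\<dots> = \<chi> t * (\<Sum>y\<in>carrier G. \<chi> (inv y) * h y)"
      using c t by (simp add: is_char_def sum_distrib_left mult.assoc)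
    finally show "(\<Sum>x\<in>carrier G. \<chi> (inv x) * h (x \<otimes> t)) = 0"
      using h c by (simp add: \<Phi>_def)
  qed
  have comb: "\<Phi> (\<lambda>x. \<Sum>k<m. c k * h k x)" if "\<And>k. k < m \<Longrightarrow> \<Phi> (h k)" for m :: nat and c h
    unfolding \<Phi>_def
  proof (intro allI impI)
    fix \<chi> assume ch: "is_char G \<chi>"
    have "(\<Sum>x\<in>carrier G. \<chi> (inv x) * (\<Sum>k<m. c k * h k x)) =
      (\<Sum>k<m. c k * (\<Sum>x\<in>carrier G. \<chi> (inv x) * h k x))"
      unfolding sum_distrib_left by (subst sum.swap) (simp add: ac_simps)
    also have "\<dots> = 0" using that ch by (simp add: \<Phi>_def)
    finally show "(\<Sum>x\<in>carrier G. \<chi> (inv x) * (\<Sum>k<m. c k * h k x)) = 0" .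
  qed
  \<comment> \<open>Averaging over a new s keeps the eigenfunction property for the earlier
    elements, because translations commute.\<close>
  have "\<exists>h. \<Phi> h \<and> (\<exists>x\<in>carrier G. h x \<noteq> 0) \<and>
      (\<forall>s\<in>S. \<exists>c. \<forall>x\<in>carrier G. h (x \<otimes> s) = c * h x)" if "S \<subseteq> carrier G" for S
    using finite_subset[OF that fin] that
  proof (induction S rule: finite_induct)
    case empty
    then show ?case using all0 x0 by (auto simp: \<Phi>_def)
  next
    case (insert s S)
    then obtain h y where h: "\<Phi> h" "y \<in> carrier G" "h y \<noteq> 0"
      "\<forall>s\<in>S. \<exists>c. \<forall>x\<in>carrier G. h (x \<otimes> s) = c * h x" by auto
    have s: "s \<in> carrier G" using insert by auto
    obtain z m where zm: "z \<noteq> 0" "s [^] (m::nat) = \<one>" "m > 0" "z ^ m = 1"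
      "\<exists>x\<in>carrier G. (\<Sum>k<m. z ^ k * h (x \<otimes> s [^] k)) \<noteq> 0"
      "\<And>x. x \<in> carrier G \<Longrightarrow>
      (\<Sum>k<m. z ^ k * h (x \<otimes> s \<otimes> s [^] k)) = inverse z * (\<Sum>k<m. z ^ k * h (x \<otimes> s [^] k))"
      using eigenfunction_step[OF s h(2), of h] h(3) by blast
    define h' where "h' x = (\<Sum>k<m. z ^ k * h (x \<otimes> s [^] k))" for x
    have "\<Phi> h'" unfolding h'_def by (intro comb shift h) (use s in auto)
    moreover have "\<exists>x\<in>carrier G. h' x \<noteq> 0" using zm by (simp add: h'_def)
    moreover have "\<exists>c. \<forall>x\<in>carrier G. h' (x \<otimes> t) = c * h' x" if t: "t \<in> S" for t
    proof -
      have tG: "t \<in> carrier G" using t insert by auto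
      obtain c where c: "\<forall>x\<in>carrier G. h (x \<otimes> t) = c * h x" using h t by auto
      have "h' (x \<otimes> t) = c * h' x" if x: "x \<in> carrier G" for x
      proof -
        have "h (x \<otimes> t \<otimes> s [^] k) = c * h (x \<otimes> s [^] k)" for k :: nat
          using c x tG s by (metis m_assoc m_comm m_closed nat_pow_closed)
        then show ?thesis by (simp add: h'_def sum_distrib_left ac_simps)
      qed
      then show ?thesis by blast
    qed
    moreover have "\<exists>c. \<forall>x\<in>carrier G. h' (x \<otimes> s) = c * h' x"
      using zm(6) unfolding h'_def by blast
    ultimately show ?case by blast
  qed
  from this[OF subset_refl] obtain h y where h: "\<Phi> h" "y \<in> carrier G" "h y \<noteq> 0"
    "\<forall>s\<in>carrier G. \<exists>c. \<forall>x\<in>carrier G. h (x \<otimes> s) = c * h x" by blast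
  \<comment> \<open>The eigenvalues are multiplicative in s because \<open>h\<close> has a nonzero
    value to cancel.\<close>
  from h(4) obtain \<chi> where chi: "\<And>s x. s \<in> carrier G \<Longrightarrow> x \<in> carrier G \<Longrightarrow> h (x \<otimes> s) = \<chi> s * h x"
    by metis
  have "is_char G \<chi>"
    unfolding is_char_def
  proof (intro conjI ballI)
    show "\<chi> \<one> = 1" using chi[of \<one> y] h by simp
    fix s t assume st: "s \<in> carrier G" "t \<in> carrier G"
    have "\<chi> (s \<otimes> t) * h y = h (y \<otimes> s \<otimes> t)" using chi[of "s \<otimes> t" y] st h by (simp add: m_assoc)
    also have "\<dots> = \<chi> t * (\<chi> s * h y)" using chi[of t "y \<otimes> s"] chi[of s y] st h by simp
    finally show "\<chi> (s \<otimes> t) = \<chi> s * \<chi> t" using h by simp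
  qed
  then have "(\<Sum>x\<in>carrier G. \<chi> (inv x) * h x) = 0" using h by (simp add: \<Phi>_def)
  \<comment> \<open>All terms of the Fourier coefficient at \<chi> agree, so it is the group order
    times the value of \<open>h\<close> at the unit, which is not 0.\<close>
  moreover have "\<chi> (inv x) * h x = h \<one>" if "x \<in> carrier G" for x
    using chi[of "inv x" x] that by simp
  moreover have "h \<one> \<noteq> 0" using chi[of y \<one>] h by auto
  moreover have "card (carrier G) \<noteq> 0" using fin by auto
  ultimately show False by simp
qed

end

section \<open>The two groups of a finite field and a nontrivial additive character\<close>

definition add_group :: "'k::{finite,field} monoid" where
  "add_group = \<lparr>carrier = UNIV, mult = (+), one = 0\<rparr>"

definition unit_group :: "'k::{finite,field} monoid" where
  "unit_group = \<lparr>carrier = - {0}, mult = (*), one = 1\<rparr>"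

lemma
  fixes x y :: "'k::{finite,field}"
  shows add_group_simps: "carrier (add_group :: 'k::{finite,field} monoid) = UNIV"
      "x \<otimes>\<^bsub>add_group\<^esub> y = x + y" "\<one>\<^bsub>add_group\<^esub> = 0"
    and unit_group_simps: "carrier (unit_group :: 'k monoid) = - {0}"
      "x \<otimes>\<^bsub>unit_group\<^esub> y = x * y" "\<one>\<^bsub>unit_group\<^esub> = 1"
  by (simp_all add: add_group_def unit_group_def)

lemma finite_comm_group_add_group: "finite_comm_group (add_group :: 'k::{finite,field} monoid)"
  unfolding finite_comm_group_def finite_comm_group_axioms_def
  by (intro conjI comm_groupI)
    (auto simp: add_group_simps add.assoc add.commute intro: exI[of _ "- _"])

lemma finite_comm_group_unit_group: "finite_comm_group (unit_group :: 'k::{finite,field} monoid)"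
  unfolding finite_comm_group_def finite_comm_group_axioms_def
  by (intro conjI comm_groupI) (auto simp: unit_group_simps intro!: bexI[of _ "inverse _"])

lemma inv_add_group: "inv\<^bsub>add_group\<^esub> x = - (x :: 'k::{finite,field})"
proof -
  interpret finite_comm_group "add_group :: 'k monoid" by (rule finite_comm_group_add_group)
  show ?thesis by (rule inv_equality) (auto simp: add_group_simps)
qed

lemma inv_unit_group: "inv\<^bsub>unit_group\<^esub> x = inverse x" if "x \<noteq> 0" for x :: "'k::{finite,field}"
proof -
  interpret finite_comm_group "unit_group :: 'k monoid" by (rule finite_comm_group_unit_group)
  show ?thesis by (rule inv_equality) (use that in \<open>auto simp: unit_group_simps\<close>)
qed

lemma ex_additive_char:
  "\<exists>\<psi> :: 'k::{finite,field} \<Rightarrow> complex. (\<forall>a b. \<psi> (a + b) = \<psi> a * \<psi> b) \<and> \<psi> 0 = 1 \<and> (\<exists>c. \<psi> c \<noteq> 1)"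
proof -
  interpret finite_comm_group "add_group :: 'k monoid" by (rule finite_comm_group_add_group)
  \<comment> \<open>This test function has Fourier coefficient 1 - \<chi>(-1), so a nonzero
    coefficient exhibits a nontrivial character.\<close>
  define f :: "'k \<Rightarrow> complex" where "f x = (if x = 0 then 1 else if x = 1 then -1 else 0)" for x
  obtain \<chi> where c: "is_char (add_group :: 'k monoid) \<chi>" "(\<Sum>x\<in>UNIV. \<chi> (- x) * f x) \<noteq> 0"
    using fourier_nonzero[of 0 f] by (auto simp: add_group_simps inv_add_group f_def)
  have "(\<Sum>x\<in>UNIV. \<chi> (- x) * f x) = (\<Sum>x\<in>{0,1}. \<chi> (- x) * f x)"
    by (rule sum.mono_neutral_right) (auto simp: f_def)
  then have "\<chi> (-1) \<noteq> 1" using c by (auto simp: f_def is_char_def add_group_simps)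
  with c show ?thesis by (auto simp: is_char_def add_group_simps)
qed

text \<open>Supplies a character of the unit group whose isotypic projection does not kill a given
  vector. The value of \<open>l\<close> at 0 is unconstrained.\<close>

lemma ex_unit_char:
  fixes f :: "'k::{finite,field} \<Rightarrow> complex"
  assumes "x \<noteq> 0" "f x \<noteq> 0"
  obtains l where "l 1 = 1" "\<And>a b. a \<noteq> 0 \<Longrightarrow> b \<noteq> 0 \<Longrightarrow> l (a * b) = l a * l b"
    "(\<Sum>x\<in>-{0}. l (inverse x) * f x) \<noteq> 0"
proof -
  interpret finite_comm_group "unit_group :: 'k monoid" by (rule finite_comm_group_unit_group)
  obtain \<chi> where c: "is_char unit_group \<chi>"
      "(\<Sum>x\<in>carrier unit_group. \<chi> (inv\<^bsub>unit_group\<^esub> x) * f x) \<noteq> 0"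
    using fourier_nonzero[of x f] assms by (auto simp: unit_group_simps)
  have "(\<Sum>x\<in>carrier unit_group. \<chi> (inv\<^bsub>unit_group\<^esub> x) * f x) = (\<Sum>x\<in>-{0}. \<chi> (inverse x) * f x)"
    by (rule sum.cong) (auto simp: unit_group_simps inv_unit_group)
  with c show thesis by (intro that[of \<chi>]) (auto simp: is_char_def unit_group_simps)
qed

text \<open>One nontrivial additive character, fixed once per field. The pairing \<psi>(x y) is then
  nondegenerate and identifies the field with its character group.\<close>

definition \<psi> :: "'k::{finite,field} \<Rightarrow> complex" where
  "\<psi> = (SOME f. (\<forall>a b. f (a + b) = f a * f b) \<and> f 0 = 1 \<and> (\<exists>c. f c \<noteq> 1))"

lemma
  fixes a b :: "'k::{finite,field}"
  shows \<psi>_add: "\<psi> (a + b) = \<psi> a * \<psi> b"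
    and \<psi>_0[simp]: "\<psi> (0 :: 'k) = 1"
    and \<psi>_nontrivial: "\<exists>c :: 'k. \<psi> c \<noteq> 1"
  using someI_ex[OF ex_additive_char[where 'k='k], folded \<psi>_def] by auto

text \<open>Orthogonality: the substitution x + d / c multiplies the sum by \<psi>(d), and d can be
  chosen with \<psi>(d) different from 1.\<close>

lemma sum_\<psi>_mult:
  fixes c :: "'k::{finite,field}"
  shows "(\<Sum>x\<in>UNIV. \<psi> (x * c)) = (if c = 0 then of_nat (card (UNIV :: 'k set)) else 0)"
proof (cases "c = 0")
  case False
  obtain d :: 'k where d: "\<psi> d \<noteq> 1" using \<psi>_nontrivial by blast
  have "(\<Sum>x\<in>UNIV. \<psi> (x * c)) = (\<Sum>x\<in>UNIV. \<psi> ((x + d / c) * c))"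
    by (rule sum.reindex_bij_witness[of _ "\<lambda>x. x + d / c" "\<lambda>x. x - d / c"]) auto
  also have "\<dots> = \<psi> d * (\<Sum>x\<in>UNIV. \<psi> (x * c))"
    using False by (simp add: ring_distribs \<psi>_add sum_distrib_left mult.commute)
  finally show ?thesis using d False by simp
qed simp

subsection \<open>Vectors as functions\<close>

text \<open>Functions supported below n put vectors of all dimensions into one type with pointwise
  addition, so that finite sums carry no dimension arguments.\<close>

definition vspace :: "nat \<Rightarrow> (nat \<Rightarrow> complex) set" where
  "vspace n = {v. \<forall>i\<ge>n. v i = 0}"

definition sc :: "complex \<Rightarrow> (nat \<Rightarrow> complex) \<Rightarrow> nat \<Rightarrow> complex" where
  "sc c v = (\<lambda>i. c * v i)"

definition mv :: "complex mat \<Rightarrow> (nat \<Rightarrow> complex) \<Rightarrow> nat \<Rightarrow> complex" where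
  "mv M v = (\<lambda>i. if i < dim_row M then \<Sum>j<dim_col M. M $$ (i, j) * v j else 0)"

text \<open>Row-major indexing as in \<open>kron\<close>; only the dimension n of the right factor
  enters.\<close>

definition tens :: "nat \<Rightarrow> (nat \<Rightarrow> complex) \<Rightarrow> (nat \<Rightarrow> complex) \<Rightarrow> nat \<Rightarrow> complex" where
  "tens n v w = (\<lambda>k. v (k div n) * w (k mod n))"

definition unitv :: "nat \<Rightarrow> nat \<Rightarrow> complex" where
  "unitv j = (\<lambda>i. if i = j then 1 else 0)"

lemma sum_fun_apply: "(\<Sum>a\<in>A. f a) i = (\<Sum>a\<in>A. f a i)" for f :: "'a \<Rightarrow> 'b \<Rightarrow> 'c::comm_monoid_add"
  by (induction A rule: infinite_finite_induct) auto

lemma sc_apply [simp]: "sc c v i = c * v i" by (simp add: sc_def)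
lemma sc_sc [simp]: "sc a (sc b v) = sc (a * b) v" by (auto simp: sc_def)
lemma sc_0 [simp]: "sc 0 v = 0" "sc a 0 = 0" by (auto simp: sc_def)
lemma sc_1 [simp]: "sc 1 v = v" by (auto simp: sc_def)
lemma sc_sum: "sc a (\<Sum>x\<in>A. f x) = (\<Sum>x\<in>A. sc a (f x))"
  by (rule ext) (simp add: sum_fun_apply sum_distrib_left)
lemma sum_sc: "(\<Sum>x\<in>A. sc (f x) v) = sc (\<Sum>x\<in>A. f x) v"
  by (rule ext) (simp add: sum_fun_apply sum_distrib_right)
lemma sc_add: "sc a (v + w) = sc a v + sc a w" by (rule ext) (simp add: ring_distribs)
lemma sc_eq_0_iff [simp]: "sc a v = 0 \<longleftrightarrow> a = 0 \<or> v = 0" by (auto simp: fun_eq_iff)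

lemma vspace_0 [simp]: "0 \<in> vspace n" by (simp add: vspace_def)
lemma vspace_add [simp]: "v \<in> vspace n \<Longrightarrow> w \<in> vspace n \<Longrightarrow> v + w \<in> vspace n" by (simp add: vspace_def)
lemma vspace_sc [simp]: "v \<in> vspace n \<Longrightarrow> sc c v \<in> vspace n" by (simp add: vspace_def)
lemma vspace_sum [simp]: "(\<And>a. a \<in> A \<Longrightarrow> f a \<in> vspace n) \<Longrightarrow> (\<Sum>a\<in>A. f a) \<in> vspace n"
  by (simp add: vspace_def sum_fun_apply)
lemma vspace_unitv [simp]: "j < n \<Longrightarrow> unitv j \<in> vspace n" by (auto simp: vspace_def unitv_def)
lemma vspace_expand: "v \<in> vspace n \<Longrightarrow> v = (\<Sum>j<n. sc (v j) (unitv j))"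
  by (rule ext) (auto simp: sum_fun_apply vspace_def unitv_def if_distrib sum.delta not_less cong: if_cong)

lemma mv_vspace: "M \<in> carrier_mat m n \<Longrightarrow> mv M v \<in> vspace m"
  by (auto simp: mv_def vspace_def)
lemma mv_add: "mv M (v + w) = mv M v + mv M w"
  by (rule ext) (simp add: mv_def ring_distribs sum.distrib)
lemma mv_sc: "mv M (sc c v) = sc c (mv M v)"
  by (rule ext) (simp add: mv_def sum_distrib_left ac_simps)
lemma mv_0 [simp]: "mv M 0 = 0" by (rule ext) (simp add: mv_def)
lemma mv_sum: "mv M (\<Sum>a\<in>A. f a) = (\<Sum>a\<in>A. mv M (f a))"
proof (induction A rule: infinite_finite_induct)
  case (insert x F)
  show ?case unfolding sum.insert[OF insert(1,2)] mv_add insert(3) ..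
qed (simp_all only: sum.infinite sum.empty mv_0 not_False_eq_True)

lemma mv_mult:
  assumes "A \<in> carrier_mat l m" "B \<in> carrier_mat m n"
  shows "mv (A * B) v = mv A (mv B v)"
proof
  fix i
  show "mv (A * B) v i = mv A (mv B v) i"
  proof (cases "i < l")
    case True
    have "(\<Sum>j<n. (\<Sum>k<m. A $$ (i, k) * B $$ (k, j)) * v j) = (\<Sum>k<m. A $$ (i, k) * (\<Sum>j<n. B $$ (k, j) * v j))"
      by (simp add: sum_distrib_left sum_distrib_right mult.assoc) (rule sum.swap)
    then show ?thesis using True assms
      by (simp add: mv_def scalar_prod_def atLeast0LessThan)
  qed (use assms in \<open>auto simp: mv_def\<close>)
qed

lemma mv_one [simp]: "v \<in> vspace n \<Longrightarrow> mv (1\<^sub>m n) v = v"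
  by (rule ext) (auto simp: mv_def vspace_def one_mat_def if_distrib[of "\<lambda>x. x * _"] not_less cong: if_cong)

lemma mv_zero [simp]: "mv (0\<^sub>m m n) v = 0"
  by (rule ext) (auto simp: mv_def)

lemma mv_smult: "mv (c \<cdot>\<^sub>m A) v = sc c (mv A v)"
  by (rule ext) (auto simp: mv_def sum_distrib_left ac_simps)

lemma mv_msum:
  assumes "\<And>a. a \<in> S \<Longrightarrow> f a \<in> carrier_mat m n"
  shows "mv (msum m n S f) v = (\<Sum>a\<in>S. mv (f a) v)"
proof
  fix i
  have "mv (msum m n S f) v i = (if i < m then \<Sum>a\<in>S. \<Sum>j<n. f a $$ (i, j) * v j else 0)"
    by (simp add: mv_def msum_def sum_distrib_right) (simp add: sum.swap[of _ S])
  also have "\<dots> = (\<Sum>a\<in>S. mv (f a) v i)"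
  proof -
    have "mv (f a) v i = (if i < m then \<Sum>j<n. f a $$ (i, j) * v j else 0)" if "a \<in> S" for a
      using assms[OF that] by (auto simp: mv_def)
    then show ?thesis by simp
  qed
  finally show "mv (msum m n S f) v i = (\<Sum>a\<in>S. mv (f a) v) i" by (simp add: sum_fun_apply)
qed

lemma msum_carrier [simp]: "msum m n S f \<in> carrier_mat m n" by (simp add: msum_def)
lemma kron_carrier [simp]:
  "A \<in> carrier_mat m n \<Longrightarrow> B \<in> carrier_mat k l \<Longrightarrow> kron A B \<in> carrier_mat (m * k) (n * l)"
  by (simp add: kron_def)
lemma swap_mat_carrier [simp]: "swap_mat m n \<in> carrier_mat (n * m) (m * n)"
  by (simp add: swap_mat_def)

lemma mv_unitv:
  assumes "A \<in> carrier_mat m n" "i < m" "j < n"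
  shows "mv A (unitv j) i = A $$ (i, j)"
  using assms by (auto simp: mv_def unitv_def if_distrib[of "\<lambda>x. _ * x"] cong: if_cong)

lemma mat_eqI_mv:
  assumes "A \<in> carrier_mat m n" "B \<in> carrier_mat m n" "\<And>v. v \<in> vspace n \<Longrightarrow> mv A v = mv B v"
  shows "A = B"
proof (rule eq_matI)
  fix i j assume "i < dim_row B" "j < dim_col B"
  then show "A $$ (i, j) = B $$ (i, j)"
    using assms mv_unitv[of A m n i j] mv_unitv[of B m n i j] by (auto simp: assms(3)[OF vspace_unitv])
qed (use assms in auto)

text \<open>Turns a linear map given by a formula into a matrix; needed where an intertwiner is
  built by averaging.\<close>

lemma ex_mat_linear:
  assumes "\<And>v. v \<in> vspace n \<Longrightarrow> f v \<in> vspace m"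
    and "\<And>v w. v \<in> vspace n \<Longrightarrow> w \<in> vspace n \<Longrightarrow> f (v + w) = f v + f w"
    and "\<And>c v. v \<in> vspace n \<Longrightarrow> f (sc c v) = sc c (f v)"
  obtains A where "A \<in> carrier_mat m n" "\<And>v. v \<in> vspace n \<Longrightarrow> mv A v = f v"
proof
  define A where "A = mat m n (\<lambda>(i, j). f (unitv j) i)"
  show "A \<in> carrier_mat m n" by (simp add: A_def)
  fix v assume v: "v \<in> vspace n"
  have f0: "f 0 = 0" using assms(3)[of 0 0] by simp
  have fs: "f (\<Sum>j\<in>S. sc (v j) (unitv j)) = (\<Sum>j\<in>S. sc (v j) (f (unitv j)))" if "S \<subseteq> {..<n}" for S
    using finite_subset[OF that finite_lessThan] that
  proof (induction S rule: finite_induct)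
    case (insert x F)
    then have "(\<Sum>j\<in>F. sc (v j) (unitv j)) \<in> vspace n" by (intro vspace_sum) auto
    moreover have "x < n" using insert by auto
    ultimately have "f (sc (v x) (unitv x) + (\<Sum>j\<in>F. sc (v j) (unitv j))) =
        sc (v x) (f (unitv x)) + (\<Sum>j\<in>F. sc (v j) (f (unitv j)))"
      using insert by (simp only: assms vspace_sc vspace_unitv insert_subset)
    then show ?case by (simp only: sum.insert[OF insert(1,2)])
  qed (simp only: f0 sum.empty)
  have "f v = (\<Sum>j<n. sc (v j) (f (unitv j)))"
    using fs[OF subset_refl] vspace_expand[OF v] by simp
  moreover have "f (unitv j) i = 0" if "i \<ge> m" "j < n" for i j
    using assms(1)[OF vspace_unitv[OF that(2)]] that(1) by (simp add: vspace_def)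
  ultimately show "mv A v = f v"
    by (auto simp: mv_def A_def fun_eq_iff sum_fun_apply mult.commute)
qed

lemma sum_div_mod: "(\<Sum>k<m * n. f (k div n) (k mod n)) = (\<Sum>i<m. \<Sum>j<(n::nat). f i j)"
  for f :: "nat \<Rightarrow> nat \<Rightarrow> 'a::comm_monoid_add"
proof -
  have "(\<Sum>k<m * n. f (k div n) (k mod n)) = (\<Sum>i<m. \<Sum>k=i*n..<i*n+n. f (k div n) (k mod n))"
    by (rule sum.nat_group[symmetric])
  also have "\<dots> = (\<Sum>i<m. \<Sum>j<n. f i j)"
  proof (rule sum.cong[OF refl])
    fix i
    have ge: "k div n = i" "k mod n = k - i * n" if "i * n \<le> k" "k < i * n + n" for k
      using that by (auto intro!: div_nat_eqI simp: algebra_simps)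
        (metis div_nat_eqI minus_mult_div_eq_mod mult.commute add.commute mult_Suc)
    show "(\<Sum>k=i*n..<i*n+n. f (k div n) (k mod n)) = (\<Sum>j<n. f i j)"
      by (rule sum.reindex_bij_witness[of _ "\<lambda>j. i * n + j" "\<lambda>k. k - i * n"])
        (auto simp: ge)
  qed
  finally show ?thesis .
qed

section \<open>Pure tensors, Kronecker products and the flip\<close>

lemma tens_vspace [simp]:
  assumes "v \<in> vspace m" "w \<in> vspace n"
  shows "tens n v w \<in> vspace (m * n)"
  unfolding vspace_def
proof safe
  fix i assume i: "m * n \<le> i"
  show "tens n v w i = 0"
  \<comment> \<open>For n = 0 division returns index 0 and the left factor gives no information; but
    then \<open>w\<close> is zero.\<close>
  proof (cases "n = 0")
    case False
    then have "m \<le> i div n" using i by (simp add: less_eq_div_iff_mult_less_eq)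
    then show ?thesis using assms by (simp add: tens_def vspace_def)
  qed (use assms in \<open>auto simp: tens_def vspace_def\<close>)
qed

lemma tens_0 [simp]: "tens n 0 w = 0" "tens n v 0 = 0" by (auto simp: tens_def fun_eq_iff)
lemma tens_sc [simp]: "tens n (sc a v) w = sc a (tens n v w)" "tens n v (sc a w) = sc a (tens n v w)"
  by (auto simp: tens_def fun_eq_iff)
lemma tens_sum_left: "tens n (\<Sum>a\<in>A. f a) w = (\<Sum>a\<in>A. tens n (f a) w)"
  by (rule ext) (simp add: tens_def sum_fun_apply sum_distrib_right)
lemma tens_sum_right: "tens n v (\<Sum>a\<in>A. f a) = (\<Sum>a\<in>A. tens n v (f a))"
  by (rule ext) (simp add: tens_def sum_fun_apply sum_distrib_left)

text \<open>Both bracketings unfold to the same index arithmetic, which is why the associativity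
  constraint is an identity matrix.\<close>

lemma tens_assoc: "tens (n * p) u (tens p v w) = tens p (tens n u v) w"
proof
  fix k
  have "k div (n * p) = k div p div n" by (metis div_mult2_eq mult.commute)
  moreover have "k mod (n * p) div p = k div p mod n"
  proof (cases "p = 0")
    case False
    have "k mod (n * p) = p * (k div p mod n) + k mod p" by (metis mod_mult2_eq mult.commute)
    then show ?thesis using False by simp
  qed simp
  moreover have "k mod (n * p) mod p = k mod p" by (simp add: mod_mod_cancel)
  ultimately show "tens (n * p) u (tens p v w) k = tens p (tens n u v) w k"
    by (simp add: tens_def mult.assoc)
qed

lemma mv_kron_tens:
  assumes A: "A \<in> carrier_mat m m'" and B: "B \<in> carrier_mat n n'"
  shows "mv (kron A B) (tens n' v w) = tens n (mv A v) (mv B w)"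
proof
  fix i
  show "mv (kron A B) (tens n' v w) i = tens n (mv A v) (mv B w) i"
  proof (cases "i < m * n")
    case True
    then have n: "n > 0" by (cases n) auto
    have i: "i div n < m" "i mod n < n" using True n by (auto simp: less_mult_imp_div_less)
    have "mv (kron A B) (tens n' v w) i =
      (\<Sum>k<m' * n'. (A $$ (i div n, k div n') * v (k div n')) * (B $$ (i mod n, k mod n') * w (k mod n')))"
      using True A B by (simp add: mv_def kron_def tens_def ac_simps)
    also have "\<dots> = (\<Sum>p<m'. \<Sum>q<n'. (A $$ (i div n, p) * v p) * (B $$ (i mod n, q) * w q))"
      by (rule sum_div_mod)
    also have "\<dots> = tens n (mv A v) (mv B w) i"
      using A B i by (simp add: tens_def mv_def sum_product)
    finally show ?thesis .
  next
    case False
    then show ?thesis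
      using kron_carrier[OF A B, THEN mv_vspace, of "tens n' v w"]
        tens_vspace[OF mv_vspace[OF A] mv_vspace[OF B], of v w]
      by (simp add: vspace_def not_less)
  qed
qed

lemma mv_swap_tens:
  assumes v: "v \<in> vspace m" and w: "w \<in> vspace n"
  shows "mv (swap_mat m n) (tens n v w) = tens m w v"
proof
  fix r
  show "mv (swap_mat m n) (tens n v w) r = tens m w v r"
  proof (cases "r < n * m")
    case True
    then have m: "m > 0" by (cases m) auto
    have r: "r div m < n" "r mod m < m" using True m by (auto simp: less_mult_imp_div_less)
    have eq: "r = q * m + p \<longleftrightarrow> p = r mod m \<and> q = r div m" if "p < m" for p q
      using that by auto
    have "mv (swap_mat m n) (tens n v w) r =
      (\<Sum>k<m * n. (if r = (k mod n) * m + k div n then v (k div n) * w (k mod n) else 0))"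
      using True by (auto simp: mv_def swap_mat_def tens_def intro!: sum.cong)
    also have "\<dots> = (\<Sum>p<m. \<Sum>q<n. (if r = q * m + p then v p * w q else 0))"
      by (rule sum_div_mod)
    also have "\<dots> = (\<Sum>p<m. \<Sum>q<n. (if q = r div m then if p = r mod m then v p * w q else 0 else 0))"
      by (intro sum.cong refl) (auto simp: eq)
    also have "\<dots> = (\<Sum>p<m. if p = r mod m then v p * w (r div m) else 0)"
      by (intro sum.cong refl) (use r in \<open>simp add: sum.delta\<close>)
    also have "\<dots> = tens m w v r"
      using r by (simp add: tens_def sum.delta)
    finally show ?thesis .
  next
    case False
    then show ?thesis
      using swap_mat_carrier[of m n, THEN mv_vspace, of "tens n v w"] tens_vspace[OF w v]
      by (simp add: vspace_def not_less)
  qed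
qed

lemma unitv_tens: "k < m * n \<Longrightarrow> unitv k = tens n (unitv (k div n)) (unitv (k mod n))"
  by (auto simp: unitv_def tens_def fun_eq_iff) (metis div_mult_mod_eq)

text \<open>Basis vectors of the product are pure tensors of basis vectors.\<close>

lemma mat_eqI_tens:
  assumes A: "A \<in> carrier_mat l (m * n)" and B: "B \<in> carrier_mat l (m * n)"
    and "\<And>v w. v \<in> vspace m \<Longrightarrow> w \<in> vspace n \<Longrightarrow> mv A (tens n v w) = mv B (tens n v w)"
  shows "A = B"
proof (rule eq_matI)
  fix i j assume "i < dim_row B" "j < dim_col B"
  then have ij: "i < l" "j < m * n" using B by auto
  then have n: "n > 0" by (cases n) auto
  have "j div n < m" "j mod n < n" using ij n by (auto simp: less_mult_imp_div_less)
  then have "mv A (unitv j) = mv B (unitv j)" using assms(3) ij by (simp add: unitv_tens[of j m n])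
  then show "A $$ (i, j) = B $$ (i, j)" using mv_unitv[OF A ij] mv_unitv[OF B ij] by simp
qed (use assms in auto)

text \<open>Applied to vectors, these rules make the simplifier eta-expand sums.\<close>

declare plus_fun_apply [simp del] zero_fun_apply [simp del] sc_apply [simp del]

subsection \<open>Representations as graded spaces with a group action\<close>

abbreviation act :: "'g drep \<Rightarrow> 'g \<Rightarrow> 'g \<Rightarrow> (nat \<Rightarrow> complex) \<Rightarrow> nat \<Rightarrow> complex" where
  "act X g h v \<equiv> mv (dact X g h) v"

locale finite_fgrp =
  fixes G :: "'g fgrp"
  assumes fin: "finite (gcar G)"
    and one_in [simp]: "gone G \<in> gcar G"
    and mul_in [simp]: "g \<in> gcar G \<Longrightarrow> h \<in> gcar G \<Longrightarrow> gmul G g h \<in> gcar G"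
    and inv_in [simp]: "g \<in> gcar G \<Longrightarrow> ginv G g \<in> gcar G"
    and assoc: "g \<in> gcar G \<Longrightarrow> h \<in> gcar G \<Longrightarrow> k \<in> gcar G \<Longrightarrow>
      gmul G (gmul G g h) k = gmul G g (gmul G h k)"
    and l_one [simp]: "g \<in> gcar G \<Longrightarrow> gmul G (gone G) g = g"
    and l_inv [simp]: "g \<in> gcar G \<Longrightarrow> gmul G (ginv G g) g = gone G"
begin

abbreviation mul (infixl "\<cdot>" 70) where "g \<cdot> h \<equiv> gmul G g h"
abbreviation inv' ("\<star>_" [81] 80) where "\<star>g \<equiv> ginv G g"
abbreviation unit' ("\<e>") where "\<e> \<equiv> gone G"

lemma l_cancel [simp]: "g \<in> gcar G \<Longrightarrow> h \<in> gcar G \<Longrightarrow> \<star>g \<cdot> (g \<cdot> h) = h"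
  by (simp flip: assoc)
lemma r_inv [simp]: "g \<in> gcar G \<Longrightarrow> g \<cdot> \<star>g = \<e>"
  by (metis assoc inv_in l_cancel l_inv l_one mul_in)
lemma l_cancel' [simp]: "g \<in> gcar G \<Longrightarrow> h \<in> gcar G \<Longrightarrow> g \<cdot> (\<star>g \<cdot> h) = h"
  by (simp flip: assoc)
lemma r_one [simp]: "g \<in> gcar G \<Longrightarrow> g \<cdot> \<e> = g"
  by (metis assoc inv_in l_inv r_inv l_one)
lemma inv_unique: "g \<in> gcar G \<Longrightarrow> h \<in> gcar G \<Longrightarrow> g \<cdot> h = \<e> \<Longrightarrow> \<star>g = h"
  by (metis inv_in l_cancel r_one)
lemma inv_inv [simp]: "g \<in> gcar G \<Longrightarrow> \<star>(\<star>g) = g"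
  by (simp add: inv_unique)
lemma inv_mul [simp]: "g \<in> gcar G \<Longrightarrow> h \<in> gcar G \<Longrightarrow> \<star>(g \<cdot> h) = \<star>h \<cdot> \<star>g"
  by (rule inv_unique) (simp_all add: assoc)
lemma inv_one [simp]: "\<star>\<e> = \<e>"
  by (rule inv_unique) simp_all
lemma mul_left_iff: "g \<in> gcar G \<Longrightarrow> h \<in> gcar G \<Longrightarrow> k \<in> gcar G \<Longrightarrow> h = \<star>g \<cdot> k \<longleftrightarrow> k = g \<cdot> h"
  by auto
lemma conj_iff: "g \<in> gcar G \<Longrightarrow> h \<in> gcar G \<Longrightarrow> k \<in> gcar G \<Longrightarrow>
    h = \<star>g \<cdot> k \<cdot> g \<longleftrightarrow> k = g \<cdot> h \<cdot> \<star>g"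
  by (auto simp: assoc)

lemma sum_mult_left: "g \<in> gcar G \<Longrightarrow> (\<Sum>k\<in>gcar G. f (g \<cdot> k)) = (\<Sum>k\<in>gcar G. f k)"
  for f :: "'g \<Rightarrow> 'b::comm_monoid_add"
  by (rule sum.reindex_bij_witness[of _ "\<lambda>k. \<star>g \<cdot> k" "\<lambda>k. g \<cdot> k"]) auto

lemma dact_carrier: "is_drep G X \<Longrightarrow> g \<in> gcar G \<Longrightarrow> h \<in> gcar G \<Longrightarrow>
    dact X g h \<in> carrier_mat (ddim X) (ddim X)"
  by (simp add: is_drep_def)

lemma act_vspace: "is_drep G X \<Longrightarrow> g \<in> gcar G \<Longrightarrow> h \<in> gcar G \<Longrightarrow> act X g h v \<in> vspace (ddim X)"
  by (rule mv_vspace[OF dact_carrier])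

lemma act_act:
  assumes X: "is_drep G X" and g: "g1 \<in> gcar G" "h1 \<in> gcar G" "g2 \<in> gcar G" "h2 \<in> gcar G"
  shows "act X g1 h1 (act X g2 h2 v) = (if h2 = \<star>g2 \<cdot> h1 \<cdot> g2 then act X (g1 \<cdot> g2) h2 v else 0)"
proof -
  have "act X g1 h1 (act X g2 h2 v) = mv (dact X g1 h1 * dact X g2 h2) v"
    by (rule mv_mult[OF dact_carrier[OF X g(1,2)] dact_carrier[OF X g(3,4)], symmetric])
  also have "dact X g1 h1 * dact X g2 h2 =
      (if h2 = \<star>g2 \<cdot> h1 \<cdot> g2 then dact X (g1 \<cdot> g2) h2 else 0\<^sub>m (ddim X) (ddim X))"
    using X g unfolding is_drep_def by blast
  finally show ?thesis by simp
qed

lemma sum_act_one: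
  assumes X: "is_drep G X" and v: "v \<in> vspace (ddim X)"
  shows "(\<Sum>h\<in>gcar G. act X \<e> h v) = v"
proof -
  have "(\<Sum>h\<in>gcar G. act X \<e> h v) = mv (msum (ddim X) (ddim X) (gcar G) (\<lambda>h. dact X \<e> h)) v"
    using dact_carrier[OF X] by (simp add: mv_msum)
  then show ?thesis using X v by (simp add: is_drep_def)
qed

lemma is_drepI:
  assumes c: "\<And>g h. g \<in> gcar G \<Longrightarrow> h \<in> gcar G \<Longrightarrow> dact X g h \<in> carrier_mat (ddim X) (ddim X)"
    and m: "\<And>g1 h1 g2 h2 v. g1 \<in> gcar G \<Longrightarrow> h1 \<in> gcar G \<Longrightarrow> g2 \<in> gcar G \<Longrightarrow> h2 \<in> gcar G \<Longrightarrow>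
      v \<in> vspace (ddim X) \<Longrightarrow>
      act X g1 h1 (act X g2 h2 v) = (if h2 = \<star>g2 \<cdot> h1 \<cdot> g2 then act X (g1 \<cdot> g2) h2 v else 0)"
    and s: "\<And>v. v \<in> vspace (ddim X) \<Longrightarrow> (\<Sum>h\<in>gcar G. act X \<e> h v) = v"
  shows "is_drep G X"
  unfolding is_drep_def
proof (intro conjI ballI)
  fix g1 h1 g2 h2 assume g: "g1 \<in> gcar G" "h1 \<in> gcar G" "g2 \<in> gcar G" "h2 \<in> gcar G"
  have "dact X (g1 \<cdot> g2) (\<star>g2 \<cdot> h1 \<cdot> g2) \<in> carrier_mat (ddim X) (ddim X)"
    by (rule c) (use g in simp_all)
  then show "dact X g1 h1 * dact X g2 h2 =
      (if h2 = \<star>g2 \<cdot> h1 \<cdot> g2 then dact X (g1 \<cdot> g2) h2 else 0\<^sub>m (ddim X) (ddim X))"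
    by (intro mat_eqI_mv[where m="ddim X" and n="ddim X"])
      (use g m[OF g] c[OF g(1,2)] c[OF g(3,4)] c[OF mul_in[OF g(1,3)] g(4)]
        mv_mult[OF c[OF g(1,2)] c[OF g(3,4)]] in simp_all)
next
  show "msum (ddim X) (ddim X) (gcar G) (\<lambda>h. dact X \<e> h) = 1\<^sub>m (ddim X)"
    by (rule mat_eqI_mv[where m="ddim X" and n="ddim X"]) (use c s in \<open>auto simp: mv_msum\<close>)
qed (use c in auto)

definition flux :: "'g drep \<Rightarrow> 'g \<Rightarrow> (nat \<Rightarrow> complex) set" where
  "flux X h = {v \<in> vspace (ddim X). act X \<e> h v = v}"

text \<open>In the double, the group element g is the sum of the basis elements \<open>g h*\<close>
  over h. With the projections onto the flux spaces it generates the whole action, since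
  \<open>g h*\<close> is g after the projection to flux h.\<close>

definition gact :: "'g drep \<Rightarrow> 'g \<Rightarrow> (nat \<Rightarrow> complex) \<Rightarrow> nat \<Rightarrow> complex" where
  "gact X g v = (\<Sum>h\<in>gcar G. act X g h v)"

definition gmat :: "'g drep \<Rightarrow> 'g \<Rightarrow> complex mat" where
  "gmat X g = msum (ddim X) (ddim X) (gcar G) (dact X g)"

lemma gmat_carrier [simp]: "gmat X g \<in> carrier_mat (ddim X) (ddim X)"
  by (simp add: gmat_def)

lemma mv_gmat: "is_drep G X \<Longrightarrow> g \<in> gcar G \<Longrightarrow> mv (gmat X g) v = gact X g v"
  by (simp add: gmat_def gact_def mv_msum dact_carrier)

lemma gact_sum: "gact X g (\<Sum>a\<in>A. f a) = (\<Sum>a\<in>A. gact X g (f a))"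
  unfolding gact_def mv_sum by (rule sum.swap)
lemma gact_sc: "gact X g (sc c v) = sc c (gact X g v)"
  by (simp add: gact_def mv_sc sc_sum)
lemma gact_zero [simp]: "gact X g 0 = 0"
  by (simp add: gact_def)
lemma gact_vspace [simp]: "is_drep G X \<Longrightarrow> g \<in> gcar G \<Longrightarrow> gact X g v \<in> vspace (ddim X)"
  by (simp add: gact_def act_vspace)

lemma flux_vspace: "v \<in> flux X h \<Longrightarrow> v \<in> vspace (ddim X)" by (simp add: flux_def)
lemma flux_sc [simp]: "v \<in> flux X h \<Longrightarrow> sc c v \<in> flux X h" by (simp add: flux_def mv_sc)
lemma flux_zero [simp]: "0 \<in> flux X h" by (simp add: flux_def)
lemma flux_sum [simp]: "(\<And>a. a \<in> A \<Longrightarrow> f a \<in> flux X h) \<Longrightarrow> (\<Sum>a\<in>A. f a) \<in> flux X h"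
  by (simp add: flux_def mv_sum)

context
  fixes X assumes X: "is_drep G X"
begin

lemma act_flux_eq_gact:
  assumes v: "v \<in> flux X h" and "g \<in> gcar G" "h \<in> gcar G" "h' \<in> gcar G"
  shows "act X g h' v = (if h' = h then gact X g v else 0)"
proof -
  have v': "act X \<e> h v = v" using v by (simp add: flux_def)
  have 1: "act X g k v = (if k = h then act X g h v else 0)" if "k \<in> gcar G" for k
    using act_act[OF X, of g k \<e> h v] assms that by (auto simp: v')
  have "gact X g v = act X g h v"
    unfolding gact_def using assms fin by (subst sum.cong[OF refl 1]) (auto simp: sum.delta)
  with 1[of h'] assms show ?thesis by simp
qed

lemma act_one_flux [simp]:
  "h \<in> gcar G \<Longrightarrow> act X \<e> h v \<in> flux X h"
  using act_act[OF X, of \<e> h \<e> h v] by (simp add: flux_def act_vspace[OF X])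

lemma act_eq_gact_act: "g \<in> gcar G \<Longrightarrow> h \<in> gcar G \<Longrightarrow> act X g h v = gact X g (act X \<e> h v)"
  using act_flux_eq_gact[of "act X \<e> h v" h g h] act_act[OF X, of g h \<e> h v] by simp

lemma gact_flux:
  assumes v: "v \<in> flux X h" and gh: "g \<in> gcar G" "h \<in> gcar G"
  shows "gact X g v \<in> flux X (g \<cdot> h \<cdot> \<star>g)"
proof -
  have "gact X g v = act X g h v" using act_flux_eq_gact[OF v] gh by simp
  with act_act[OF X, of \<e> "g \<cdot> h \<cdot> \<star>g" g h v] gh show ?thesis
    by (simp add: flux_def act_vspace[OF X] assoc)
qed

lemma gact_gact:
  assumes g: "g1 \<in> gcar G" "g2 \<in> gcar G"
  shows "gact X g1 (gact X g2 v) = gact X (g1 \<cdot> g2) v"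
proof -
  have "gact X g1 (gact X g2 v) = (\<Sum>h2\<in>gcar G. \<Sum>h1\<in>gcar G. act X g1 h1 (act X g2 h2 v))"
    by (simp add: gact_def mv_sum) (rule sum.swap)
  also have "\<dots> = (\<Sum>h2\<in>gcar G. \<Sum>h1\<in>gcar G. if h1 = g2 \<cdot> h2 \<cdot> \<star>g2 then act X (g1 \<cdot> g2) h2 v else 0)"
    using g by (intro sum.cong refl) (simp add: act_act[OF X] conj_iff)
  also have "\<dots> = gact X (g1 \<cdot> g2) v"
    unfolding gact_def using g fin by (intro sum.cong refl) (simp add: sum.delta)
  finally show ?thesis .
qed

lemma gact_one [simp]: "v \<in> vspace (ddim X) \<Longrightarrow> gact X \<e> v = v"
  by (simp add: gact_def sum_act_one[OF X])

lemma flux_expand: "v \<in> vspace (ddim X) \<Longrightarrow> (\<Sum>h\<in>gcar G. act X \<e> h v) = v"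
  by (rule sum_act_one[OF X])

text \<open>Every vector is the sum of its flux components. Most computations below start with this
  reduction or with its tensor versions.\<close>

lemma mat_eqI_flux:
  assumes A: "A \<in> carrier_mat m (ddim X)" and B: "B \<in> carrier_mat m (ddim X)"
    and eq: "\<And>v h. h \<in> gcar G \<Longrightarrow> v \<in> flux X h \<Longrightarrow> mv A v = mv B v"
  shows "A = B"
proof (rule mat_eqI_mv[OF A B])
  fix v assume v: "v \<in> vspace (ddim X)"
  have "mv A (\<Sum>h\<in>gcar G. act X \<e> h v) = mv B (\<Sum>h\<in>gcar G. act X \<e> h v)"
    unfolding mv_sum by (intro sum.cong refl eq[OF _ act_one_flux]) auto
  then show "mv A v = mv B v" by (simp only: flux_expand[OF v])
qed

end

lemma mat_eqI_tens_flux: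
  assumes X: "is_drep G X" and Y: "is_drep G Y"
    and A: "A \<in> carrier_mat l (ddim X * ddim Y)" and B: "B \<in> carrier_mat l (ddim X * ddim Y)"
    and eq: "\<And>h k v w. h \<in> gcar G \<Longrightarrow> k \<in> gcar G \<Longrightarrow> v \<in> flux X h \<Longrightarrow> w \<in> flux Y k \<Longrightarrow>
      mv A (tens (ddim Y) v w) = mv B (tens (ddim Y) v w)"
  shows "A = B"
proof (rule mat_eqI_tens[OF A B])
  fix v w assume v: "v \<in> vspace (ddim X)" and w: "w \<in> vspace (ddim Y)"
  have "mv A (tens (ddim Y) (\<Sum>h\<in>gcar G. act X \<e> h v) (\<Sum>k\<in>gcar G. act Y \<e> k w)) =
      mv B (tens (ddim Y) (\<Sum>h\<in>gcar G. act X \<e> h v) (\<Sum>k\<in>gcar G. act Y \<e> k w))"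
    unfolding mv_sum tens_sum_left tens_sum_right
    by (intro sum.cong refl eq[OF _ _ act_one_flux[OF X] act_one_flux[OF Y]]) auto
  then show "mv A (tens (ddim Y) v w) = mv B (tens (ddim Y) v w)"
    by (simp only: flux_expand[OF X v] flux_expand[OF Y w])
qed

subsection \<open>Morphisms\<close>

lemma dhom_act:
  assumes "is_drep G X" "is_drep G Y" "T \<in> dhom G X Y" "g \<in> gcar G" "h \<in> gcar G"
  shows "mv T (act X g h v) = act Y g h (mv T v)"
proof -
  have T: "T \<in> carrier_mat (ddim Y) (ddim X)" "T * dact X g h = dact Y g h * T"
    using assms by (auto simp: dhom_def)
  show ?thesis
    using mv_mult[OF T(1) dact_carrier[OF assms(1,4,5)], of v]
      mv_mult[OF dact_carrier[OF assms(2,4,5)] T(1), of v] T(2) by simp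
qed

lemma dhom_gact:
  assumes "is_drep G X" "is_drep G Y" "T \<in> dhom G X Y" "g \<in> gcar G"
  shows "mv T (gact X g v) = gact Y g (mv T v)"
  unfolding gact_def mv_sum using assms by (intro sum.cong refl dhom_act)

lemma dhom_flux:
  assumes "is_drep G X" "is_drep G Y" "T \<in> dhom G X Y" "h \<in> gcar G" "v \<in> flux X h"
  shows "mv T v \<in> flux Y h"
  using dhom_act[OF assms(1-3) one_in assms(4), of v] assms mv_vspace[of T "ddim Y" "ddim X" v]
  by (auto simp: flux_def dhom_def)

lemma dhomI:
  assumes X: "is_drep G X" and Y: "is_drep G Y" and T: "T \<in> carrier_mat (ddim Y) (ddim X)"
    and f: "\<And>h v. h \<in> gcar G \<Longrightarrow> v \<in> vspace (ddim X) \<Longrightarrow> mv T (act X \<e> h v) = act Y \<e> h (mv T v)"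
    and g: "\<And>g v. g \<in> gcar G \<Longrightarrow> v \<in> vspace (ddim X) \<Longrightarrow> mv T (gact X g v) = gact Y g (mv T v)"
  shows "T \<in> dhom G X Y"
  unfolding dhom_def
proof (intro CollectI conjI ballI T)
  fix g h assume gh: "g \<in> gcar G" "h \<in> gcar G"
  show "T * dact X g h = dact Y g h * T"
  proof (rule mat_eqI_mv)
    show "T * dact X g h \<in> carrier_mat (ddim Y) (ddim X)" "dact Y g h * T \<in> carrier_mat (ddim Y) (ddim X)"
      using T dact_carrier[OF X gh] dact_carrier[OF Y gh] by auto
    fix v assume v: "v \<in> vspace (ddim X)"
    have "mv (T * dact X g h) v = mv T (gact X g (act X \<e> h v))"
      unfolding mv_mult[OF T dact_carrier[OF X gh]] act_eq_gact_act[OF X gh] ..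
    also have "\<dots> = gact Y g (act Y \<e> h (mv T v))"
      using gh v by (simp add: f g act_vspace[OF X])
    also have "\<dots> = mv (dact Y g h * T) v"
      unfolding mv_mult[OF dact_carrier[OF Y gh] T] act_eq_gact_act[OF Y gh] ..
    finally show "mv (T * dact X g h) v = mv (dact Y g h * T) v" .
  qed
qed

lemma dhom_fluxI:
  assumes X: "is_drep G X" and Y: "is_drep G Y" and T: "T \<in> carrier_mat (ddim Y) (ddim X)"
    and f: "\<And>h v. h \<in> gcar G \<Longrightarrow> v \<in> flux X h \<Longrightarrow> mv T v \<in> flux Y h"
    and g: "\<And>g h v. g \<in> gcar G \<Longrightarrow> h \<in> gcar G \<Longrightarrow> v \<in> flux X h \<Longrightarrow> mv T (gact X g v) = gact Y g (mv T v)"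
  shows "T \<in> dhom G X Y"
proof (rule dhomI[OF X Y T])
  fix h v assume h: "h \<in> gcar G" and v: "v \<in> vspace (ddim X)"
  have "mv T (act X \<e> h v) = act Y \<e> h (\<Sum>k\<in>gcar G. mv T (act X \<e> k v))"
  proof -
    \<comment> \<open>The image of the k-component has flux k, so the projection to flux h keeps
      only k = h.\<close>
    have "act Y \<e> h (mv T (act X \<e> k v)) = (if h = k then mv T (act X \<e> h v) else 0)" if "k \<in> gcar G" for k
      using act_flux_eq_gact[OF Y f[OF that act_one_flux[OF X that]] one_in that h] that h
      by (auto simp: gact_one[OF Y] mv_vspace[OF T])
    then show ?thesis using h fin by (simp add: mv_sum sum.delta')
  qed
  also have "(\<Sum>k\<in>gcar G. mv T (act X \<e> k v)) = mv T v"
    by (simp only: flux_expand[OF X v] flip: mv_sum)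
  finally show "mv T (act X \<e> h v) = act Y \<e> h (mv T v)" .
next
  fix k v assume k: "k \<in> gcar G" and v: "v \<in> vspace (ddim X)"
  have "mv T (gact X k (\<Sum>h\<in>gcar G. act X \<e> h v)) = gact Y k (mv T (\<Sum>h\<in>gcar G. act X \<e> h v))"
    unfolding mv_sum gact_sum by (intro sum.cong refl g[OF k _ act_one_flux[OF X]]) auto
  then show "mv T (gact X k v) = gact Y k (mv T v)" by (simp only: flux_expand[OF X v])
qed

text \<open>The matrix inverse of an intertwiner intertwines automatically, so only invertibility
  has to be shown.\<close>

lemma is_iso_morI:
  assumes T: "T \<in> dhom G X Y" and X: "is_drep G X" and Y: "is_drep G Y"
    and S: "S \<in> carrier_mat (ddim X) (ddim Y)" "S * T = 1\<^sub>m (ddim X)" "T * S = 1\<^sub>m (ddim Y)"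
  shows "is_iso_mor G X Y T"
proof -
  have Tc: "T \<in> carrier_mat (ddim Y) (ddim X)" using T by (simp add: dhom_def)
  have "S \<in> dhom G Y X"
    unfolding dhom_def
  proof (intro CollectI conjI ballI S)
    fix g h assume gh: "g \<in> gcar G" "h \<in> gcar G"
    note cX = dact_carrier[OF X gh] and cY = dact_carrier[OF Y gh]
    have 1: "mv S (mv T v) = v" if "v \<in> vspace (ddim X)" for v
      using mv_mult[OF S(1) Tc, of v] that S by simp
    have 2: "mv T (mv S v) = v" if "v \<in> vspace (ddim Y)" for v
      using mv_mult[OF Tc S(1), of v] that S by simp
    show "S * dact Y g h = dact X g h * S"
    proof (rule mat_eqI_mv)
      fix v assume v: "v \<in> vspace (ddim Y)"
      have "mv (S * dact Y g h) v = mv S (act Y g h (mv T (mv S v)))"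
        using v by (simp add: mv_mult[OF S(1) cY] 2)
      also have "\<dots> = mv (dact X g h * S) v"
        by (simp add: dhom_act[OF X Y T gh, symmetric] 1 mv_vspace[OF cX] mv_mult[OF cX S(1)])
      finally show "mv (S * dact Y g h) v = mv (dact X g h * S) v" .
    qed (rule mult_carrier_mat[OF S(1) cY] mult_carrier_mat[OF cX S(1)])+
  qed
  with T S show ?thesis by (auto simp: is_iso_mor_def)
qed

lemma diso_sym: "diso G X Y \<Longrightarrow> diso G Y X"
  by (auto simp: diso_def is_iso_mor_def)

lemma diso_mono:
  assumes "diso G X Y" "is_drep G X" "is_drep G Y"
  obtains T where "T \<in> dhom G X Y" "\<And>v. v \<in> vspace (ddim X) \<Longrightarrow> mv T v = 0 \<Longrightarrow> v = 0"
proof -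
  obtain T S where TS: "T \<in> dhom G X Y" "S \<in> dhom G Y X" "S * T = 1\<^sub>m (ddim X)"
    using assms by (auto simp: diso_def is_iso_mor_def)
  have "v = mv S (mv T v)" if "v \<in> vspace (ddim X)" for v
    using TS mv_mult[of S "ddim X" "ddim Y" T "ddim X" v] that by (simp add: dhom_def)
  with TS(1) that show thesis by (metis mv_0)
qed

subsection \<open>Tensor products\<close>

lemma ddim_simps [simp]: "ddim (dtensor G X Y) = ddim X * ddim Y" "ddim (ddual G X) = ddim X"
  "ddim (dunit G) = 1"
  by (simp_all add: ddim_def dtensor_def ddual_def dunit_def)

lemma act_dtensor:
  assumes X: "is_drep G X" and Y: "is_drep G Y" and gh: "g \<in> gcar G" "h \<in> gcar G"
  shows "act (dtensor G X Y) g h (tens (ddim Y) v w) =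
    (\<Sum>k\<in>gcar G. tens (ddim Y) (act X g k v) (act Y g (\<star>k \<cdot> h) w))"
proof -
  have "act (dtensor G X Y) g h (tens (ddim Y) v w) =
     (\<Sum>k\<in>gcar G. mv (kron (dact X g k) (dact Y g (\<star>k \<cdot> h))) (tens (ddim Y) v w))"
    using gh by (simp add: dtensor_def dact_def mv_msum dact_carrier[OF X, unfolded dact_def]
        dact_carrier[OF Y, unfolded dact_def])
  then show ?thesis
    using gh by (simp add: mv_kron_tens[OF dact_carrier[OF X] dact_carrier[OF Y]])
qed

context
  fixes X Y assumes X: "is_drep G X" and Y: "is_drep G Y"
begin

text \<open>Fluxes multiply: on homogeneous vectors only the term of the comultiplication with first
  factor h survives.\<close>

lemma act_dtensor_flux:
  assumes v: "v \<in> flux X h" and w: "w \<in> flux Y k" and gh: "g \<in> gcar G" "l \<in> gcar G"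
    "h \<in> gcar G" "k \<in> gcar G"
  shows "act (dtensor G X Y) g l (tens (ddim Y) v w) =
    (if l = h \<cdot> k then tens (ddim Y) (gact X g v) (gact Y g w) else 0)"
proof -
  have "act (dtensor G X Y) g l (tens (ddim Y) v w) =
    (\<Sum>m\<in>gcar G. if m = h then (if l = h \<cdot> k then tens (ddim Y) (gact X g v) (gact Y g w) else 0) else 0)"
    unfolding act_dtensor[OF X Y gh(1,2)]
  proof (intro sum.cong refl)
    fix m assume m: "m \<in> gcar G"
    have "\<star>h \<cdot> l = k \<longleftrightarrow> l = h \<cdot> k" using mul_left_iff[of h k l] gh by auto
    then show "tens (ddim Y) (act X g m v) (act Y g (\<star>m \<cdot> l) w) =
      (if m = h then (if l = h \<cdot> k then tens (ddim Y) (gact X g v) (gact Y g w) else 0) else 0)"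
      using gh m by (simp add: act_flux_eq_gact[OF X v] act_flux_eq_gact[OF Y w])
  qed
  then show ?thesis using gh fin by simp
qed

lemma is_drep_dtensor: "is_drep G (dtensor G X Y)"
proof -
  let ?Z = "dtensor G X Y"
  have c: "dact ?Z g h \<in> carrier_mat (ddim X * ddim Y) (ddim X * ddim Y)" for g h
    by (simp add: dtensor_def dact_def)
  show ?thesis
    unfolding is_drep_def
  proof (intro conjI ballI)
    fix g1 h1 g2 h2 assume g: "g1 \<in> gcar G" "h1 \<in> gcar G" "g2 \<in> gcar G" "h2 \<in> gcar G"
    show "dact ?Z g1 h1 * dact ?Z g2 h2 =
        (if h2 = \<star>g2 \<cdot> h1 \<cdot> g2 then dact ?Z (g1 \<cdot> g2) h2 else 0\<^sub>m (ddim ?Z) (ddim ?Z))"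
    proof (rule mat_eqI_tens_flux[OF X Y, where l="ddim X * ddim Y"])
      fix h k v w assume hk: "h \<in> gcar G" "k \<in> gcar G" and vw: "v \<in> flux X h" "w \<in> flux Y k"
      \<comment> \<open>Conjugation is multiplicative, so the flux of a tensor moves as the fluxes
        of its factors do.\<close>
      have e: "(g2 \<cdot> h \<cdot> \<star>g2) \<cdot> (g2 \<cdot> k \<cdot> \<star>g2) = g2 \<cdot> (h \<cdot> k) \<cdot> \<star>g2"
        using g hk by (simp add: assoc)
      show "mv (dact ?Z g1 h1 * dact ?Z g2 h2) (tens (ddim Y) v w) =
        mv (if h2 = \<star>g2 \<cdot> h1 \<cdot> g2 then dact ?Z (g1 \<cdot> g2) h2 else 0\<^sub>m (ddim ?Z) (ddim ?Z)) (tens (ddim Y) v w)"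
        using g hk vw
        by (simp add: mv_mult[OF c c] act_dtensor_flux act_dtensor_flux[OF gact_flux[OF X] gact_flux[OF Y]]
            gact_gact[OF X] gact_gact[OF Y] e conj_iff)
    qed (use c in \<open>auto intro!: mult_carrier_mat[OF c c]\<close>)
  next
    show "msum (ddim ?Z) (ddim ?Z) (gcar G) (\<lambda>h. dact ?Z \<e> h) = 1\<^sub>m (ddim ?Z)"
    proof (rule mat_eqI_tens_flux[OF X Y, where l="ddim X * ddim Y"])
      fix h k v w assume hk: "h \<in> gcar G" "k \<in> gcar G" and vw: "v \<in> flux X h" "w \<in> flux Y k"
      then show "mv (msum (ddim ?Z) (ddim ?Z) (gcar G) (\<lambda>h. dact ?Z \<e> h)) (tens (ddim Y) v w) =
          mv (1\<^sub>m (ddim ?Z)) (tens (ddim Y) v w)"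
        using fin by (simp add: mv_msum[OF c] act_dtensor_flux gact_one[OF X] gact_one[OF Y]
            mv_one[OF tens_vspace] flux_vspace)
    qed auto
  qed (use c in auto)
qed

lemma tens_flux: "v \<in> flux X h \<Longrightarrow> w \<in> flux Y k \<Longrightarrow> h \<in> gcar G \<Longrightarrow> k \<in> gcar G \<Longrightarrow>
    tens (ddim Y) v w \<in> flux (dtensor G X Y) (h \<cdot> k)"
  unfolding flux_def[of "dtensor G X Y"]
  by (simp add: act_dtensor_flux gact_one[OF X] gact_one[OF Y] tens_vspace flux_vspace)

lemma gact_dtensor:
  assumes v: "v \<in> vspace (ddim X)" and w: "w \<in> vspace (ddim Y)" and g: "g \<in> gcar G"
  shows "gact (dtensor G X Y) g (tens (ddim Y) v w) = tens (ddim Y) (gact X g v) (gact Y g w)"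
proof -
  have f: "gact (dtensor G X Y) g (tens (ddim Y) v w) = tens (ddim Y) (gact X g v) (gact Y g w)"
    if "v \<in> flux X h" "w \<in> flux Y k" "h \<in> gcar G" "k \<in> gcar G" for v w h k
    using that g fin by (simp add: gact_def[of "dtensor G X Y"] act_dtensor_flux)
  have "gact (dtensor G X Y) g (tens (ddim Y) (\<Sum>h\<in>gcar G. act X \<e> h v) (\<Sum>k\<in>gcar G. act Y \<e> k w)) =
      tens (ddim Y) (gact X g (\<Sum>h\<in>gcar G. act X \<e> h v)) (gact Y g (\<Sum>k\<in>gcar G. act Y \<e> k w))"
    unfolding gact_sum tens_sum_left tens_sum_right
    by (intro sum.cong refl f[OF act_one_flux[OF X] act_one_flux[OF Y]]) auto
  then show ?thesis by (simp only: flux_expand[OF X v] flux_expand[OF Y w])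
qed

text \<open>The second leg of R is the group element itself. The sum is kept for \<open>v\<close> of
  mixed flux, because in \<open>Jm_braided\<close> the vectors are homogeneous for X and not for its
  image under the functor.\<close>

lemma dbraid_tens:
  assumes v: "v \<in> vspace (ddim X)" and w: "w \<in> vspace (ddim Y)"
  shows "mv (dbraid G X Y) (tens (ddim Y) v w) = (\<Sum>h\<in>gcar G. tens (ddim X) (gact Y h w) (act X \<e> h v))"
proof -
  have 1: "kron (dact X \<e> h) (gmat Y h) \<in> carrier_mat (ddim X * ddim Y) (ddim X * ddim Y)"
    if "h \<in> gcar G" for h using that by (simp add: dact_carrier[OF X])
  have "mv (dbraid G X Y) (tens (ddim Y) v w) =
     mv (swap_mat (ddim X) (ddim Y)) (\<Sum>h\<in>gcar G. mv (kron (dact X \<e> h) (gmat Y h)) (tens (ddim Y) v w))"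
    unfolding dbraid_def gmat_def[symmetric]
    by (subst mv_mult[OF swap_mat_carrier msum_carrier]) (simp add: mv_msum[OF 1])
  also have "\<dots> = mv (swap_mat (ddim X) (ddim Y)) (\<Sum>h\<in>gcar G. tens (ddim Y) (act X \<e> h v) (gact Y h w))"
    by (intro arg_cong[where f="mv _"] sum.cong refl)
      (simp add: mv_kron_tens[OF dact_carrier[OF X] gmat_carrier] mv_gmat[OF Y])
  also have "\<dots> = (\<Sum>h\<in>gcar G. tens (ddim X) (gact Y h w) (act X \<e> h v))"
    unfolding mv_sum by (intro sum.cong refl mv_swap_tens) (auto simp: act_vspace[OF X] Y)
  finally show ?thesis .
qed

lemma dbraid_carrier [simp]: "dbraid G X Y \<in> carrier_mat (ddim Y * ddim X) (ddim X * ddim Y)"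
  unfolding dbraid_def by (rule mult_carrier_mat[OF swap_mat_carrier msum_carrier])

end

lemma dbraid_tens_flux:
  assumes X: "is_drep G X" and Y: "is_drep G Y"
    and v: "v \<in> flux X h" and h: "h \<in> gcar G" and w: "w \<in> vspace (ddim Y)"
  shows "mv (dbraid G X Y) (tens (ddim Y) v w) = tens (ddim X) (gact Y h w) v"
proof -
  have "tens (ddim X) (gact Y k w) (act X \<e> k v) = (if k = h then tens (ddim X) (gact Y h w) v else 0)"
    if "k \<in> gcar G" for k
    using h that by (simp add: act_flux_eq_gact[OF X v] gact_one[OF X flux_vspace[OF v]])
  then show ?thesis using flux_vspace[OF v] w h fin by (simp add: dbraid_tens[OF X Y])
qed

lemma act_dunit: "v \<in> vspace 1 \<Longrightarrow> act (dunit G) g h v = (if h = \<e> then v else 0)"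
  by (simp add: dunit_def dact_def)

lemma is_drep_dunit: "is_drep G (dunit G)"
proof (rule is_drepI)
  fix g h show "dact (dunit G) g h \<in> carrier_mat (ddim (dunit G)) (ddim (dunit G))"
    by (simp add: dunit_def dact_def ddim_def)
next
  fix g1 h1 g2 h2 v assume g: "g1 \<in> gcar G" "h1 \<in> gcar G" "g2 \<in> gcar G" "h2 \<in> gcar G"
    and "v \<in> vspace (ddim (dunit G))"
  then show "act (dunit G) g1 h1 (act (dunit G) g2 h2 v) =
      (if h2 = \<star>g2 \<cdot> h1 \<cdot> g2 then act (dunit G) (g1 \<cdot> g2) h2 v else 0)"
    using conj_iff[OF g(3,4,2)] by (auto simp: act_dunit)
qed (use fin in \<open>simp add: act_dunit\<close>)

end

subsection \<open>Simple representations\<close>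

text \<open>Bridge to the vectors in the definition of simplicity; only
  \<open>dsimple_subrep\<close> and \<open>dsimpleI\<close> cross it.\<close>

definition vfun :: "complex vec \<Rightarrow> nat \<Rightarrow> complex" where
  "vfun x = (\<lambda>i. if i < dim_vec x then x $ i else 0)"

lemma vfun_vspace: "x \<in> carrier_vec n \<Longrightarrow> vfun x \<in> vspace n"
  by (auto simp: vfun_def vspace_def)
lemma vfun_vec: "v \<in> vspace n \<Longrightarrow> vfun (vec n v) = v"
  by (auto simp: vfun_def vspace_def fun_eq_iff)
lemma vfun_add: "x \<in> carrier_vec n \<Longrightarrow> y \<in> carrier_vec n \<Longrightarrow> vfun (x + y) = vfun x + vfun y"
  by (auto simp: vfun_def fun_eq_iff plus_fun_apply)
lemma vfun_smult: "vfun (c \<cdot>\<^sub>v x) = sc c (vfun x)"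
  by (auto simp: vfun_def fun_eq_iff sc_apply)
lemma vfun_zero [simp]: "vfun (0\<^sub>v n) = 0"
  by (auto simp: vfun_def fun_eq_iff zero_fun_apply)
lemma vfun_mult: "A \<in> carrier_mat m n \<Longrightarrow> x \<in> carrier_vec n \<Longrightarrow> vfun (A *\<^sub>v x) = mv A (vfun x)"
  by (auto simp: vfun_def mv_def fun_eq_iff scalar_prod_def atLeast0LessThan)
lemma vfun_inj: "x \<in> carrier_vec n \<Longrightarrow> y \<in> carrier_vec n \<Longrightarrow> vfun x = vfun y \<Longrightarrow> x = y"
  by (rule eq_vecI) (auto simp: vfun_def fun_eq_iff split: if_splits)

text \<open>Bilinear and not Hermitian: vectors double as functionals, and the transposed matrices
  of \<open>ddual\<close> are the adjoint operators.\<close>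

definition pr :: "nat \<Rightarrow> (nat \<Rightarrow> complex) \<Rightarrow> (nat \<Rightarrow> complex) \<Rightarrow> complex" where
  "pr n \<xi> x = (\<Sum>i<n. \<xi> i * x i)"

lemma pr_sc: "pr n \<xi> (sc c x) = c * pr n \<xi> x" "pr n (sc c \<xi>) x = c * pr n \<xi> x"
  by (simp_all add: pr_def sc_apply sum_distrib_left ac_simps)
lemma pr_zero [simp]: "pr n \<xi> 0 = 0" "pr n 0 x = 0"
  by (simp_all add: pr_def zero_fun_apply)
lemma pr_add: "pr n \<xi> (x + y) = pr n \<xi> x + pr n \<xi> y"
  by (simp add: pr_def plus_fun_apply ring_distribs sum.distrib)
lemma pr_sum: "pr n \<xi> (\<Sum>a\<in>A. f a) = (\<Sum>a\<in>A. pr n \<xi> (f a))"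
  unfolding pr_def sum_fun_apply by (simp add: sum_distrib_left) (rule sum.swap)
lemma pr_sum_left: "pr n (\<Sum>a\<in>A. f a) x = (\<Sum>a\<in>A. pr n (f a) x)"
  unfolding pr_def sum_fun_apply by (simp add: sum_distrib_right) (rule sum.swap)
lemma pr_unitv: "j < n \<Longrightarrow> pr n \<xi> (unitv j) = \<xi> j"
  by (simp add: pr_def unitv_def if_distrib[of "\<lambda>x. _ * x"] cong: if_cong)
lemma pr_ext:
  assumes "\<xi> \<in> vspace n" "\<eta> \<in> vspace n" "\<And>x. x \<in> vspace n \<Longrightarrow> pr n \<xi> x = pr n \<eta> x"
  shows "\<xi> = \<eta>"
proof
  fix j show "\<xi> j = \<eta> j"
  proof (cases "j < n")
    case True
    then show ?thesis using assms(3)[of "unitv j"] by (simp add: pr_unitv)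
  qed (use assms in \<open>auto simp: vspace_def\<close>)
qed

lemma pr_transpose:
  assumes "A \<in> carrier_mat n n"
  shows "pr n (mv (transpose_mat A) \<xi>) x = pr n \<xi> (mv A x)"
proof -
  have "pr n (mv (transpose_mat A) \<xi>) x = (\<Sum>i<n. \<Sum>j<n. A $$ (j, i) * \<xi> j * x i)"
    using assms by (simp add: pr_def mv_def sum_distrib_right)
  also have "\<dots> = (\<Sum>j<n. \<Sum>i<n. A $$ (j, i) * \<xi> j * x i)" by (rule sum.swap)
  also have "\<dots> = pr n \<xi> (mv A x)"
    using assms by (simp add: pr_def mv_def sum_distrib_left ac_simps)
  finally show ?thesis .
qed

context finite_fgrp
begin

definition subrep :: "'g drep \<Rightarrow> (nat \<Rightarrow> complex) set \<Rightarrow> bool" where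
  "subrep X N \<longleftrightarrow> N \<subseteq> vspace (ddim X) \<and> 0 \<in> N \<and> (\<forall>v\<in>N. \<forall>w\<in>N. v + w \<in> N) \<and>
     (\<forall>c. \<forall>v\<in>N. sc c v \<in> N) \<and> (\<forall>g\<in>gcar G. \<forall>h\<in>gcar G. \<forall>v\<in>N. act X g h v \<in> N)"

lemma subrep_sum: "subrep X N \<Longrightarrow> (\<And>a. a \<in> A \<Longrightarrow> f a \<in> N) \<Longrightarrow> (\<Sum>a\<in>A. f a) \<in> N"
  by (induction A rule: infinite_finite_induct) (auto simp: subrep_def)

lemma dsimple_drep: "dsimple G X \<Longrightarrow> is_drep G X" by (simp add: dsimple_def)

lemma dsimple_subrep:
  assumes X: "dsimple G X" and N: "subrep X N" and v: "v \<in> N" "v \<noteq> 0"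
  shows "N = vspace (ddim X)"
proof -
  let ?n = "ddim X"
  define W where "W = {x \<in> carrier_vec ?n. vfun x \<in> N}"
  have "W = {0\<^sub>v ?n} \<or> W = carrier_vec ?n"
  proof -
    have "W \<subseteq> carrier_vec ?n \<and> 0\<^sub>v ?n \<in> W \<and> (\<forall>v\<in>W. \<forall>w\<in>W. v + w \<in> W) \<and>
      (\<forall>c. \<forall>v\<in>W. c \<cdot>\<^sub>v v \<in> W) \<and> (\<forall>g\<in>gcar G. \<forall>h\<in>gcar G. \<forall>v\<in>W. dact X g h *\<^sub>v v \<in> W)"
      using N unfolding W_def subrep_def
      by (auto simp: vfun_add vfun_smult vfun_mult[OF dact_carrier[OF dsimple_drep[OF X]]]
          intro!: mult_mat_vec_carrier[OF dact_carrier[OF dsimple_drep[OF X]]])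
    then show ?thesis using X unfolding dsimple_def by blast
  qed
  moreover have "vec ?n v \<in> W" using v N by (auto simp: W_def subrep_def vfun_vec)
  moreover have "vec ?n v \<noteq> 0\<^sub>v ?n"
    using v N vfun_vec[of v ?n] vfun_zero[of ?n] by (metis subrep_def subset_iff)
  ultimately have W: "W = carrier_vec ?n" by auto
  have "w \<in> N" if "w \<in> vspace ?n" for w
  proof -
    have "vec ?n w \<in> W" using W by simp
    then show ?thesis using that by (simp add: W_def vfun_vec)
  qed
  with N show ?thesis by (auto simp: subrep_def)
qed

lemma dsimpleI:
  assumes X: "is_drep G X" and "ddim X > 0"
    and N: "\<And>N v. subrep X N \<Longrightarrow> v \<in> N \<Longrightarrow> v \<noteq> 0 \<Longrightarrow> vspace (ddim X) \<subseteq> N"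
  shows "dsimple G X"
  unfolding dsimple_def
proof (intro conjI allI impI assms)
  let ?n = "ddim X"
  fix W assume W: "W \<subseteq> carrier_vec ?n \<and> 0\<^sub>v ?n \<in> W \<and> (\<forall>v\<in>W. \<forall>w\<in>W. v + w \<in> W) \<and>
      (\<forall>c. \<forall>v\<in>W. c \<cdot>\<^sub>v v \<in> W) \<and> (\<forall>g\<in>gcar G. \<forall>h\<in>gcar G. \<forall>v\<in>W. dact X g h *\<^sub>v v \<in> W)"
  show "W = {0\<^sub>v ?n} \<or> W = carrier_vec ?n"
  proof (cases "W = {0\<^sub>v ?n}")
    case False
    then obtain x where x: "x \<in> W" "x \<noteq> 0\<^sub>v ?n" using W by blast
    have Wc: "w \<in> W \<Longrightarrow> w \<in> carrier_vec ?n" for w using W by auto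
    have S: "subrep X (vfun ` W)"
      unfolding subrep_def
    proof (intro conjI ballI allI)
      show "vfun ` W \<subseteq> vspace ?n" using W by (auto intro: vfun_vspace)
      show "0 \<in> vfun ` W" using W by (metis imageI vfun_zero)
    next
      fix v w assume "v \<in> vfun ` W" "w \<in> vfun ` W"
      then obtain a b where ab: "a \<in> W" "b \<in> W" "v = vfun a" "w = vfun b" by auto
      then have "v + w = vfun (a + b)" using vfun_add[OF Wc Wc] by simp
      then show "v + w \<in> vfun ` W" using W ab by auto
    next
      fix c v assume "v \<in> vfun ` W"
      then show "sc c v \<in> vfun ` W" using W by (auto simp flip: vfun_smult)
    next
      fix g h v assume gh: "g \<in> gcar G" "h \<in> gcar G" and "v \<in> vfun ` W"
      then show "act X g h v \<in> vfun ` W"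
        using W by (auto simp: Wc simp flip: vfun_mult[OF dact_carrier[OF X gh]])
    qed
    have "vfun x \<noteq> 0" using x Wc vfun_inj[of x ?n "0\<^sub>v ?n"] by auto
    then have sub: "vspace ?n \<subseteq> vfun ` W" using N[OF S] x by blast
    have "y \<in> W" if y: "y \<in> carrier_vec ?n" for y
    proof -
      obtain z where "z \<in> W" "vfun y = vfun z" using sub vfun_vspace[OF y] by blast
      then show ?thesis using vfun_inj[OF y Wc] by blast
    qed
    then show ?thesis using W by blast
  qed simp
qed

subsection \<open>Types\<close>

text \<open>The condition for \<open>g \<notin> S\<close> says that \<open>S\<close> is the full stabilizer of the pair \<open>(h, \<chi>)\<close>; by Clifford
  theory a simple object is then determined by \<open>(h, S, \<chi>)\<close>.  Functionals of this type (\<open>cotype\<close>)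
  are vectors of the dual type in the dual, and averaging them yields homomorphisms.\<close>

definition stab :: "'g \<Rightarrow> 'g set \<Rightarrow> ('g \<Rightarrow> complex) \<Rightarrow> bool" where
  "stab h S \<chi> \<longleftrightarrow> h \<in> gcar G \<and> S \<subseteq> gcar G \<and> \<e> \<in> S \<and> (\<forall>s\<in>S. \<star>s \<in> S) \<and> (\<forall>s\<in>S. \<forall>t\<in>S. s \<cdot> t \<in> S) \<and>
     (\<forall>s\<in>S. s \<cdot> h \<cdot> \<star>s = h) \<and> \<chi> \<e> = 1 \<and> (\<forall>s\<in>S. \<forall>t\<in>S. \<chi> (s \<cdot> t) = \<chi> s * \<chi> t) \<and>
     (\<forall>g\<in>gcar G - S. g \<cdot> h \<cdot> \<star>g \<noteq> h \<or> (\<exists>s\<in>S. \<star>g \<cdot> s \<cdot> g \<in> S \<and> \<chi> s \<noteq> \<chi> (\<star>g \<cdot> s \<cdot> g)))"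

definition has_type :: "'g drep \<Rightarrow> 'g \<Rightarrow> 'g set \<Rightarrow> ('g \<Rightarrow> complex) \<Rightarrow> (nat \<Rightarrow> complex) \<Rightarrow> bool" where
  "has_type X h S \<chi> v \<longleftrightarrow> v \<in> flux X h \<and> v \<noteq> 0 \<and> (\<forall>s\<in>S. gact X s v = sc (\<chi> s) v)"

definition cotype :: "'g drep \<Rightarrow> 'g \<Rightarrow> 'g set \<Rightarrow> ('g \<Rightarrow> complex) \<Rightarrow> (nat \<Rightarrow> complex) \<Rightarrow> bool" where
  "cotype X h S \<chi> \<xi> \<longleftrightarrow> \<xi> \<in> vspace (ddim X) \<and>
     (\<forall>k\<in>gcar G. \<forall>x\<in>vspace (ddim X). pr (ddim X) \<xi> (act X \<e> k x) = (if k = h then pr (ddim X) \<xi> x else 0)) \<and>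
     (\<forall>s\<in>S. \<forall>x\<in>vspace (ddim X). pr (ddim X) \<xi> (gact X s x) = \<chi> s * pr (ddim X) \<xi> x)"

lemma act_gact:
  assumes X: "is_drep G X" and gk: "g \<in> gcar G" "k \<in> gcar G"
  shows "act X \<e> k (gact X g x) = gact X g (act X \<e> (\<star>g \<cdot> k \<cdot> g) x)"
proof -
  have "act X \<e> k (gact X g x) = (\<Sum>h\<in>gcar G. if h = \<star>g \<cdot> k \<cdot> g then act X g h x else 0)"
    unfolding gact_def mv_sum using gk by (intro sum.cong refl) (simp add: act_act[OF X])
  then show ?thesis using gk fin act_eq_gact_act[OF X gk(1), of "\<star>g \<cdot> k \<cdot> g" x] by simp
qed

text \<open>A coordinate that is nonzero on \<open>v\<close> is composed with the projection to flux
  h and averaged over S against the inverse character. On \<open>v\<close> the average is |S| times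
  the coordinate.\<close>

lemma ex_cotype:
  assumes X: "is_drep G X" and st: "stab h S \<chi>" and v: "has_type X h S \<chi> v"
  obtains \<xi> where "cotype X h S \<chi> \<xi>" "pr (ddim X) \<xi> v \<noteq> 0"
proof -
  let ?n = "ddim X"
  have h: "h \<in> gcar G" and S: "S \<subseteq> gcar G" "\<e> \<in> S" and fS: "finite S"
    using st fin by (auto simp: stab_def intro: finite_subset)
  have vv: "v \<in> flux X h" "v \<in> vspace ?n" using v by (auto simp: has_type_def intro: flux_vspace)
  obtain i where i: "v i \<noteq> 0" using v by (auto simp: has_type_def fun_eq_iff zero_fun_apply)
  define L where "L x = (\<Sum>s\<in>S. \<chi> (\<star>s) * gact X s (act X \<e> h x) i)" for x
  define \<xi> where "\<xi> j = (if j < ?n then L (unitv j) else 0)" for j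
  have L: "pr ?n \<xi> x = L x" if "x \<in> vspace ?n" for x
  proof -
    have "L x = L (\<Sum>j<?n. sc (x j) (unitv j))" using vspace_expand[OF that] by simp
    also have "\<dots> = (\<Sum>s\<in>S. \<Sum>j<?n. x j * (\<chi> (\<star>s) * gact X s (act X \<e> h (unitv j)) i))"
      by (simp add: L_def mv_sum gact_sum mv_sc gact_sc sum_fun_apply sc_apply sum_distrib_left ac_simps)
    also have "\<dots> = (\<Sum>j<?n. x j * L (unitv j))"
      unfolding L_def sum_distrib_left by (rule sum.swap)
    finally show ?thesis by (simp add: pr_def \<xi>_def mult.commute)
  qed
  show thesis
  proof (rule that)
    have "\<chi> (\<star>s) * gact X s v i = v i" if "s \<in> S" for s
    proof -
      have "\<chi> (\<star>s) * \<chi> s = 1" using st that S by (auto simp: stab_def) (metis l_inv subsetD)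
      then show ?thesis using v that by (simp add: has_type_def sc_apply mult.assoc[symmetric])
    qed
    then have "L v = of_nat (card S) * v i"
      using vv by (simp add: L_def flux_def)
    moreover have "card S \<noteq> 0" using fS S by auto
    ultimately show "pr ?n \<xi> v \<noteq> 0" using i vv by (simp add: L)
    show "cotype X h S \<chi> \<xi>"
      unfolding cotype_def
    proof (intro conjI ballI)
      show "\<xi> \<in> vspace ?n" by (simp add: vspace_def \<xi>_def)
      fix k x assume k: "k \<in> gcar G" and x: "x \<in> vspace ?n"
      have "act X \<e> h (act X \<e> k x) = (if k = h then act X \<e> h x else 0)"
        using act_act[OF X one_in h one_in k] h by simp
      then show "pr ?n \<xi> (act X \<e> k x) = (if k = h then pr ?n \<xi> x else 0)"
        using x h k by (simp add: L act_vspace[OF X] L_def zero_fun_apply)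
    next
      fix t x assume t: "t \<in> S" and x: "x \<in> vspace ?n"
      have tG: "t \<in> gcar G" using t S by auto
      have "\<star>t \<cdot> h \<cdot> t = h" using st t tG by (auto simp: stab_def) (metis inv_inv)
      then have 1: "act X \<e> h (gact X t x) = gact X t (act X \<e> h x)"
        using act_gact[OF X tG h] by simp
      have "L (gact X t x) = (\<Sum>s\<in>S. \<chi> (\<star>s) * gact X (s \<cdot> t) (act X \<e> h x) i)"
        unfolding L_def 1 using S tG by (intro sum.cong refl) (simp add: gact_gact[OF X] subset_iff)
      also have "\<dots> = (\<Sum>s\<in>S. \<chi> (t \<cdot> \<star>s) * gact X s (act X \<e> h x) i)"
        by (rule sum.reindex_bij_witness[of _ "\<lambda>s. s \<cdot> \<star>t" "\<lambda>s. s \<cdot> t"])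
          (use st t S in \<open>auto simp: stab_def subset_iff assoc\<close>)
      also have "\<dots> = \<chi> t * L x"
        unfolding L_def sum_distrib_left using st t by (intro sum.cong refl) (simp add: stab_def)
      finally show "pr ?n \<xi> (gact X t x) = \<chi> t * pr ?n \<xi> x"
        using x tG by (simp add: L X)
    qed
  qed
qed

text \<open>Here the fullness of the stabilizer enters: for g outside S, either g v has another
  flux, or some s in S acts on it by a scalar other than \<chi>(s). The functional \<xi> kills it in
  both cases.\<close>

lemma cotype_vanish:
  assumes X: "is_drep G X" and st: "stab h S \<chi>" and v: "has_type X h S \<chi> v"
    and xi: "cotype X h S \<chi> \<xi>" and g: "g \<in> gcar G" "g \<notin> S"
  shows "pr (ddim X) \<xi> (gact X g v) = 0"
proof -
  have h: "h \<in> gcar G" and S: "S \<subseteq> gcar G" using st by (auto simp: stab_def)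
  have vf: "v \<in> flux X h" using v by (simp add: has_type_def)
  have "g \<cdot> h \<cdot> \<star>g \<noteq> h \<or> (\<exists>s\<in>S. \<star>g \<cdot> s \<cdot> g \<in> S \<and> \<chi> s \<noteq> \<chi> (\<star>g \<cdot> s \<cdot> g))"
    using st g by (simp add: stab_def)
  then show ?thesis
  proof (elim disjE bexE conjE)
    assume ne: "g \<cdot> h \<cdot> \<star>g \<noteq> h"
    have "act X \<e> (g \<cdot> h \<cdot> \<star>g) (gact X g v) = gact X g v"
      using gact_flux[OF X vf g(1) h] by (simp add: flux_def)
    with xi ne g h X show ?thesis unfolding cotype_def by (metis gact_vspace mul_in inv_in)
  next
    fix s assume s: "s \<in> S" "\<star>g \<cdot> s \<cdot> g \<in> S" "\<chi> s \<noteq> \<chi> (\<star>g \<cdot> s \<cdot> g)"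
    have sG: "s \<in> gcar G" using s S by auto
    have "gact X s (gact X g v) = gact X g (gact X (\<star>g \<cdot> s \<cdot> g) v)"
      using g sG by (simp add: gact_gact[OF X] assoc)
    also have "\<dots> = sc (\<chi> (\<star>g \<cdot> s \<cdot> g)) (gact X g v)"
      using v s by (simp add: has_type_def gact_sc)
    finally have "\<chi> s * pr (ddim X) \<xi> (gact X g v) = \<chi> (\<star>g \<cdot> s \<cdot> g) * pr (ddim X) \<xi> (gact X g v)"
      using xi s(1) g X by (metis cotype_def gact_vspace pr_sc(1))
    with s show ?thesis by simp
  qed
qed

text \<open>The map sending x to the sum over g of \<xi>(g^-1 x) g w is an intertwiner. At
  \<open>v\<close> the terms outside S vanish by \<open>cotype_vanish\<close> and each term inside
  equals \<xi>(v) w, so \<open>v\<close> goes to |S| \<xi>(v) w.\<close>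

lemma type_hom:
  assumes X: "is_drep G X" and Y: "is_drep G Y" and st: "stab h S \<chi>"
    and v: "has_type X h S \<chi> v" and w: "has_type Y h S \<chi> w"
  obtains T c where "T \<in> dhom G X Y" "c \<noteq> 0" "mv T v = sc c w"
proof -
  let ?n = "ddim X"
  have h: "h \<in> gcar G" and S: "S \<subseteq> gcar G" "\<e> \<in> S" and fS: "finite S"
    using st fin by (auto simp: stab_def intro: finite_subset)
  obtain \<xi> where xi: "cotype X h S \<chi> \<xi>" and nz: "pr ?n \<xi> v \<noteq> 0" using ex_cotype[OF X st v] .
  have wf: "w \<in> flux Y h" using w by (simp add: has_type_def)
  define f where "f x = (\<Sum>g\<in>gcar G. sc (pr ?n \<xi> (gact X (\<star>g) x)) (gact Y g w))" for x
  have gadd: "gact X g (x + y) = gact X g x + gact X g y" for g x y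
    by (simp add: gact_def mv_add sum.distrib)
  obtain T where T: "T \<in> carrier_mat (ddim Y) ?n" "\<And>x. x \<in> vspace ?n \<Longrightarrow> mv T x = f x"
  proof (rule ex_mat_linear[of ?n f "ddim Y"])
    show "f x \<in> vspace (ddim Y)" for x unfolding f_def by (intro vspace_sum vspace_sc gact_vspace Y)
    show "f (x + y) = f x + f y" for x y
      unfolding f_def gadd pr_add sum.distrib[symmetric]
      by (intro sum.cong refl) (simp add: fun_eq_iff sc_apply plus_fun_apply ring_distribs)
    show "f (sc c x) = sc c (f x)" for c x
      unfolding f_def sc_sum by (intro sum.cong refl) (simp add: gact_sc pr_sc)
  qed (use that in blast)
  have "T \<in> dhom G X Y"
  proof (rule dhomI[OF X Y T(1)])
    fix k x assume k: "k \<in> gcar G" and x: "x \<in> vspace ?n"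
    have "f (act X \<e> k x) = act Y \<e> k (f x)"
      unfolding f_def mv_sum mv_sc
    proof (intro sum.cong refl)
      fix g assume g: "g \<in> gcar G"
      have "gact X (\<star>g) (act X \<e> k x) = act X \<e> (\<star>g \<cdot> k \<cdot> g) (gact X (\<star>g) x)"
        using act_gact[OF X, of "\<star>g" "\<star>g \<cdot> k \<cdot> g" x] g k by (simp add: assoc)
      then have "pr ?n \<xi> (gact X (\<star>g) (act X \<e> k x)) =
          (if \<star>g \<cdot> k \<cdot> g = h then pr ?n \<xi> (gact X (\<star>g) x) else 0)"
        using xi g k by (simp add: cotype_def X)
      moreover have "act Y \<e> k (gact Y g w) = (if k = g \<cdot> h \<cdot> \<star>g then gact Y g w else 0)"
        using act_flux_eq_gact[OF Y gact_flux[OF Y wf g h] one_in _ k] g h by (simp add: Y)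
      moreover have "\<star>g \<cdot> k \<cdot> g = h \<longleftrightarrow> k = g \<cdot> h \<cdot> \<star>g"
        using conj_iff[OF g h k] by auto
      ultimately show "sc (pr ?n \<xi> (gact X (\<star>g) (act X \<e> k x))) (gact Y g w) =
          sc (pr ?n \<xi> (gact X (\<star>g) x)) (act Y \<e> k (gact Y g w))" by simp
    qed
    then show "mv T (act X \<e> k x) = act Y \<e> k (mv T x)"
      using k x by (simp add: T act_vspace[OF X])
  next
    fix k x assume k: "k \<in> gcar G" and x: "x \<in> vspace ?n"
    have "f (gact X k x) = (\<Sum>g\<in>gcar G. sc (pr ?n \<xi> (gact X (\<star>(k \<cdot> g)) (gact X k x))) (gact Y (k \<cdot> g) w))"
      unfolding f_def using sum_mult_left[OF k, symmetric] .
    also have "\<dots> = gact Y k (f x)"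
      unfolding f_def gact_sum gact_sc using k
      by (intro sum.cong refl) (simp add: gact_gact[OF X] gact_gact[OF Y] assoc)
    finally show "mv T (gact X k x) = gact Y k (mv T x)"
      using k x by (simp add: T X)
  qed
  moreover have "mv T v = sc (of_nat (card S) * pr ?n \<xi> v) w"
  proof -
    have vn: "v \<in> vspace ?n" using v by (auto simp: has_type_def intro: flux_vspace)
    have "f v = (\<Sum>g\<in>S. sc (pr ?n \<xi> (gact X (\<star>g) v)) (gact Y g w))"
      unfolding f_def
    proof (rule sum.mono_neutral_right[OF fin S(1)], intro ballI)
      fix g assume g: "g \<in> gcar G - S"
      then have "\<star>g \<notin> S" using st unfolding stab_def by (metis DiffD1 DiffD2 inv_inv)
      then show "sc (pr ?n \<xi> (gact X (\<star>g) v)) (gact Y g w) = 0"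
        using cotype_vanish[OF X st v xi, of "\<star>g"] g by simp
    qed
    also have "\<dots> = (\<Sum>g\<in>S. sc (pr ?n \<xi> v) w)"
    proof (intro sum.cong refl)
      fix s assume s: "s \<in> S"
      have "\<chi> (\<star>s) * \<chi> s = 1" using st s S by (auto simp: stab_def) (metis l_inv subsetD)
      moreover have "\<star>s \<in> S" using st s by (simp add: stab_def)
      ultimately show "sc (pr ?n \<xi> (gact X (\<star>s) v)) (gact Y s w) = sc (pr ?n \<xi> v) w"
        using v w s by (simp add: has_type_def pr_sc) (metis mult.assoc mult.commute mult_1)
    qed
    also have "\<dots> = sc (of_nat (card S) * pr ?n \<xi> v) w"
      unfolding sum_sc by simp
    finally show ?thesis using T(2)[OF vn] by simp
  qed
  moreover have "of_nat (card S) * pr ?n \<xi> v \<noteq> 0" using nz fS S by auto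
  ultimately show thesis using that by blast
qed

text \<open>Schur's lemma with the eigenvector already in hand: the c-eigenspace of S T is a
  subrepresentation that contains \<open>v\<close>.\<close>

lemma dsimple_scalar:
  assumes X: "dsimple G X" and Y: "is_drep G Y" and T: "T \<in> dhom G X Y" and S: "S \<in> dhom G Y X"
    and v: "v \<in> vspace (ddim X)" "v \<noteq> 0" "mv S (mv T v) = sc c v"
  shows "S * T = c \<cdot>\<^sub>m 1\<^sub>m (ddim X)"
proof -
  let ?n = "ddim X"
  note Xr = dsimple_drep[OF X]
  have c: "T \<in> carrier_mat (ddim Y) ?n" "S \<in> carrier_mat ?n (ddim Y)" using T S by (auto simp: dhom_def)
  define N where "N = {x \<in> vspace ?n. mv S (mv T x) = sc c x}"
  have "subrep X N"
    unfolding subrep_def N_def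
    by (auto simp: mv_add sc_add mv_sc mult.commute act_vspace[OF Xr] dhom_act[OF Xr Y T] dhom_act[OF Y Xr S])
  then have N: "N = vspace ?n" by (rule dsimple_subrep[OF X]) (use v in \<open>auto simp: N_def\<close>)
  show ?thesis
  proof (rule mat_eqI_mv)
    fix x assume "x \<in> vspace ?n"
    then have "x \<in> N" by (simp add: N)
    then show "mv (S * T) x = mv (c \<cdot>\<^sub>m 1\<^sub>m ?n) x"
      by (simp add: mv_mult[OF c(2,1)] mv_smult N_def)
  qed (use c in auto)
qed

text \<open>Homomorphisms in both directions that match the two type vectors compose to a scalar.\<close>

lemma type_iso:
  assumes X: "dsimple G X" and Y: "is_drep G Y" and st: "stab h S \<chi>"
    and v: "has_type X h S \<chi> v" and w: "has_type Y h S \<chi> w"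
    and alt: "dsimple G Y \<or> ddim Y = ddim X"
  shows "diso G X Y"
proof -
  note Xr = dsimple_drep[OF X]
  obtain T c where T: "T \<in> dhom G X Y" "c \<noteq> 0" "mv T v = sc c w" using type_hom[OF Xr Y st v w] .
  obtain R d where R: "R \<in> dhom G Y X" "d \<noteq> 0" "mv R w = sc d v" using type_hom[OF Y Xr st w v] .
  have Tc: "T \<in> carrier_mat (ddim Y) (ddim X)" and Rc: "R \<in> carrier_mat (ddim X) (ddim Y)"
    using T R by (auto simp: dhom_def)
  have vw: "v \<in> vspace (ddim X)" "v \<noteq> 0" "w \<in> vspace (ddim Y)" "w \<noteq> 0"
    using v w by (auto simp: has_type_def intro: flux_vspace)
  define R' where "R' = (1 / (c * d)) \<cdot>\<^sub>m R"
  have R'c: "R' \<in> carrier_mat (ddim X) (ddim Y)" using Rc by (simp add: R'_def)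
  have "R * T = (c * d) \<cdot>\<^sub>m 1\<^sub>m (ddim X)"
    by (rule dsimple_scalar[OF X Y T(1) R(1) vw(1,2)]) (simp add: T R mv_sc)
  then have 1: "R' * T = 1\<^sub>m (ddim X)"
    using T R Rc Tc by (simp add: R'_def mult_smult_assoc_mat) (auto intro!: eq_matI)
  have 2: "T * R' = 1\<^sub>m (ddim Y)"
    using alt
  proof
    assume Ys: "dsimple G Y"
    have "T * R = (c * d) \<cdot>\<^sub>m 1\<^sub>m (ddim Y)"
      by (rule dsimple_scalar[OF Ys Xr R(1) T(1) vw(3,4)]) (simp add: T R mv_sc mult.commute)
    then show ?thesis
      using T R Rc Tc by (simp add: R'_def mult_smult_distrib) (auto intro!: eq_matI)
  next
    \<comment> \<open>Meant for duals, whose simplicity is not established: a one-sided inverse of a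
      square matrix is two-sided.\<close>
    assume "ddim Y = ddim X"
    then show ?thesis using mat_mult_left_right_inverse[OF _ _ 1] Tc R'c by simp
  qed
  show ?thesis
    unfolding diso_def using is_iso_morI[OF T(1) Xr Y R'c 1 2] by blast
qed

text \<open>Types are isomorphism invariants; this is how objects are shown to be
  non-isomorphic.\<close>

lemma diso_has_type:
  assumes "diso G X Y" "is_drep G X" "is_drep G Y" "h \<in> gcar G" "S \<subseteq> gcar G" "has_type X h S \<chi> v"
  shows "\<exists>w. has_type Y h S \<chi> w"
proof -
  obtain T where T: "T \<in> dhom G X Y" "\<And>v. v \<in> vspace (ddim X) \<Longrightarrow> mv T v = 0 \<Longrightarrow> v = 0"
    using diso_mono assms by blast
  have "has_type Y h S \<chi> (mv T v)"
    using assms T dhom_flux[OF assms(2,3) T(1) assms(4), of v] flux_vspace[of v X h]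
    by (auto simp: has_type_def subset_iff mv_sc simp flip: dhom_gact[OF assms(2,3) T(1)])
  then show ?thesis by blast
qed

subsection \<open>Duals\<close>

lemma act_ddual:
  assumes X: "is_drep G X" and gh: "g \<in> gcar G" "h \<in> gcar G"
  shows "pr (ddim X) (act (ddual G X) g h \<xi>) x = pr (ddim X) \<xi> (act X (\<star>g) (g \<cdot> \<star>h \<cdot> \<star>g) x)"
  using pr_transpose[OF dact_carrier[OF X, of "\<star>g" "g \<cdot> \<star>h \<cdot> \<star>g"], of \<xi> x] gh
  by (simp add: ddual_def dact_def)

lemma ddual_carrier:
  "is_drep G X \<Longrightarrow> g \<in> gcar G \<Longrightarrow> h \<in> gcar G \<Longrightarrow> dact (ddual G X) g h \<in> carrier_mat (ddim X) (ddim X)"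
  using dact_carrier[of X "\<star>g" "g \<cdot> \<star>h \<cdot> \<star>g"] by (simp add: ddual_def dact_def)

text \<open>The antipode reverses products and transposition reverses them back. Equality of vectors
  is tested through the pairing.\<close>

lemma is_drep_ddual:
  assumes X: "is_drep G X"
  shows "is_drep G (ddual G X)"
proof (rule is_drepI)
  let ?n = "ddim X"
  note c = ddual_carrier[OF X]
  then show "dact (ddual G X) g h \<in> carrier_mat (ddim (ddual G X)) (ddim (ddual G X))"
    if "g \<in> gcar G" "h \<in> gcar G" for g h using that by simp
  fix g1 h1 g2 h2 v
  assume g: "g1 \<in> gcar G" "h1 \<in> gcar G" "g2 \<in> gcar G" "h2 \<in> gcar G"
  show "act (ddual G X) g1 h1 (act (ddual G X) g2 h2 v) =
      (if h2 = \<star>g2 \<cdot> h1 \<cdot> g2 then act (ddual G X) (g1 \<cdot> g2) h2 v else 0)"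
  proof (rule pr_ext[of _ ?n])
    fix x
    have iff: "g1 \<cdot> \<star>h1 \<cdot> \<star>g1 = g1 \<cdot> (g2 \<cdot> \<star>h2 \<cdot> \<star>g2) \<cdot> \<star>g1 \<longleftrightarrow> h2 = \<star>g2 \<cdot> h1 \<cdot> g2" (is "?L \<longleftrightarrow> ?R")
    proof
      assume ?L
      then have "\<star>g1 \<cdot> (g1 \<cdot> \<star>h1 \<cdot> \<star>g1) \<cdot> g1 = \<star>g1 \<cdot> (g1 \<cdot> (g2 \<cdot> \<star>h2 \<cdot> \<star>g2) \<cdot> \<star>g1) \<cdot> g1" by simp
      then have "\<star>h1 = g2 \<cdot> \<star>h2 \<cdot> \<star>g2" using g by (simp add: assoc)
      then have "\<star>(\<star>h1) = \<star>(g2 \<cdot> \<star>h2 \<cdot> \<star>g2)" by simp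
      then show ?R using g by (simp add: assoc)
    next
      assume ?R
      then show ?L using g by (simp add: assoc)
    qed
    have "pr ?n (act (ddual G X) g1 h1 (act (ddual G X) g2 h2 v)) x =
       pr ?n v (act X (\<star>g2) (g2 \<cdot> \<star>h2 \<cdot> \<star>g2) (act X (\<star>g1) (g1 \<cdot> \<star>h1 \<cdot> \<star>g1) x))"
      using g by (simp add: act_ddual[OF X])
    also have "\<dots> = (if ?L then pr ?n v (act X (\<star>g2 \<cdot> \<star>g1) (g1 \<cdot> \<star>h1 \<cdot> \<star>g1) x) else 0)"
      using g by (subst act_act[OF X]) auto
    also have "\<dots> = pr ?n (if h2 = \<star>g2 \<cdot> h1 \<cdot> g2 then act (ddual G X) (g1 \<cdot> g2) h2 v else 0) x"
      unfolding iff using g by (simp add: act_ddual[OF X] assoc)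
    finally show "pr ?n (act (ddual G X) g1 h1 (act (ddual G X) g2 h2 v)) x = \<dots>" .
  qed (use g in \<open>auto intro!: mv_vspace c\<close>)
next
  let ?n = "ddim X"
  fix v assume v: "v \<in> vspace (ddim (ddual G X))"
  show "(\<Sum>h\<in>gcar G. act (ddual G X) \<e> h v) = v"
  proof (rule pr_ext[of _ ?n])
    fix x assume x: "x \<in> vspace ?n"
    have "pr ?n (\<Sum>h\<in>gcar G. act (ddual G X) \<e> h v) x = pr ?n v (\<Sum>h\<in>gcar G. act X \<e> (\<star>h) x)"
      unfolding pr_sum pr_sum_left by (intro sum.cong refl) (simp add: act_ddual[OF X])
    also have "(\<Sum>h\<in>gcar G. act X \<e> (\<star>h) x) = (\<Sum>h\<in>gcar G. act X \<e> h x)"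
      by (rule sum.reindex_bij_witness[of _ "ginv G" "ginv G"]) auto
    finally show "pr ?n (\<Sum>h\<in>gcar G. act (ddual G X) \<e> h v) x = pr ?n v x"
      by (simp add: flux_expand[OF X x])
  qed (use v in \<open>auto intro!: vspace_sum mv_vspace[OF ddual_carrier[OF X]]\<close>)
qed

text \<open>A functional of the given cotype, read as a vector of the dual, has the inverse flux and
  the inverse character.\<close>

lemma has_type_ddual:
  assumes X: "is_drep G X" and st: "stab h S \<chi>" and v: "has_type X h S \<chi> v"
  shows "\<exists>\<xi>. has_type (ddual G X) (\<star>h) S (\<lambda>s. \<chi> (\<star>s)) \<xi>"
proof -
  let ?n = "ddim X"
  have h: "h \<in> gcar G" and S: "S \<subseteq> gcar G" "\<And>s. s \<in> S \<Longrightarrow> \<star>s \<in> S" using st by (auto simp: stab_def)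
  obtain \<xi> where xi: "cotype X h S \<chi> \<xi>" and nz: "pr ?n \<xi> v \<noteq> 0" using ex_cotype[OF X st v] .
  note Xd = is_drep_ddual[OF X]
  have xv: "\<xi> \<in> vspace ?n" using xi by (simp add: cotype_def)
  have "act (ddual G X) \<e> (\<star>h) \<xi> = \<xi>"
    by (rule pr_ext[of _ ?n])
      (use xi h xv act_vspace[OF Xd, of \<e> "\<star>h" \<xi>] in \<open>auto simp: act_ddual[OF X] cotype_def\<close>)
  moreover have "gact (ddual G X) s \<xi> = sc (\<chi> (\<star>s)) \<xi>" if s: "s \<in> S" for s
  proof (rule pr_ext[of _ ?n])
    have sG: "s \<in> gcar G" using s S by auto
    show "gact (ddual G X) s \<xi> \<in> vspace ?n" using gact_vspace[OF Xd sG] by simp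
    fix x assume x: "x \<in> vspace ?n"
    have "pr ?n (gact (ddual G X) s \<xi>) x = pr ?n \<xi> (\<Sum>k\<in>gcar G. act X (\<star>s) (s \<cdot> \<star>k \<cdot> \<star>s) x)"
      unfolding gact_def pr_sum_left pr_sum using sG by (intro sum.cong refl) (simp add: act_ddual[OF X])
    also have "(\<Sum>k\<in>gcar G. act X (\<star>s) (s \<cdot> \<star>k \<cdot> \<star>s) x) = gact X (\<star>s) x"
      unfolding gact_def
      by (rule sum.reindex_bij_witness[of _ "\<lambda>k. \<star>s \<cdot> \<star>k \<cdot> s" "\<lambda>k. s \<cdot> \<star>k \<cdot> \<star>s"])
        (use sG in \<open>auto simp: assoc\<close>)
    also have "pr ?n \<xi> (gact X (\<star>s) x) = pr ?n (sc (\<chi> (\<star>s)) \<xi>) x"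
      using xi x S(2)[OF s] by (simp add: cotype_def pr_sc)
    finally show "pr ?n (gact (ddual G X) s \<xi>) x = pr ?n (sc (\<chi> (\<star>s)) \<xi>) x" .
  qed (use xv in simp)
  ultimately have "has_type (ddual G X) (\<star>h) S (\<lambda>s. \<chi> (\<star>s)) \<xi>"
    using nz xv by (auto simp: has_type_def flux_def)
  then show ?thesis by blast
qed

end

subsection \<open>The affine group\<close>

lemma affine_simps [simp]:
  "(a, \<alpha>) \<in> gcar affine_grp \<longleftrightarrow> \<alpha> \<noteq> 0"
  "gone affine_grp = (0, 1)"
  "gmul affine_grp (a, \<alpha>) (b, \<beta>) = (a + \<alpha> * b, \<alpha> * \<beta>)"
  "ginv affine_grp (a, \<alpha>) = (- a / \<alpha>, inverse \<alpha>)"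
  for a b \<alpha> \<beta> :: "'k::{finite,field}"
  by (simp_all add: affine_grp_def)

type_synonym 'k arep = "('k \<times> 'k) drep"

abbreviation (input) Aff :: "('k::{finite,field} \<times> 'k) fgrp" where "Aff \<equiv> affine_grp"

abbreviation arep :: "'k::{finite,field} arep \<Rightarrow> bool" where "arep \<equiv> is_drep Aff"

lemma gcar_affine: "gcar Aff = UNIV \<times> - {0}"
  by (auto simp: affine_grp_def)

global_interpretation aff: finite_fgrp "Aff :: ('k::{finite,field} \<times> 'k) fgrp"
proof
  fix g h k :: "'k \<times> 'k"
  assume ghk: "g \<in> gcar Aff" "h \<in> gcar Aff" "k \<in> gcar Aff"
  then show "gmul Aff (gmul Aff g h) k = gmul Aff g (gmul Aff h k)"
    by (cases g, cases h, cases k) (simp add: algebra_simps)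
qed (auto simp: gcar_affine divide_inverse intro: left_inverse)

lemma sum_affine: "(\<Sum>h\<in>gcar Aff. f h) = (\<Sum>b\<in>UNIV. \<Sum>\<beta>\<in>-{0}. f (b, \<beta>))"
  unfolding gcar_affine by (simp add: sum.cartesian_product)

abbreviation Fl :: "'k::{finite,field} arep \<Rightarrow> 'k \<times> 'k \<Rightarrow> (nat \<Rightarrow> complex) set" where
  "Fl \<equiv> aff.flux"

abbreviation U :: "'k::{finite,field} arep \<Rightarrow> 'k \<Rightarrow> 'k \<Rightarrow> (nat \<Rightarrow> complex) \<Rightarrow> nat \<Rightarrow> complex" where
  "U X a \<alpha> \<equiv> aff.gact X (a, \<alpha>)"

lemma U_U: "arep X \<Longrightarrow> \<alpha> \<noteq> 0 \<Longrightarrow> \<beta> \<noteq> 0 \<Longrightarrow>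
    U X a \<alpha> (U X b \<beta> v) = U X (a + \<alpha> * b) (\<alpha> * \<beta>) v"
  using aff.gact_gact[of X "(a, \<alpha>)" "(b, \<beta>)" v] by simp

lemma U_one [simp]: "arep X \<Longrightarrow> v \<in> vspace (ddim X) \<Longrightarrow> U X 0 1 v = v"
  using aff.gact_one[of X v] by simp

lemma U_vspace [simp]: "arep X \<Longrightarrow> \<alpha> \<noteq> 0 \<Longrightarrow> U X a \<alpha> v \<in> vspace (ddim X)"
  by (rule aff.gact_vspace) auto

text \<open>Conjugation in the affine group: a translation shifts the flux by (1 - \<beta>) a, so it
  preserves the flux when \<beta> = 1. The separate b' lets the result be stated in any convenient
  form.\<close>

lemma U_flux:
  assumes "arep X" "v \<in> Fl X (b, \<beta>)" "\<alpha> \<noteq> 0" "\<beta> \<noteq> 0"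
    "b' = \<alpha> * b + (1 - \<beta>) * a"
  shows "U X a \<alpha> v \<in> Fl X (b', \<beta>)"
proof -
  have "gmul Aff (gmul Aff (a, \<alpha>) (b, \<beta>)) (ginv Aff (a, \<alpha>)) = (b', \<beta>)"
    using assms(3-5) by (simp add: field_simps)
  moreover have "U X a \<alpha> v \<in> Fl X
      (gmul Aff (gmul Aff (a, \<alpha>) (b, \<beta>)) (ginv Aff (a, \<alpha>)))"
    by (rule aff.gact_flux[OF assms(1,2)]) (use assms(3,4) in auto)
  ultimately show ?thesis by (simp only:)
qed

lemma act_flux:
  assumes "arep X" "v \<in> Fl X (b, \<beta>)" "\<alpha> \<noteq> 0" "\<beta> \<noteq> 0" "\<beta>' \<noteq> 0"
  shows "act X (a, \<alpha>) (b', \<beta>') v = (if b' = b \<and> \<beta>' = \<beta> then U X a \<alpha> v else 0)"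
  using aff.act_flux_eq_gact[OF assms(1,2), of "(a, \<alpha>)" "(b', \<beta>')"] assms(3-5) by simp

subsection \<open>Averages over the field\<close>

text \<open>Normalised so that constants average to themselves and the averages of translations
  against a character are projections.\<close>

definition favg :: "('k::{finite,field} \<Rightarrow> nat \<Rightarrow> complex) \<Rightarrow> nat \<Rightarrow> complex" where
  "favg f = sc (1 / of_nat (card (UNIV :: 'k set))) (\<Sum>x\<in>UNIV. f x)"

lemma favg_cong: "(\<And>x. f x = g x) \<Longrightarrow> favg f = favg g"
  by (simp add: favg_def)
lemma mv_favg: "mv M (favg f) = favg (\<lambda>x. mv M (f x))"
  by (simp add: favg_def mv_sc mv_sum)
lemma gact_favg: "aff.gact X g (favg f) = favg (\<lambda>x. aff.gact X g (f x))"
  by (simp add: favg_def aff.gact_sc aff.gact_sum)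
lemma favg_sc: "favg (\<lambda>x. sc c (f x)) = sc c (favg f)"
  by (simp add: favg_def sc_sum mult.commute)
lemma favg_swap: "favg (\<lambda>x. favg (\<lambda>y. f x y)) = favg (\<lambda>y. favg (\<lambda>x. f x y))"
  by (simp add: favg_def sc_sum mult.commute) (rule sum.swap)
lemma favg_sum: "favg (\<lambda>x. \<Sum>y\<in>A. f x y) = (\<Sum>y\<in>A. favg (\<lambda>x. f x y))"
  by (simp add: favg_def sc_sum) (rule sum.swap)
lemma favg_zero [simp]: "favg (\<lambda>x. 0) = 0"
  by (simp add: favg_def)
lemma favg_const [simp]: "favg (\<lambda>x::'k::{finite,field}. v) = v"
  by (rule ext) (simp add: favg_def sc_apply sum_fun_apply)
lemma favg_reindex: "bij p \<Longrightarrow> favg (\<lambda>x. f (p x)) = favg f" for p :: "'k::{finite,field} \<Rightarrow> 'k"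
  by (simp add: favg_def sum.reindex_bij_betw[of p UNIV UNIV f])
lemma tens_favg: "tens n (favg f) w = favg (\<lambda>x. tens n (f x) w)" "tens n v (favg f) = favg (\<lambda>x. tens n v (f x))"
  by (simp_all add: favg_def tens_sum_left tens_sum_right)
lemma flux_favg: "(\<And>x. f x \<in> Fl X h) \<Longrightarrow> favg f \<in> Fl X h"
  by (simp add: favg_def)

lemma bij_mult_add: "c \<noteq> 0 \<Longrightarrow> bij (\<lambda>x. c * x + d)" for c d :: "'k::{finite,field}"
  by (rule bij_betw_byWitness[where f'="\<lambda>x. (x - d) / c"]) auto

lemma favg_\<psi>: "favg (\<lambda>x. sc (\<psi> (x * c)) v) = (if c = 0 then v else 0)"
  for c :: "'k::{finite,field}"
  by (simp add: favg_def sum_sc sum_\<psi>_mult)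

text \<open>The phases \<psi>(b d x), summed over b, give a multiple of the delta function at the
  zero of d. A general d with a single zero covers the different affine functions that occur
  below.\<close>

lemma fourier_inversion:
  fixes d :: "'k::{finite,field} \<Rightarrow> 'k"
  assumes "\<And>x. d x = 0 \<longleftrightarrow> x = c"
  shows "(\<Sum>b\<in>UNIV. favg (\<lambda>x. sc (\<psi> (b * d x)) (f x))) = f c"
    "favg (\<lambda>b. \<Sum>x\<in>UNIV. sc (\<psi> (b * d x)) (f x)) = f c"
proof -
  show "favg (\<lambda>b. \<Sum>x\<in>UNIV. sc (\<psi> (b * d x)) (f x)) = f c"
    by (simp add: favg_sum favg_\<psi> assms sum.delta)
  then show "(\<Sum>b\<in>UNIV. favg (\<lambda>x. sc (\<psi> (b * d x)) (f x))) = f c"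
    by (simp add: favg_def sc_sum)
qed

subsection \<open>The functor\<close>

text \<open>On the vectors of flux \<open>(y, \<eta>)\<close> the new flux projections are
  \<open>P'(b, \<beta>) = [\<beta> \<eta> = 1] avg\<^sub>x \<psi>(- x b) U(x, 1)\<close> and the new group action is
  \<open>U'(a, \<alpha>) = \<psi>(a y / (\<eta> \<alpha>)) U(0, 1 / \<alpha>)\<close>; the definition below is \<open>U' P'\<close> written out.\<close>

definition Fob :: "'k::{finite,field} arep \<Rightarrow> 'k arep" where
  "Fob X = (ddim X, \<lambda>(a, \<alpha>) (b, \<beta>). msum (ddim X) (ddim X) UNIV (\<lambda>(x, y).
     (\<psi> (a * \<beta> * (y + (1 - 1 / \<beta>) * x) / \<alpha> - x * b) / of_nat (card (UNIV :: 'k set)))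
        \<cdot>\<^sub>m dact X (x / \<alpha>, 1 / \<alpha>) (y, 1 / \<beta>)))"

lemma ddim_Fob [simp]: "ddim (Fob X) = ddim X"
  by (simp add: Fob_def ddim_def)

lemma Fob_carrier: "dact (Fob X) g h \<in> carrier_mat (ddim X) (ddim X)"
  by (simp add: Fob_def dact_def split: prod.split)

lemma act_Fob:
  assumes X: "arep X" and "\<alpha> \<noteq> 0" "\<beta> \<noteq> 0"
  shows "act (Fob X) (a, \<alpha>) (b, \<beta>) v = favg (\<lambda>x. \<Sum>y\<in>UNIV.
    sc (\<psi> (a * \<beta> * (y + (1 - 1 / \<beta>) * x) / \<alpha> - x * b)) (act X (x / \<alpha>, 1 / \<alpha>) (y, 1 / \<beta>) v))"
proof -
  have c: "dact X (x / \<alpha>, 1 / \<alpha>) (y, 1 / \<beta>) \<in> carrier_mat (ddim X) (ddim X)" for x y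
    by (rule aff.dact_carrier[OF X]) (use assms in auto)
  have "act (Fob X) (a, \<alpha>) (b, \<beta>) v = (\<Sum>(x, y)\<in>UNIV \<times> UNIV.
     sc (\<psi> (a * \<beta> * (y + (1 - 1 / \<beta>) * x) / \<alpha> - x * b) / of_nat (card (UNIV :: 'a set)))
        (act X (x / \<alpha>, 1 / \<alpha>) (y, 1 / \<beta>) v))"
    using c by (simp add: Fob_def dact_def[of "(_, _)"] mv_msum mv_smult split_def)
  then show ?thesis
    by (simp add: favg_def sc_sum sum.cartesian_product split_def)
qed

text \<open>The translation U(x, 1) inside the new projection moves the flux from y to y + (1 -
  \<eta>) x, and the phase of the new action is evaluated there.\<close>

lemma act_Fob_flux:
  assumes X: "arep X" and v: "v \<in> Fl X (y, \<eta>)" and nz: "\<eta> \<noteq> 0" "\<alpha> \<noteq> 0" "\<beta> \<noteq> 0"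
  shows "act (Fob X) (a, \<alpha>) (b, \<beta>) v = (if \<beta> * \<eta> = 1 then
    favg (\<lambda>x. sc (\<psi> (a * (y + (1 - \<eta>) * x) / (\<eta> * \<alpha>) - x * b)) (U X (x / \<alpha>) (1 / \<alpha>) v)) else 0)"
proof -
  have 1: "act X (x / \<alpha>, 1 / \<alpha>) (z, 1 / \<beta>) v = (if z = y then if 1 / \<beta> = \<eta> then U X (x / \<alpha>) (1 / \<alpha>) v else 0 else 0)" for x z
    using act_flux[OF X v, of "1 / \<alpha>" "1 / \<beta>" "x / \<alpha>" z] nz by simp
  have 2: "1 / \<beta> = \<eta> \<longleftrightarrow> \<beta> * \<eta> = 1" using nz by (auto simp: field_simps)
  show ?thesis
  proof (cases "\<beta> * \<eta> = 1")
    case True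
    then have b: "\<beta> = 1 / \<eta>" using nz by (simp add: field_simps)
    show ?thesis
      unfolding act_Fob[OF X nz(2,3)] 1 using nz
      by (simp add: b if_distrib[of "sc _"] sum.delta cong: if_cong)
  next
    case False
    then show ?thesis unfolding act_Fob[OF X nz(2,3)] 1 by (simp add: 2 cong: if_cong)
  qed
qed

text \<open>Summing the new basis elements over all b leaves only the translation x = 0.\<close>

lemma gact_Fob_flux:
  assumes X: "arep X" and v: "v \<in> Fl X (y, \<eta>)" and nz: "\<eta> \<noteq> 0" "\<alpha> \<noteq> 0"
  shows "U (Fob X) a \<alpha> v = sc (\<psi> (a * y / (\<eta> * \<alpha>))) (U X 0 (1 / \<alpha>) v)"
proof -
  let ?f = "\<lambda>x. sc (\<psi> (a * (y + (1 - \<eta>) * x) / (\<eta> * \<alpha>))) (U X (x / \<alpha>) (1 / \<alpha>) v)"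
  have "U (Fob X) a \<alpha> v = (\<Sum>b\<in>UNIV. \<Sum>\<beta>\<in>-{0}. if \<beta> = 1 / \<eta> then
      favg (\<lambda>x. sc (\<psi> (a * (y + (1 - \<eta>) * x) / (\<eta> * \<alpha>) - x * b)) (U X (x / \<alpha>) (1 / \<alpha>) v)) else 0)"
    unfolding aff.gact_def[of "Fob X"] sum_affine using nz
    by (intro sum.cong refl) (simp add: act_Fob_flux[OF X v] eq_divide_eq)
  also have "\<dots> = (\<Sum>b\<in>UNIV. favg (\<lambda>x. sc (\<psi> (b * (- x))) (?f x)))"
    using nz by (intro sum.cong refl) (simp add: sum.delta \<psi>_add[symmetric] algebra_simps)
  also have "\<dots> = ?f 0" by (rule fourier_inversion) simp
  finally show ?thesis by simp
qed

text \<open>A product of two new operators is a double average over translations x1, x2. In the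
  variables x1 and \<alpha>2 x1 + x2 it splits, and the average over x1 is the delta function of the
  A-part of the required conjugacy relation. The H-part comes from comparing \<beta>1 and \<beta>2
  with \<eta>.\<close>

lemma is_drep_Fob:
  assumes X: "arep X"
  shows "arep (Fob X)"
  unfolding is_drep_def
proof (intro conjI ballI)
  let ?n = "ddim (Fob X)" and ?G = "Aff :: ('a \<times> 'a) fgrp"
  show "dact (Fob X) g h \<in> carrier_mat ?n ?n" for g h using Fob_carrier by simp
  fix g1 h1 g2 h2 :: "'a \<times> 'a"
  assume g: "g1 \<in> gcar Aff" "h1 \<in> gcar Aff" "g2 \<in> gcar Aff" "h2 \<in> gcar Aff"
  obtain a1 \<alpha>1 b1 \<beta>1 a2 \<alpha>2 b2 \<beta>2 where e: "g1 = (a1, \<alpha>1)" "h1 = (b1, \<beta>1)" "g2 = (a2, \<alpha>2)" "h2 = (b2, \<beta>2)"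
    by (metis surj_pair)
  with g have nz: "\<alpha>1 \<noteq> 0" "\<alpha>2 \<noteq> 0" "\<beta>1 \<noteq> 0" "\<beta>2 \<noteq> 0" by auto
  have cond: "h2 = gmul ?G (gmul ?G (ginv ?G g2) h1) g2 \<longleftrightarrow> b1 = \<alpha>2 * b2 + (1 - \<beta>2) * a2 \<and> \<beta>1 = \<beta>2"
    using aff.conj_iff[OF g(3,4,2)] nz by (auto simp: e algebra_simps)
  show "dact (Fob X) g1 h1 * dact (Fob X) g2 h2 =
      (if h2 = gmul ?G (gmul ?G (ginv ?G g2) h1) g2 then dact (Fob X) (gmul ?G g1 g2) h2 else 0\<^sub>m ?n ?n)"
  proof (rule aff.mat_eqI_flux[OF X])
    show "dact (Fob X) g1 h1 * dact (Fob X) g2 h2 \<in> carrier_mat (ddim X) (ddim X)"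
      by (rule mult_carrier_mat[OF Fob_carrier Fob_carrier])
    fix v h assume h: "h \<in> gcar Aff" and v: "v \<in> Fl X h"
    obtain y \<eta> where h_eq: "h = (y, \<eta>)" by fastforce
    then have nh: "\<eta> \<noteq> 0" and v: "v \<in> Fl X (y, \<eta>)" using h v by auto
    let ?E = "\<lambda>x. (a1 + \<alpha>1 * a2) * (y + (1 - \<eta>) * x) / (\<eta> * (\<alpha>1 * \<alpha>2)) - x * b2"
    let ?w = "\<lambda>x. U X (x / (\<alpha>1 * \<alpha>2)) (1 / (\<alpha>1 * \<alpha>2)) v"
    have fl: "U X (x / \<alpha>2) (1 / \<alpha>2) v \<in> Fl X ((y + (1 - \<eta>) * x) / \<alpha>2, \<eta>)" for x
      by (rule U_flux[OF X v]) (use nz nh in \<open>auto simp: field_simps\<close>)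
    have "act (Fob X) g1 h1 (act (Fob X) g2 h2 v) =
      (if \<beta>2 * \<eta> = 1 \<and> \<beta>1 * \<eta> = 1 then favg (\<lambda>x2. favg (\<lambda>x1.
         sc (\<psi> (a2 * (y + (1 - \<eta>) * x2) / (\<eta> * \<alpha>2) - x2 * b2))
           (sc (\<psi> (a1 * ((y + (1 - \<eta>) * x2) / \<alpha>2 + (1 - \<eta>) * x1) / (\<eta> * \<alpha>1) - x1 * b1))
             (U X (x1 / \<alpha>1) (1 / \<alpha>1) (U X (x2 / \<alpha>2) (1 / \<alpha>2) v))))) else 0)"
      using nz nh by (simp add: e act_Fob_flux[OF X v] mv_favg mv_sc act_Fob_flux[OF X fl] favg_sc del: sc_sc)
    also have "\<dots> = (if \<beta>2 * \<eta> = 1 \<and> \<beta>1 * \<eta> = 1 then favg (\<lambda>x2. favg (\<lambda>x1.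
         sc (\<psi> (x1 * (\<alpha>2 * b2 + (1 - \<beta>2) * a2 - b1) + ?E (\<alpha>2 * x1 + x2))) (?w (\<alpha>2 * x1 + x2)))) else 0)"
    proof (intro if_cong refl favg_cong)
      fix x1 x2
      assume "\<beta>2 * \<eta> = 1 \<and> \<beta>1 * \<eta> = 1"
      then have b: "\<beta>2 = 1 / \<eta>" using nh by (simp add: field_simps)
      have "U X (x1 / \<alpha>1) (1 / \<alpha>1) (U X (x2 / \<alpha>2) (1 / \<alpha>2) v) = ?w (\<alpha>2 * x1 + x2)"
        using nz by (simp add: U_U[OF X] add_divide_distrib)
      \<comment> \<open>The exponents are sorted so that x1 occurs once with the coefficient to be
        killed and otherwise only through \<alpha>2 x1 + x2.\<close>
      moreover have "(a2 * (y + (1 - \<eta>) * x2) / (\<eta> * \<alpha>2) - x2 * b2) +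
          (a1 * ((y + (1 - \<eta>) * x2) / \<alpha>2 + (1 - \<eta>) * x1) / (\<eta> * \<alpha>1) - x1 * b1) =
          x1 * (\<alpha>2 * b2 + (1 - \<beta>2) * a2 - b1) + ?E (\<alpha>2 * x1 + x2)"
        using nz nh unfolding b by (simp add: field_simps)
      ultimately show "sc (\<psi> (a2 * (y + (1 - \<eta>) * x2) / (\<eta> * \<alpha>2) - x2 * b2))
           (sc (\<psi> (a1 * ((y + (1 - \<eta>) * x2) / \<alpha>2 + (1 - \<eta>) * x1) / (\<eta> * \<alpha>1) - x1 * b1))
             (U X (x1 / \<alpha>1) (1 / \<alpha>1) (U X (x2 / \<alpha>2) (1 / \<alpha>2) v))) =
          sc (\<psi> (x1 * (\<alpha>2 * b2 + (1 - \<beta>2) * a2 - b1) + ?E (\<alpha>2 * x1 + x2))) (?w (\<alpha>2 * x1 + x2))"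
        by (simp only: sc_sc \<psi>_add[symmetric])
    qed
    also have "favg (\<lambda>x2. favg (\<lambda>x1. sc (\<psi> (x1 * (\<alpha>2 * b2 + (1 - \<beta>2) * a2 - b1) + ?E (\<alpha>2 * x1 + x2))) (?w (\<alpha>2 * x1 + x2)))) =
        favg (\<lambda>x1. favg (\<lambda>x2. sc (\<psi> (x1 * (\<alpha>2 * b2 + (1 - \<beta>2) * a2 - b1) + ?E (1 * x2 + \<alpha>2 * x1))) (?w (1 * x2 + \<alpha>2 * x1))))"
      by (subst favg_swap) (simp only: mult_1 add.commute[of "\<alpha>2 * _"])
    also have "\<dots> = favg (\<lambda>x1. favg (\<lambda>x. sc (\<psi> (x1 * (\<alpha>2 * b2 + (1 - \<beta>2) * a2 - b1) + ?E x)) (?w x)))"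
      by (rule favg_cong, rule favg_reindex) (rule bij_mult_add, simp)
    also have "\<dots> = favg (\<lambda>x. favg (\<lambda>x1. sc (\<psi> (x1 * (\<alpha>2 * b2 + (1 - \<beta>2) * a2 - b1))) (sc (\<psi> (?E x)) (?w x))))"
      by (subst favg_swap) (simp only: \<psi>_add sc_sc)
    also have "\<dots> = (if b1 = \<alpha>2 * b2 + (1 - \<beta>2) * a2 then favg (\<lambda>x. sc (\<psi> (?E x)) (?w x)) else 0)"
      by (simp only: favg_\<psi>) auto
    finally have *: "act (Fob X) g1 h1 (act (Fob X) g2 h2 v) =
      (if \<beta>2 * \<eta> = 1 \<and> \<beta>1 * \<eta> = 1 then if b1 = \<alpha>2 * b2 + (1 - \<beta>2) * a2 then favg (\<lambda>x. sc (\<psi> (?E x)) (?w x)) else 0 else 0)" .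
    have "\<beta>1 = \<beta>2" if "\<beta>2 * \<eta> = 1" "\<beta>1 * \<eta> = 1" using that nh by (metis mult_right_cancel)
    then show "mv (dact (Fob X) g1 h1 * dact (Fob X) g2 h2) v =
      mv (if h2 = gmul ?G (gmul ?G (ginv ?G g2) h1) g2 then dact (Fob X) (gmul ?G g1 g2) h2 else 0\<^sub>m ?n ?n) v"
      unfolding mv_mult[OF Fob_carrier Fob_carrier] * cond
      using nz nh by (auto simp: e act_Fob_flux[OF X v])
  qed (simp add: Fob_carrier)
next
  let ?n = "ddim (Fob X)" and ?G = "Aff :: ('a \<times> 'a) fgrp"
  show "msum ?n ?n (gcar ?G) (\<lambda>h. dact (Fob X) (gone ?G) h) = 1\<^sub>m ?n"
  proof (rule aff.mat_eqI_flux[OF X])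
    fix v h assume h: "h \<in> gcar Aff" and v: "v \<in> Fl X h"
    obtain y \<eta> where h_eq: "h = (y, \<eta>)" by fastforce
    then have nh: "\<eta> \<noteq> 0" and v: "v \<in> Fl X (y, \<eta>)" using h v by auto
    have "mv (msum ?n ?n (gcar ?G) (\<lambda>h. dact (Fob X) (gone ?G) h)) v = U (Fob X) 0 1 v"
      by (simp add: mv_msum Fob_carrier aff.gact_def)
    also have "\<dots> = v" using gact_Fob_flux[OF X v nh, of 1 0] aff.flux_vspace[OF v] X by simp
    finally show "mv (msum ?n ?n (gcar ?G) (\<lambda>h. dact (Fob X) (gone ?G) h)) v = mv (1\<^sub>m ?n) v"
      using aff.flux_vspace[OF v] by simp
  qed auto
qed

text \<open>Two Fourier transforms in succession: the sum over y forces x' = a \<beta> / \<alpha>,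
  then the average over x forces y0 = b \<beta>. The opposite signs in the new projection and the
  new action prevent a sign change; what remains is conjugation by the H-part (0, \<beta>) of the
  flux.\<close>

lemma Fob_Fob:
  assumes X: "arep X" and nz: "\<alpha> \<noteq> 0" "\<beta> \<noteq> 0"
  shows "dact (Fob (Fob X)) (a, \<alpha>) (b, \<beta>) = dact X (a * \<beta>, \<alpha>) (b * \<beta>, \<beta>)"
proof (rule aff.mat_eqI_flux[OF X])
  note FX = is_drep_Fob[OF X]
  show "dact X (a * \<beta>, \<alpha>) (b * \<beta>, \<beta>) \<in> carrier_mat (ddim X) (ddim X)"
    by (rule aff.dact_carrier[OF X]) (use nz in auto)
  fix v h assume h: "h \<in> gcar Aff" and v: "v \<in> Fl X h"
  obtain y0 \<eta> where h_eq: "h = (y0, \<eta>)" by fastforce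
  then have nh: "\<eta> \<noteq> 0" and v: "v \<in> Fl X (y0, \<eta>)" using h v by auto
  have "act (Fob (Fob X)) (a, \<alpha>) (b, \<beta>) v = favg (\<lambda>x. \<Sum>y\<in>UNIV.
    sc (\<psi> (a * \<beta> * (y + (1 - 1 / \<beta>) * x) / \<alpha> - x * b)) (if \<eta> = \<beta> then favg (\<lambda>x'.
      sc (\<psi> (x / \<alpha> * (y0 + (1 - \<eta>) * x') / (\<eta> * (1 / \<alpha>)) - x' * y)) (U X (x' * \<alpha>) \<alpha> v)) else 0))"
    using nz nh by (simp add: act_Fob[OF FX] act_Fob_flux[OF X v] cong: if_cong)
  also have "\<dots> = (if \<eta> = \<beta> then favg (\<lambda>x. \<Sum>y\<in>UNIV. favg (\<lambda>x'. sc (\<psi> (y * (a * \<beta> / \<alpha> - x')))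
      (sc (\<psi> (x * ((\<beta> - 1) * a / \<alpha> + (y0 + (1 - \<beta>) * x') / \<beta> - b))) (U X (x' * \<alpha>) \<alpha> v)))) else 0)"
  proof (cases "\<eta> = \<beta>")
    case True
    have E: "(a * \<beta> * (y + (1 - 1 / \<beta>) * x) / \<alpha> - x * b) + (x / \<alpha> * (y0 + (1 - \<beta>) * x') / (\<beta> * (1 / \<alpha>)) - x' * y) =
      y * (a * \<beta> / \<alpha> - x') + x * ((\<beta> - 1) * a / \<alpha> + (y0 + (1 - \<beta>) * x') / \<beta> - b)" for x x' y
      using nz by (simp add: field_simps)
    show ?thesis unfolding True by (simp only: simp_thms if_True favg_sc[symmetric] sc_sc \<psi>_add[symmetric] E)
  qed simp
  also have "\<dots> = (if \<eta> = \<beta> then favg (\<lambda>x. sc (\<psi> (x * ((\<beta> - 1) * a / \<alpha> + (y0 + (1 - \<beta>) * (a * \<beta> / \<alpha>)) / \<beta> - b)))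
      (U X (a * \<beta> / \<alpha> * \<alpha>) \<alpha> v)) else 0)"
    by (intro if_cong refl favg_cong fourier_inversion) auto
  also have "\<dots> = (if \<eta> = \<beta> \<and> y0 = b * \<beta> then U X (a * \<beta>) \<alpha> v else 0)"
  proof -
    have "(\<beta> - 1) * a / \<alpha> + (y0 + (1 - \<beta>) * (a * \<beta> / \<alpha>)) / \<beta> - b = 0 \<longleftrightarrow> y0 = b * \<beta>"
      using nz by (simp add: field_simps)
    then show ?thesis unfolding favg_\<psi> using nz by auto
  qed
  finally show "mv (dact (Fob (Fob X)) (a, \<alpha>) (b, \<beta>)) v = mv (dact X (a * \<beta>, \<alpha>) (b * \<beta>, \<beta>)) v"
    using nz nh act_flux[OF X v nz(1) nh nz(2), of "a * \<beta>" "b * \<beta>"] by auto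
qed (use Fob_carrier[of "Fob X"] in auto)

lemma dhom_Fob_subset:
  assumes X: "arep X" and Y: "arep Y" and T: "T \<in> dhom Aff X Y"
  shows "T \<in> dhom Aff (Fob X) (Fob Y)"
proof -
  have Tc: "T \<in> carrier_mat (ddim Y) (ddim X)" using T by (simp add: dhom_def)
  have "T * dact (Fob X) g h = dact (Fob Y) g h * T"
    if "g \<in> gcar Aff" "h \<in> gcar Aff" for g h
  proof (rule mat_eqI_mv)
    show "T * dact (Fob X) g h \<in> carrier_mat (ddim Y) (ddim X)" "dact (Fob Y) g h * T \<in> carrier_mat (ddim Y) (ddim X)"
      using mult_carrier_mat[OF Tc Fob_carrier] mult_carrier_mat[OF Fob_carrier Tc] by auto
    fix v
    obtain a \<alpha> b \<beta> where e: "g = (a, \<alpha>)" "h = (b, \<beta>)" by (metis surj_pair)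
    with that have nz: "\<alpha> \<noteq> 0" "\<beta> \<noteq> 0" by auto
    then show "mv (T * dact (Fob X) g h) v = mv (dact (Fob Y) g h * T) v"
      by (simp add: e mv_mult[OF Tc Fob_carrier] mv_mult[OF Fob_carrier Tc] act_Fob[OF X] act_Fob[OF Y]
          mv_favg mv_sum mv_sc aff.dhom_act[OF X Y T])
  qed
  with Tc show ?thesis by (simp add: dhom_def)
qed

text \<open>No intertwiner is lost, since new operators are combinations of old ones; none is
  gained, since a second application recovers the old operators with a and b rescaled by
  \<beta>.\<close>

lemma dhom_Fob:
  assumes X: "arep X" and Y: "arep Y"
  shows "dhom Aff (Fob X) (Fob Y) = dhom Aff X Y"
proof (intro equalityI subsetI)
  fix T assume "T \<in> dhom Aff (Fob X) (Fob Y)"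
  then have T: "T \<in> dhom Aff (Fob (Fob X)) (Fob (Fob Y))"
    by (rule dhom_Fob_subset[OF is_drep_Fob[OF X] is_drep_Fob[OF Y]])
  have "T * dact X (a, \<alpha>) (b, \<beta>) = dact Y (a, \<alpha>) (b, \<beta>) * T" if "\<alpha> \<noteq> 0" "\<beta> \<noteq> 0" for a \<alpha> b \<beta>
  proof -
    have "T * dact (Fob (Fob X)) (a / \<beta>, \<alpha>) (b / \<beta>, \<beta>) = dact (Fob (Fob Y)) (a / \<beta>, \<alpha>) (b / \<beta>, \<beta>) * T"
      using T that unfolding dhom_def by fastforce
    then show ?thesis using that by (simp add: Fob_Fob[OF X] Fob_Fob[OF Y])
  qed
  with T show "T \<in> dhom Aff X Y" by (auto simp: dhom_def gcar_affine)
qed (rule dhom_Fob_subset[OF X Y])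

lemma subrep_Fob: "arep X \<Longrightarrow> aff.subrep X N \<Longrightarrow> aff.subrep (Fob X) N"
proof -
  assume X: "arep X" and N: "aff.subrep X N"
  have "act (Fob X) (a, \<alpha>) (b, \<beta>) v \<in> N" if "\<alpha> \<noteq> 0" "\<beta> \<noteq> 0" "v \<in> N" for a \<alpha> b \<beta> v
  proof -
    have "act X (x / \<alpha>, 1 / \<alpha>) (y, 1 / \<beta>) v \<in> N" for x y
      using N that unfolding aff.subrep_def by auto
    moreover have sc: "sc c w \<in> N" if "w \<in> N" for c w using N that unfolding aff.subrep_def by blast
    ultimately show ?thesis
      unfolding act_Fob[OF X that(1,2)] favg_def by (intro sc aff.subrep_sum[OF N])
  qed
  then show "aff.subrep (Fob X) N" using N by (auto simp: aff.subrep_def gcar_affine)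
qed

text \<open>X and its image have the same subrepresentations, again because the second application
  returns the original operators.\<close>

lemma dsimple_Fob:
  assumes X: "dsimple Aff X"
  shows "dsimple Aff (Fob X)"
proof (rule aff.dsimpleI)
  note Xr = aff.dsimple_drep[OF X]
  show "arep (Fob X)" by (rule is_drep_Fob[OF Xr])
  show "ddim (Fob X) > 0" using X by (simp add: dsimple_def)
  fix N v assume N: "aff.subrep (Fob X) N" and v: "v \<in> N" "v \<noteq> 0"
  have N2: "aff.subrep (Fob (Fob X)) N" by (rule subrep_Fob[OF is_drep_Fob[OF Xr] N])
  have "act X (a, \<alpha>) (b, \<beta>) v \<in> N" if "\<alpha> \<noteq> 0" "\<beta> \<noteq> 0" "v \<in> N" for a \<alpha> b \<beta> v
  proof -
    have "act (Fob (Fob X)) (a / \<beta>, \<alpha>) (b / \<beta>, \<beta>) v \<in> N"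
      using N2 that unfolding aff.subrep_def by auto
    then show ?thesis using that by (simp add: Fob_Fob[OF Xr])
  qed
  then have "aff.subrep X N" using N by (auto simp: aff.subrep_def gcar_affine)
  from aff.dsimple_subrep[OF X this v] show "vspace (ddim (Fob X)) \<subseteq> N" by simp
qed

subsection \<open>The square of the functor is isomorphic to the identity\<close>

text \<open>On vectors of flux (b, \<beta>) this is U(0, f \<beta>). The choice f \<beta> = \<beta>
  undoes the conjugation found in \<open>Fob_Fob\<close>, and f \<beta> = 1 / \<beta> gives the
  inverse matrix.\<close>

definition twist :: "'k::{finite,field} arep \<Rightarrow> ('k \<Rightarrow> 'k) \<Rightarrow> complex mat" where
  "twist X f = msum (ddim X) (ddim X) (gcar Aff)
     (\<lambda>h. aff.gmat X (0, f (snd h)) * dact X (0, 1) h)"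

lemma twist_carrier [simp]: "twist X f \<in> carrier_mat (ddim X) (ddim X)"
  by (simp add: twist_def)

lemma mv_twist:
  assumes X: "arep X" and v: "v \<in> Fl X (y, \<eta>)" and nz: "\<eta> \<noteq> 0"
    and f: "\<And>\<beta>. \<beta> \<noteq> 0 \<Longrightarrow> f \<beta> \<noteq> 0"
  shows "mv (twist X f) v = U X 0 (f \<eta>) v"
proof -
  have c: "dact X (0, 1) h \<in> carrier_mat (ddim X) (ddim X)" if "h \<in> gcar Aff" for h
    by (rule aff.dact_carrier[OF X]) (use that in auto)
  have "mv (twist X f) v = (\<Sum>h\<in>gcar Aff. mv (aff.gmat X (0, f (snd h)) * dact X (0, 1) h) v)"
    unfolding twist_def by (rule mv_msum) (rule mult_carrier_mat[OF aff.gmat_carrier c])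
  also have "\<dots> = (\<Sum>h\<in>gcar Aff. if h = (y, \<eta>) then U X 0 (f \<eta>) v else 0)"
  proof (intro sum.cong refl)
    fix h :: "'a \<times> 'a" assume h: "h \<in> gcar Aff"
    obtain b \<beta> where e: "h = (b, \<beta>)" by fastforce
    with h have b: "\<beta> \<noteq> 0" by simp
    have "mv (aff.gmat X (0, f (snd h)) * dact X (0, 1) h) v = U X 0 (f \<beta>) (act X (0, 1) (b, \<beta>) v)"
      unfolding mv_mult[OF aff.gmat_carrier c[OF h]] using f[OF b] by (simp add: e aff.mv_gmat[OF X])
    then show "mv (aff.gmat X (0, f (snd h)) * dact X (0, 1) h) v = (if h = (y, \<eta>) then U X 0 (f \<eta>) v else 0)"
      using act_flux[OF X v, of 1 \<beta> 0 b] b nz X aff.flux_vspace[OF v] by (auto simp: e)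
  qed
  also have "\<dots> = U X 0 (f \<eta>) v"
    using nz aff.fin by (simp add: sum.delta)
  finally show ?thesis .
qed

lemma flux_Fob_Fob:
  assumes X: "arep X" and nz: "\<beta> \<noteq> 0"
  shows "Fl (Fob (Fob X)) (b, \<beta>) = Fl X (b * \<beta>, \<beta>)"
  using Fob_Fob[OF X _ nz, of 1 0 b] by (simp add: aff.flux_def)

lemma diso_Fob_Fob:
  assumes X: "arep X"
  shows "diso Aff X (Fob (Fob X))"
proof -
  note FX = is_drep_Fob[OF is_drep_Fob[OF X]]
  note tw = mv_twist[OF X, where f="\<lambda>\<beta>. \<beta>"] and twi = mv_twist[OF X, where f="\<lambda>\<beta>. 1 / \<beta>"]
  have "twist X (\<lambda>\<beta>. \<beta>) \<in> dhom Aff X (Fob (Fob X))"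
  proof (rule aff.dhom_fluxI[OF X FX])
    show "twist X (\<lambda>\<beta>. \<beta>) \<in> carrier_mat (ddim (Fob (Fob X))) (ddim X)" by simp
    fix h :: "'a \<times> 'a" and v assume h: "h \<in> gcar Aff" and v: "v \<in> Fl X h"
    obtain y \<eta> where e: "h = (y, \<eta>)" by fastforce
    have nz: "\<eta> \<noteq> 0" and v: "v \<in> Fl X (y, \<eta>)" using h v by (auto simp: e)
    \<comment> \<open>Flux (y, \<eta>) in the square means old flux (y \<eta>, \<eta>), which is
      where U(0, \<eta>) takes flux (y, \<eta>).\<close>
    have Nv: "U X 0 \<eta> v \<in> Fl X (y * \<eta>, \<eta>)"
      by (rule U_flux[OF X v nz nz]) (simp add: mult.commute)
    then show "mv (twist X (\<lambda>\<beta>. \<beta>)) v \<in> Fl (Fob (Fob X)) h"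
      by (simp add: e tw[OF v nz] flux_Fob_Fob[OF X nz])
    fix g :: "'a \<times> 'a" assume g: "g \<in> gcar Aff"
    obtain a \<alpha> where eg: "g = (a, \<alpha>)" by fastforce
    with g have na: "\<alpha> \<noteq> 0" by simp
    have 1: "U X a \<alpha> v \<in> Fl X (\<alpha> * y + (1 - \<eta>) * a, \<eta>)"
      by (rule U_flux[OF X v na nz]) simp
    have "aff.gact (Fob (Fob X)) g (U X 0 \<eta> v) = act (Fob (Fob X)) (a, \<alpha>) (y, \<eta>) (U X 0 \<eta> v)"
      using act_flux[OF FX _ na nz nz, of "U X 0 \<eta> v" y a y] Nv by (simp add: eg flux_Fob_Fob[OF X nz])
    also have "\<dots> = act X (a * \<eta>, \<alpha>) (y * \<eta>, \<eta>) (U X 0 \<eta> v)"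
      by (simp add: Fob_Fob[OF X na nz])
    also have "\<dots> = U X (a * \<eta>) \<alpha> (U X 0 \<eta> v)"
      using act_flux[OF X Nv na nz nz] by simp
    also have "\<dots> = U X 0 \<eta> (U X a \<alpha> v)"
      using na nz by (simp add: U_U[OF X] mult.commute)
    finally show "mv (twist X (\<lambda>\<beta>. \<beta>)) (aff.gact X g v) = aff.gact (Fob (Fob X)) g (mv (twist X (\<lambda>\<beta>. \<beta>)) v)"
      by (simp add: tw[OF v nz] tw[OF 1 nz] eg)
  qed
  moreover have "twist X (\<lambda>\<beta>. 1 / \<beta>) * twist X (\<lambda>\<beta>. \<beta>) = 1\<^sub>m (ddim X)"
  proof (rule aff.mat_eqI_flux[OF X])
    show "twist X (\<lambda>\<beta>. 1 / \<beta>) * twist X (\<lambda>\<beta>. \<beta>) \<in> carrier_mat (ddim X) (ddim X)"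
      by (rule mult_carrier_mat[OF twist_carrier twist_carrier])
    fix h :: "'a \<times> 'a" and v assume h: "h \<in> gcar Aff" and v: "v \<in> Fl X h"
    obtain y \<eta> where e: "h = (y, \<eta>)" by fastforce
    have nz: "\<eta> \<noteq> 0" and v: "v \<in> Fl X (y, \<eta>)" using h v by (auto simp: e)
    have Nv: "U X 0 \<eta> v \<in> Fl X (y * \<eta>, \<eta>)"
      by (rule U_flux[OF X v nz nz]) (simp add: mult.commute)
    show "mv (twist X (\<lambda>\<beta>. 1 / \<beta>) * twist X (\<lambda>\<beta>. \<beta>)) v = mv (1\<^sub>m (ddim X)) v"
      using nz aff.flux_vspace[OF v]
      by (simp add: mv_mult[OF twist_carrier twist_carrier] tw[OF v nz] twi[OF Nv nz] U_U[OF X] X)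
  qed auto
  moreover from this have "twist X (\<lambda>\<beta>. \<beta>) * twist X (\<lambda>\<beta>. 1 / \<beta>) = 1\<^sub>m (ddim X)"
    by (rule mat_mult_left_right_inverse[OF twist_carrier twist_carrier])
  ultimately have "is_iso_mor Aff X (Fob (Fob X)) (twist X (\<lambda>\<beta>. \<beta>))"
    by (intro aff.is_iso_morI[OF _ X FX, where S="twist X (\<lambda>\<beta>. 1 / \<beta>)"]) (simp_all only: ddim_Fob twist_carrier)
  then show ?thesis by (auto simp: diso_def)
qed

subsection \<open>The tensor structure\<close>

text \<open>The tensor structure is c = - 1 and its inverse is c = 1: the flux of the left factor is
  untouched, so the parameters of successive applications add.\<close>

definition Jm :: "'k \<Rightarrow> 'k::{finite,field} arep \<Rightarrow> 'k arep \<Rightarrow> complex mat" where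
  "Jm c X Y = msum (ddim X * ddim Y) (ddim X * ddim Y) (gcar Aff)
     (\<lambda>h. kron (dact X (0, 1) h) (aff.gmat Y (c * fst h / snd h, 1)))"

abbreviation Jt :: "'k::{finite,field} arep \<Rightarrow> 'k arep \<Rightarrow> complex mat" where
  "Jt \<equiv> Jm (- 1)"

lemma Jm_carrier [simp]: "Jm c X Y \<in> carrier_mat (ddim X * ddim Y) (ddim X * ddim Y)"
  by (simp add: Jm_def)

lemma mv_Jm:
  assumes X: "arep X" and Y: "arep Y"
    and v: "v \<in> Fl X (b, \<beta>)" and nz: "\<beta> \<noteq> 0"
  shows "mv (Jm c X Y) (tens (ddim Y) v w) = tens (ddim Y) v (U Y (c * b / \<beta>) 1 w)"
proof -
  have cX: "dact X (0, 1) h \<in> carrier_mat (ddim X) (ddim X)" if "h \<in> gcar Aff" for h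
    by (rule aff.dact_carrier[OF X]) (use that in auto)
  have "mv (Jm c X Y) (tens (ddim Y) v w) = (\<Sum>h\<in>gcar Aff.
      mv (kron (dact X (0, 1) h) (aff.gmat Y (c * fst h / snd h, 1))) (tens (ddim Y) v w))"
    unfolding Jm_def by (rule mv_msum) (rule kron_carrier[OF cX aff.gmat_carrier])
  also have "\<dots> = (\<Sum>h\<in>gcar Aff. if h = (b, \<beta>) then tens (ddim Y) v (U Y (c * b / \<beta>) 1 w) else 0)"
  proof (intro sum.cong refl)
    fix h :: "'a \<times> 'a" assume h: "h \<in> gcar Aff"
    obtain b' \<beta>' where e: "h = (b', \<beta>')" by fastforce
    with h have b: "\<beta>' \<noteq> 0" by simp
    show "mv (kron (dact X (0, 1) h) (aff.gmat Y (c * fst h / snd h, 1))) (tens (ddim Y) v w) =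
        (if h = (b, \<beta>) then tens (ddim Y) v (U Y (c * b / \<beta>) 1 w) else 0)"
      unfolding mv_kron_tens[OF cX[OF h] aff.gmat_carrier]
      using act_flux[OF X v, of 1 \<beta>' 0 b'] b nz X aff.flux_vspace[OF v]
      by (auto simp: e aff.mv_gmat[OF Y])
  qed
  also have "\<dots> = tens (ddim Y) v (U Y (c * b / \<beta>) 1 w)"
    using nz aff.fin by (simp add: sum.delta)
  finally show ?thesis .
qed

context finite_fgrp
begin

lemma mat_eqI_tens3_flux:
  assumes X: "is_drep G X" and Y: "is_drep G Y" and Z: "is_drep G Z"
    and A: "A \<in> carrier_mat l (ddim X * ddim Y * ddim Z)" and B: "B \<in> carrier_mat l (ddim X * ddim Y * ddim Z)"
    and eq: "\<And>h k m u v w. h \<in> gcar G \<Longrightarrow> k \<in> gcar G \<Longrightarrow> m \<in> gcar G \<Longrightarrow> u \<in> flux X h \<Longrightarrow> v \<in> flux Y k \<Longrightarrow>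
      w \<in> flux Z m \<Longrightarrow>
      mv A (tens (ddim Z) (tens (ddim Y) u v) w) = mv B (tens (ddim Z) (tens (ddim Y) u v) w)"
  shows "A = B"
proof -
  let ?m = "ddim X" and ?n = "ddim Y" and ?p = "ddim Z"
  have e: "mv A (tens ?p (tens ?n u v) w) = mv B (tens ?p (tens ?n u v) w)"
    if u: "u \<in> vspace ?m" and v: "v \<in> vspace ?n" and w: "w \<in> vspace ?p" for u v w
  proof -
    have "mv A (tens ?p (tens ?n (\<Sum>h\<in>gcar G. act X \<e> h u) (\<Sum>h\<in>gcar G. act Y \<e> h v)) (\<Sum>h\<in>gcar G. act Z \<e> h w)) =
      mv B (tens ?p (tens ?n (\<Sum>h\<in>gcar G. act X \<e> h u) (\<Sum>h\<in>gcar G. act Y \<e> h v)) (\<Sum>h\<in>gcar G. act Z \<e> h w))"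
      unfolding mv_sum tens_sum_left tens_sum_right
      by (intro sum.cong refl eq[OF _ _ _ act_one_flux[OF X] act_one_flux[OF Y] act_one_flux[OF Z]]) auto
    then show ?thesis by (simp only: flux_expand[OF X u] flux_expand[OF Y v] flux_expand[OF Z w])
  qed
  show ?thesis
  proof (rule eq_matI)
    fix i j assume "i < dim_row B" "j < dim_col B"
    then have ij: "i < l" "j < ?m * ?n * ?p" using B by auto
    then have pos: "?p > 0" "?n > 0" by (auto intro: Nat.gr0I)
    have j1: "j div ?p < ?m * ?n" "j mod ?p < ?p" using ij pos by (auto simp: less_mult_imp_div_less)
    have j2: "j div ?p div ?n < ?m" "j div ?p mod ?n < ?n" using j1 pos by (auto simp: less_mult_imp_div_less)
    have "mv A (unitv j) = mv B (unitv j)"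
      unfolding unitv_tens[OF ij(2)] unitv_tens[OF j1(1)] by (intro e vspace_unitv j1 j2)
    then show "A $$ (i, j) = B $$ (i, j)" using mv_unitv[OF A ij] mv_unitv[OF B ij] by simp
  qed (use A B in auto)
qed

end

context
  fixes X Y :: "'k::{finite,field} arep"
  assumes X: "arep X" and Y: "arep Y"
begin

lemma Jm_inverse: "Jm (- c) X Y * Jm c X Y = 1\<^sub>m (ddim X * ddim Y)"
proof (rule aff.mat_eqI_tens_flux[OF X Y])
  show "Jm (- c) X Y * Jm c X Y \<in> carrier_mat (ddim X * ddim Y) (ddim X * ddim Y)"
    by (rule mult_carrier_mat[OF Jm_carrier Jm_carrier])
  fix h k :: "'k \<times> 'k" and v w
  assume h: "h \<in> gcar Aff" and v: "v \<in> Fl X h" and w: "w \<in> Fl Y k"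
  obtain b \<beta> where e: "h = (b, \<beta>)" by fastforce
  have nz: "\<beta> \<noteq> 0" and v: "v \<in> Fl X (b, \<beta>)" using h v by (auto simp: e)
  show "mv (Jm (- c) X Y * Jm c X Y) (tens (ddim Y) v w) = mv (1\<^sub>m (ddim X * ddim Y)) (tens (ddim Y) v w)"
    using aff.flux_vspace[OF v] aff.flux_vspace[OF w]
    by (simp add: mv_mult[OF Jm_carrier Jm_carrier] mv_Jm[OF X Y v nz] U_U[OF Y] Y)
qed simp

end

lemma act_one_Fob_flux:
  assumes "arep X" "v \<in> Fl X (y, \<eta>)" "\<eta> \<noteq> 0" "\<beta> \<noteq> 0"
  shows "act (Fob X) (0, 1) (b, \<beta>) v =
    (if \<beta> * \<eta> = 1 then favg (\<lambda>x. sc (\<psi> (- (x * b))) (U X x 1 v)) else 0)"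
  using act_Fob_flux[OF assms(1-3) _ assms(4), of 1 0 b] by simp

text \<open>Each new projection is an average over translations of its factor. The sum over all
  splittings b1 of the flux couples the two translations to \<eta>1 x and x.\<close>

lemma act_dtensor_Fob:
  fixes X Y :: "'k::{finite,field} arep"
  assumes X: "arep X" and Y: "arep Y"
    and v: "v \<in> Fl X (y1, \<eta>1)" and w: "w \<in> Fl Y (y2, \<eta>2)"
    and nz: "\<eta>1 \<noteq> 0" "\<eta>2 \<noteq> 0" "\<beta> \<noteq> 0"
  shows "act (dtensor Aff (Fob X) (Fob Y)) (0, 1) (b, \<beta>) (tens (ddim Y) v w) =
    (if \<beta> * (\<eta>1 * \<eta>2) = 1 then favg (\<lambda>x. sc (\<psi> (- (\<eta>1 * x * b)))
       (tens (ddim Y) (U X (\<eta>1 * x) 1 v) (U Y x 1 w))) else 0)"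
proof -
  let ?t = "tens (ddim Y)"
  have "act (dtensor Aff (Fob X) (Fob Y)) (0, 1) (b, \<beta>) (?t v w) =
    (\<Sum>b1\<in>UNIV. \<Sum>\<beta>1\<in>-{0}. ?t (act (Fob X) (0, 1) (b1, \<beta>1) v)
       (act (Fob Y) (0, 1) (- b1 / \<beta>1 + inverse \<beta>1 * b, inverse \<beta>1 * \<beta>) w))"
    using aff.act_dtensor[OF is_drep_Fob[OF X] is_drep_Fob[OF Y], of "(0, 1)" "(b, \<beta>)" v w] nz
    by (simp add: sum_affine)
  also have "\<dots> = (\<Sum>b1\<in>UNIV. \<Sum>\<beta>1\<in>-{0}. if \<beta>1 = 1 / \<eta>1 then
      (if \<beta> * (\<eta>1 * \<eta>2) = 1 then ?t (favg (\<lambda>x1. sc (\<psi> (- (x1 * b1))) (U X x1 1 v)))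
        (favg (\<lambda>x2. sc (\<psi> (- (x2 * ((b - b1) * \<eta>1)))) (U Y x2 1 w))) else 0) else 0)"
  proof (intro sum.cong refl)
    fix b1 \<beta>1 :: 'k assume "\<beta>1 \<in> - {0}"
    then have b1: "\<beta>1 \<noteq> 0" by simp
    show "?t (act (Fob X) (0, 1) (b1, \<beta>1) v)
       (act (Fob Y) (0, 1) (- b1 / \<beta>1 + inverse \<beta>1 * b, inverse \<beta>1 * \<beta>) w) =
      (if \<beta>1 = 1 / \<eta>1 then
      (if \<beta> * (\<eta>1 * \<eta>2) = 1 then ?t (favg (\<lambda>x1. sc (\<psi> (- (x1 * b1))) (U X x1 1 v)))
        (favg (\<lambda>x2. sc (\<psi> (- (x2 * ((b - b1) * \<eta>1)))) (U Y x2 1 w))) else 0) else 0)"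
    proof (cases "\<beta>1 = 1 / \<eta>1")
      case True
      have "- b1 / \<beta>1 + inverse \<beta>1 * b = (b - b1) * \<eta>1" "inverse \<beta>1 * \<beta> = \<eta>1 * \<beta>"
        using nz by (simp_all add: True field_simps)
      moreover have "\<beta>1 * \<eta>1 = 1" using True nz by simp
      moreover have "\<eta>1 * \<beta> * \<eta>2 = 1 \<longleftrightarrow> \<beta> * (\<eta>1 * \<eta>2) = 1" by (simp add: ac_simps)
      ultimately show ?thesis
        using nz b1 by (simp add: act_one_Fob_flux[OF X v] act_one_Fob_flux[OF Y w] True[symmetric])
    next
      case False
      then have "\<beta>1 * \<eta>1 \<noteq> 1" using nz by (simp add: field_simps)
      then show ?thesis using False nz b1 by (simp add: act_one_Fob_flux[OF X v])
    qed
  qed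
  also have "\<dots> = (if \<beta> * (\<eta>1 * \<eta>2) = 1 then (\<Sum>b1\<in>UNIV. favg (\<lambda>x2. favg (\<lambda>x1.
      sc (\<psi> (b1 * (\<eta>1 * x2 - x1))) (sc (\<psi> (- (\<eta>1 * x2 * b))) (?t (U X x1 1 v) (U Y x2 1 w)))))) else 0)"
  proof -
    have "?t (favg (\<lambda>x1. sc (\<psi> (- (x1 * b1))) (U X x1 1 v)))
        (favg (\<lambda>x2. sc (\<psi> (- (x2 * ((b - b1) * \<eta>1)))) (U Y x2 1 w))) =
      favg (\<lambda>x2. favg (\<lambda>x1.
      sc (\<psi> (b1 * (\<eta>1 * x2 - x1))) (sc (\<psi> (- (\<eta>1 * x2 * b))) (?t (U X x1 1 v) (U Y x2 1 w)))))" for b1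
      unfolding tens_favg(2) unfolding tens_favg(1)
    proof (intro favg_cong)
      fix x2 x1
      have "- (x1 * b1) + - (x2 * ((b - b1) * \<eta>1)) = b1 * (\<eta>1 * x2 - x1) + - (\<eta>1 * x2 * b)"
        by (simp add: algebra_simps)
      then show "?t (sc (\<psi> (- (x1 * b1))) (U X x1 1 v)) (sc (\<psi> (- (x2 * ((b - b1) * \<eta>1)))) (U Y x2 1 w)) =
        sc (\<psi> (b1 * (\<eta>1 * x2 - x1))) (sc (\<psi> (- (\<eta>1 * x2 * b))) (?t (U X x1 1 v) (U Y x2 1 w)))"
        by (simp only: tens_sc sc_sc \<psi>_add[symmetric] add.commute)
    qed
    then show ?thesis using nz by (simp add: sum.delta)
  qed
  also have "\<dots> = (if \<beta> * (\<eta>1 * \<eta>2) = 1 then favg (\<lambda>x. sc (\<psi> (- (\<eta>1 * x * b)))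
       (?t (U X (\<eta>1 * x) 1 v) (U Y x 1 w))) else 0)"
    by (intro if_cong refl trans[OF favg_sum[symmetric] favg_cong] fourier_inversion) auto
  finally show ?thesis .
qed

text \<open>A new projection translates the two factors by \<eta>1 x and x in the source, but by
  equal amounts in the target. The correction by - y1 / \<eta>1 repairs this, as y1 itself moves by
  (1 - \<eta>1) \<eta>1 x. It also makes the flux of the product (\<eta>2 y1 + \<eta>1 y2, \<eta>1
  \<eta>2), for which y / \<eta> is additive, as the phases of the new action require.\<close>

lemma Jm_hom:
  fixes X Y :: "'k::{finite,field} arep"
  assumes X: "arep X" and Y: "arep Y"
  shows "Jt X Y \<in> dhom Aff (dtensor Aff (Fob X) (Fob Y)) (Fob (dtensor Aff X Y))"
proof -
  let ?Z = "dtensor Aff (Fob X) (Fob Y)" and ?W = "Fob (dtensor Aff X Y)"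
  let ?t = "tens (ddim Y)" and ?J = "Jt X Y" and ?d = "ddim X * ddim Y"
  note FX = is_drep_Fob[OF X] and FY = is_drep_Fob[OF Y]
  have Z: "arep ?Z" by (rule aff.is_drep_dtensor[OF FX FY])
  have XY: "arep (dtensor Aff X Y)" by (rule aff.is_drep_dtensor[OF X Y])
  have W: "arep ?W" by (rule is_drep_Fob[OF XY])
  note J = mv_Jm[OF X Y, where c="- 1"]
  have cZ: "dact ?Z (0, 1) h \<in> carrier_mat ?d ?d" "dact ?W (0, 1) h \<in> carrier_mat ?d ?d"
    if "h \<in> gcar Aff" for h
    using aff.dact_carrier[OF Z _ that, of "(0, 1)"] aff.dact_carrier[OF W _ that, of "(0, 1)"] by simp_all
  have gZ: "aff.gmat ?Z g \<in> carrier_mat ?d ?d" "aff.gmat ?W g \<in> carrier_mat ?d ?d" for g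
    using aff.gmat_carrier[of ?Z g] aff.gmat_carrier[of ?W g] by simp_all
  have w0: "U Y (- 1 * y1 / \<eta>1) 1 w \<in> Fl Y (y2 - (1 - \<eta>2) * y1 / \<eta>1, \<eta>2)"
    if "w \<in> Fl Y (y2, \<eta>2)" "\<eta>2 \<noteq> 0" for y1 \<eta>1 y2 \<eta>2 w
    by (rule U_flux[OF Y that(1)]) (use that in \<open>auto simp: field_simps\<close>)
  have fl: "?t v (U Y (- 1 * y1 / \<eta>1) 1 w) \<in> Fl (dtensor Aff X Y) (\<eta>2 * y1 + \<eta>1 * y2, \<eta>1 * \<eta>2)"
    if "v \<in> Fl X (y1, \<eta>1)" "w \<in> Fl Y (y2, \<eta>2)" "\<eta>1 \<noteq> 0" "\<eta>2 \<noteq> 0" for v w y1 \<eta>1 y2 \<eta>2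
  proof -
    have "gmul Aff (y1, \<eta>1) (y2 - (1 - \<eta>2) * y1 / \<eta>1, \<eta>2) = (\<eta>2 * y1 + \<eta>1 * y2, \<eta>1 * \<eta>2)"
      using that by (simp add: field_simps)
    moreover have "?t v (U Y (- 1 * y1 / \<eta>1) 1 w) \<in>
        Fl (dtensor Aff X Y) (gmul Aff (y1, \<eta>1) (y2 - (1 - \<eta>2) * y1 / \<eta>1, \<eta>2))"
      by (rule aff.tens_flux[OF X Y that(1) w0]) (use that in auto)
    ultimately show ?thesis by (simp only:)
  qed
  have P: "?J * dact ?Z (0, 1) (b, \<beta>) = dact ?W (0, 1) (b, \<beta>) * ?J" if b: "\<beta> \<noteq> 0" for b \<beta>
  proof (rule aff.mat_eqI_tens_flux[OF X Y])
    have "(b, \<beta>) \<in> gcar Aff" using b by simp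
    note c = cZ[OF this]
    show "?J * dact ?Z (0, 1) (b, \<beta>) \<in> carrier_mat ?d ?d" "dact ?W (0, 1) (b, \<beta>) * ?J \<in> carrier_mat ?d ?d"
      by (rule mult_carrier_mat[OF Jm_carrier c(1)] mult_carrier_mat[OF c(2) Jm_carrier])+
    fix h k :: "'k \<times> 'k" and v w
    assume hk: "h \<in> gcar Aff" "k \<in> gcar Aff" and vw: "v \<in> Fl X h" "w \<in> Fl Y k"
    obtain y1 \<eta>1 y2 \<eta>2 where e: "h = (y1, \<eta>1)" "k = (y2, \<eta>2)" by (metis surj_pair)
    have nz: "\<eta>1 \<noteq> 0" "\<eta>2 \<noteq> 0" and v: "v \<in> Fl X (y1, \<eta>1)" and w: "w \<in> Fl Y (y2, \<eta>2)"
      using hk vw by (auto simp: e)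
    have Uv: "U X (\<eta>1 * x) 1 v \<in> Fl X (y1 + (1 - \<eta>1) * (\<eta>1 * x), \<eta>1)" for x
      by (rule U_flux[OF X v _ nz(1)]) auto
    let ?w = "U Y (- 1 * y1 / \<eta>1) 1 w"
    have "mv (?J * dact ?Z (0, 1) (b, \<beta>)) (?t v w) = (if \<beta> * (\<eta>1 * \<eta>2) = 1 then
      favg (\<lambda>x. sc (\<psi> (- (\<eta>1 * x * b))) (?t (U X (\<eta>1 * x) 1 v)
        (U Y (- 1 * (y1 + (1 - \<eta>1) * (\<eta>1 * x)) / \<eta>1) 1 (U Y x 1 w)))) else 0)"
      unfolding mv_mult[OF Jm_carrier c(1)] act_dtensor_Fob[OF X Y v w nz b]
      by (simp add: mv_favg mv_sc J[OF Uv nz(1)])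
    also have "\<dots> = (if \<beta> * (\<eta>1 * \<eta>2) = 1 then
      favg (\<lambda>x. (\<lambda>x. sc (\<psi> (- (x * b))) (U (dtensor Aff X Y) x 1 (?t v ?w))) (\<eta>1 * x + 0)) else 0)"
    proof (intro if_cong refl favg_cong)
      fix x
      have "- 1 * (y1 + (1 - \<eta>1) * (\<eta>1 * x)) / \<eta>1 + x = \<eta>1 * x + - 1 * y1 / \<eta>1"
        using nz by (simp add: field_simps)
      then have "U Y (- 1 * (y1 + (1 - \<eta>1) * (\<eta>1 * x)) / \<eta>1) 1 (U Y x 1 w) = U Y (\<eta>1 * x) 1 ?w"
        by (simp add: U_U[OF Y])
      then show "sc (\<psi> (- (\<eta>1 * x * b))) (?t (U X (\<eta>1 * x) 1 v)
          (U Y (- 1 * (y1 + (1 - \<eta>1) * (\<eta>1 * x)) / \<eta>1) 1 (U Y x 1 w))) =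
        (\<lambda>x. sc (\<psi> (- (x * b))) (U (dtensor Aff X Y) x 1 (?t v ?w))) (\<eta>1 * x + 0)"
        using aff.gact_dtensor[OF X Y aff.flux_vspace[OF v], of ?w "(\<eta>1 * x, 1)"] Y by simp
    qed
    also have "\<dots> = (if \<beta> * (\<eta>1 * \<eta>2) = 1 then
      favg (\<lambda>x. sc (\<psi> (- (x * b))) (U (dtensor Aff X Y) x 1 (?t v ?w))) else 0)"
      by (intro if_cong refl favg_reindex bij_mult_add nz)
    also have "\<dots> = mv (dact ?W (0, 1) (b, \<beta>) * ?J) (?t v w)"
      unfolding mv_mult[OF c(2) Jm_carrier] J[OF v nz(1)]
      using act_one_Fob_flux[OF XY fl[OF v w nz] _ b, of b] nz by simp
    finally show "mv (?J * dact ?Z (0, 1) (b, \<beta>)) (?t v w) = mv (dact ?W (0, 1) (b, \<beta>) * ?J) (?t v w)" .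
  qed
  have Q: "?J * aff.gmat ?Z (a, \<alpha>) = aff.gmat ?W (a, \<alpha>) * ?J" if a: "\<alpha> \<noteq> 0" for a \<alpha>
  proof (rule aff.mat_eqI_tens_flux[OF X Y])
    note c = gZ[of "(a, \<alpha>)"]
    show "?J * aff.gmat ?Z (a, \<alpha>) \<in> carrier_mat ?d ?d" "aff.gmat ?W (a, \<alpha>) * ?J \<in> carrier_mat ?d ?d"
      by (rule mult_carrier_mat[OF Jm_carrier c(1)] mult_carrier_mat[OF c(2) Jm_carrier])+
    fix h k :: "'k \<times> 'k" and v w
    assume hk: "h \<in> gcar Aff" "k \<in> gcar Aff" and vw: "v \<in> Fl X h" "w \<in> Fl Y k"
    obtain y1 \<eta>1 y2 \<eta>2 where e: "h = (y1, \<eta>1)" "k = (y2, \<eta>2)" by (metis surj_pair)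
    have nz: "\<eta>1 \<noteq> 0" "\<eta>2 \<noteq> 0" and v: "v \<in> Fl X (y1, \<eta>1)" and w: "w \<in> Fl Y (y2, \<eta>2)"
      using hk vw by (auto simp: e)
    have Uv: "U X 0 (1 / \<alpha>) v \<in> Fl X (y1 / \<alpha>, \<eta>1)"
      by (rule U_flux[OF X v _ nz(1)]) (use a in auto)
    let ?w = "U Y (- 1 * y1 / \<eta>1) 1 w"
    have E: "a * y1 / (\<eta>1 * \<alpha>) + a * y2 / (\<eta>2 * \<alpha>) = a * (\<eta>2 * y1 + \<eta>1 * y2) / (\<eta>1 * \<eta>2 * \<alpha>)"
      using nz a by (simp add: field_simps)
    have "aff.gact ?Z (a, \<alpha>) (?t v w) = ?t (U (Fob X) a \<alpha> v) (U (Fob Y) a \<alpha> w)"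
      using aff.gact_dtensor[OF FX FY, of v w "(a, \<alpha>)"] aff.flux_vspace[OF v] aff.flux_vspace[OF w] a by simp
    also have "\<dots> = sc (\<psi> (a * (\<eta>2 * y1 + \<eta>1 * y2) / (\<eta>1 * \<eta>2 * \<alpha>))) (?t (U X 0 (1 / \<alpha>) v) (U Y 0 (1 / \<alpha>) w))"
      unfolding gact_Fob_flux[OF X v nz(1) a] gact_Fob_flux[OF Y w nz(2) a] tens_sc sc_sc E[symmetric]
      by (simp add: \<psi>_add mult.commute)
    finally have "mv (?J * aff.gmat ?Z (a, \<alpha>)) (?t v w) = sc (\<psi> (a * (\<eta>2 * y1 + \<eta>1 * y2) / (\<eta>1 * \<eta>2 * \<alpha>)))
       (?t (U X 0 (1 / \<alpha>) v) (U Y (- 1 * (y1 / \<alpha>) / \<eta>1) 1 (U Y 0 (1 / \<alpha>) w)))"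
      unfolding mv_mult[OF Jm_carrier c(1)] using a by (simp add: aff.mv_gmat[OF Z] mv_sc J[OF Uv nz(1)])
    also have "U Y (- 1 * (y1 / \<alpha>) / \<eta>1) 1 (U Y 0 (1 / \<alpha>) w) = U Y 0 (1 / \<alpha>) ?w"
      using a nz by (simp add: U_U[OF Y] field_simps)
    also have "?t (U X 0 (1 / \<alpha>) v) (U Y 0 (1 / \<alpha>) ?w) = U (dtensor Aff X Y) 0 (1 / \<alpha>) (?t v ?w)"
      using aff.gact_dtensor[OF X Y aff.flux_vspace[OF v], of ?w "(0, 1 / \<alpha>)"] Y a by simp
    also have "sc (\<psi> (a * (\<eta>2 * y1 + \<eta>1 * y2) / (\<eta>1 * \<eta>2 * \<alpha>))) \<dots> = aff.gact ?W (a, \<alpha>) (?t v ?w)"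
      using gact_Fob_flux[OF XY fl[OF v w nz] _ a, of a] nz by simp
    also have "\<dots> = mv (aff.gmat ?W (a, \<alpha>) * ?J) (?t v w)"
      unfolding mv_mult[OF c(2) Jm_carrier] J[OF v nz(1)] using a by (simp add: aff.mv_gmat[OF W])
    finally show "mv (?J * aff.gmat ?Z (a, \<alpha>)) (?t v w) = mv (aff.gmat ?W (a, \<alpha>) * ?J) (?t v w)" .
  qed
  show ?thesis
  proof (rule aff.dhomI[OF Z W])
    show "?J \<in> carrier_mat (ddim ?W) (ddim ?Z)" by simp
    fix h :: "'k \<times> 'k" and v assume h: "h \<in> gcar Aff"
    obtain b \<beta> where e: "h = (b, \<beta>)" by fastforce
    show "mv ?J (act ?Z (gone Aff) h v) = act ?W (gone Aff) h (mv ?J v)"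
      using P[of \<beta> b] h mv_mult[OF Jm_carrier cZ(1)[OF h], of "- 1" v] mv_mult[OF cZ(2)[OF h] Jm_carrier, of "- 1" v]
      by (simp add: e)
  next
    fix g :: "'k \<times> 'k" and v assume g: "g \<in> gcar Aff"
    obtain a \<alpha> where e: "g = (a, \<alpha>)" by fastforce
    show "mv ?J (aff.gact ?Z g v) = aff.gact ?W g (mv ?J v)"
      using Q[of \<alpha> a] g mv_mult[OF Jm_carrier gZ(1), of "- 1" g v] mv_mult[OF gZ(2) Jm_carrier, of g "- 1" v]
      by (simp add: e aff.mv_gmat[OF Z] aff.mv_gmat[OF W])
  qed
qed

lemma Jm_iso:
  fixes X Y :: "'k::{finite,field} arep"
  assumes X: "arep X" and Y: "arep Y"
  shows "is_iso_mor Aff (dtensor Aff (Fob X) (Fob Y)) (Fob (dtensor Aff X Y)) (Jt X Y)"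
proof (rule aff.is_iso_morI[OF Jm_hom[OF X Y]])
  show "arep (dtensor Aff (Fob X) (Fob Y))"
    "arep (Fob (dtensor Aff X Y))"
    by (rule aff.is_drep_dtensor is_drep_Fob X Y)+
  show "Jm 1 X Y \<in> carrier_mat (ddim (dtensor Aff (Fob X) (Fob Y))) (ddim (Fob (dtensor Aff X Y)))"
    by simp
qed (use Jm_inverse[OF X Y, of "- 1"] Jm_inverse[OF X Y, of 1] in simp_all)

text \<open>Intertwiners preserve the flux of the left factor and commute with the translations of
  the right one.\<close>

lemma Jm_natural:
  fixes X Y :: "'k::{finite,field} arep"
  assumes X: "arep X" "arep X'" and Y: "arep Y" "arep Y'"
    and T: "T \<in> dhom Aff X X'" and S: "S \<in> dhom Aff Y Y'"
  shows "Jm c X' Y' * kron T S = kron T S * Jm c X Y"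
proof (rule aff.mat_eqI_tens_flux[OF X(1) Y(1)])
  have Tc: "T \<in> carrier_mat (ddim X') (ddim X)" and Sc: "S \<in> carrier_mat (ddim Y') (ddim Y)"
    using T S by (auto simp: dhom_def)
  note k = kron_carrier[OF Tc Sc]
  show "Jm c X' Y' * kron T S \<in> carrier_mat (ddim X' * ddim Y') (ddim X * ddim Y)"
    "kron T S * Jm c X Y \<in> carrier_mat (ddim X' * ddim Y') (ddim X * ddim Y)"
    by (rule mult_carrier_mat[OF Jm_carrier k] mult_carrier_mat[OF k Jm_carrier])+
  fix h k' :: "'k \<times> 'k" and v w
  assume h: "h \<in> gcar Aff" and v: "v \<in> Fl X h"
  obtain b \<beta> where e: "h = (b, \<beta>)" by fastforce
  have nz: "\<beta> \<noteq> 0" and v: "v \<in> Fl X (b, \<beta>)" using h v by (auto simp: e)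
  have Tv: "mv T v \<in> Fl X' (b, \<beta>)" using aff.dhom_flux[OF X T _ v] nz by simp
  show "mv (Jm c X' Y' * kron T S) (tens (ddim Y) v w) = mv (kron T S * Jm c X Y) (tens (ddim Y) v w)"
    by (simp add: mv_mult[OF Jm_carrier k] mv_mult[OF k Jm_carrier] mv_kron_tens[OF Tc Sc]
        mv_Jm[OF X(1) Y(1) v nz] mv_Jm[OF X(2) Y(2) Tv nz] aff.dhom_gact[OF Y S])
qed

text \<open>The quotient b / \<beta> is additive for the corrected product of fluxes. Either way u,
  v, w become u, U(- b1 / \<beta>1) v and U(- b1 / \<beta>1 - b2 / \<beta>2) w.\<close>

lemma Jm_assoc:
  fixes X Y Z :: "'k::{finite,field} arep"
  assumes X: "arep X" and Y: "arep Y" and Z: "arep Z"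
  shows "Jt (dtensor Aff X Y) Z * kron (Jt X Y) (1\<^sub>m (ddim Z)) =
    Jt X (dtensor Aff Y Z) * kron (1\<^sub>m (ddim X)) (Jt Y Z)"
proof (rule aff.mat_eqI_tens3_flux[OF X Y Z])
  let ?m = "ddim X" and ?n = "ddim Y" and ?p = "ddim Z"
  let ?XY = "dtensor Aff X Y" and ?YZ = "dtensor Aff Y Z"
  have XY: "arep ?XY" and YZ: "arep ?YZ"
    by (rule aff.is_drep_dtensor X Y Z)+
  have c1: "Jt ?XY Z \<in> carrier_mat (?m * ?n * ?p) (?m * ?n * ?p)"
    using Jm_carrier[of "- 1" ?XY Z] by simp
  have c2: "Jt X ?YZ \<in> carrier_mat (?m * (?n * ?p)) (?m * (?n * ?p))"
    using Jm_carrier[of "- 1" X ?YZ] by simp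
  have k1: "kron (Jt X Y) (1\<^sub>m ?p) \<in> carrier_mat (?m * ?n * ?p) (?m * ?n * ?p)"
    by (rule kron_carrier) auto
  have k2: "kron (1\<^sub>m ?m) (Jt Y Z) \<in> carrier_mat (?m * (?n * ?p)) (?m * (?n * ?p))"
    by (rule kron_carrier) auto
  show "Jt ?XY Z * kron (Jt X Y) (1\<^sub>m ?p) \<in> carrier_mat (?m * ?n * ?p) (?m * ?n * ?p)"
    by (rule mult_carrier_mat[OF c1 k1])
  show "Jt X ?YZ * kron (1\<^sub>m ?m) (Jt Y Z) \<in> carrier_mat (?m * ?n * ?p) (?m * ?n * ?p)"
    using mult_carrier_mat[OF c2 k2] by (simp add: mult.assoc)
  fix h k m :: "'k \<times> 'k" and u v w
  assume hk: "h \<in> gcar Aff" "k \<in> gcar Aff"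
    and uv: "u \<in> Fl X h" "v \<in> Fl Y k" and w: "w \<in> Fl Z m"
  obtain b1 \<beta>1 b2 \<beta>2 where e: "h = (b1, \<beta>1)" "k = (b2, \<beta>2)" by (metis surj_pair)
  have nz: "\<beta>1 \<noteq> 0" "\<beta>2 \<noteq> 0" and u: "u \<in> Fl X (b1, \<beta>1)" and v: "v \<in> Fl Y (b2, \<beta>2)"
    using hk uv by (auto simp: e)
  let ?v = "U Y (- 1 * b1 / \<beta>1) 1 v"
  have v': "?v \<in> Fl Y (b2 - (1 - \<beta>2) * b1 / \<beta>1, \<beta>2)"
    by (rule U_flux[OF Y v _ nz(2)]) (use nz in \<open>auto simp: field_simps\<close>)
  have "gmul Aff (b1, \<beta>1) (b2 - (1 - \<beta>2) * b1 / \<beta>1, \<beta>2) = (\<beta>2 * b1 + \<beta>1 * b2, \<beta>1 * \<beta>2)"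
    using nz by (simp add: field_simps)
  moreover have "tens ?n u ?v \<in> Fl ?XY (gmul Aff (b1, \<beta>1) (b2 - (1 - \<beta>2) * b1 / \<beta>1, \<beta>2))"
    by (rule aff.tens_flux[OF X Y u v']) (use nz in auto)
  ultimately have uv': "tens ?n u ?v \<in> Fl ?XY (\<beta>2 * b1 + \<beta>1 * b2, \<beta>1 * \<beta>2)"
    by (simp only:)
  have nn: "\<beta>1 * \<beta>2 \<noteq> 0" using nz by simp
  note un = aff.flux_vspace[OF u] and vn = aff.flux_vspace[OF v] and wn = aff.flux_vspace[OF w]
  have "mv (Jt ?XY Z * kron (Jt X Y) (1\<^sub>m ?p)) (tens ?p (tens ?n u v) w) =
      mv (Jt ?XY Z) (tens ?p (tens ?n u ?v) w)"
    unfolding mv_mult[OF c1 k1] mv_kron_tens[OF Jm_carrier one_carrier_mat] mv_Jm[OF X Y u nz(1)]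
    using wn by simp
  also have "\<dots> = tens ?p (tens ?n u ?v) (U Z (- 1 * (\<beta>2 * b1 + \<beta>1 * b2) / (\<beta>1 * \<beta>2)) 1 w)"
    by (rule mv_Jm[OF XY Z uv' nn])
  also have "\<dots> = tens (?n * ?p) u (tens ?p ?v (U Z (- 1 * b1 / \<beta>1) 1 (U Z (- 1 * b2 / \<beta>2) 1 w)))"
  proof -
    have "- 1 * (\<beta>2 * b1 + \<beta>1 * b2) / (\<beta>1 * \<beta>2) = - 1 * b1 / \<beta>1 + 1 * (- 1 * b2 / \<beta>2)"
      using nz by (simp add: field_simps)
    then show ?thesis unfolding tens_assoc by (simp only: U_U[OF Z one_neq_zero one_neq_zero] mult_1)
  qed
  also have "\<dots> = tens (?n * ?p) u (U ?YZ (- 1 * b1 / \<beta>1) 1 (tens ?p v (U Z (- 1 * b2 / \<beta>2) 1 w)))"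
    using aff.gact_dtensor[OF Y Z vn, of "U Z (- 1 * b2 / \<beta>2) 1 w" "(- 1 * b1 / \<beta>1, 1)"] Z by simp
  also have "\<dots> = mv (Jt X ?YZ) (tens (?n * ?p) u (tens ?p v (U Z (- 1 * b2 / \<beta>2) 1 w)))"
    using mv_Jm[OF X YZ u nz(1), of "- 1" "tens ?p v (U Z (- 1 * b2 / \<beta>2) 1 w)"] by simp
  also have "\<dots> = mv (Jt X ?YZ * kron (1\<^sub>m ?m) (Jt Y Z)) (tens ?p (tens ?n u v) w)"
    unfolding mv_mult[OF c2 k2] tens_assoc[symmetric] mv_kron_tens[OF one_carrier_mat Jm_carrier]
      mv_Jm[OF Y Z v nz(2)] using un by simp
  finally show "mv (Jt ?XY Z * kron (Jt X Y) (1\<^sub>m ?p)) (tens ?p (tens ?n u v) w) =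
    mv (Jt X ?YZ * kron (1\<^sub>m ?m) (Jt Y Z)) (tens ?p (tens ?n u v) w)" .
qed

text \<open>Left: U(b1, \<beta>1) U(- b1 / \<beta>1, 1) = U(0, \<beta>1), so only the H-part of the
  flux of \<open>v\<close> acts on \<open>w\<close>. Right: the sum over new fluxes collapses to a
  translation of \<open>v\<close> by b2 \<beta>1 / \<beta>2, and the tensor structure cancels it,
  since U(0, \<beta>1) w has flux (b2 \<beta>1, \<beta>2).\<close>

lemma Jm_braided:
  fixes X Y :: "'k::{finite,field} arep"
  assumes X: "arep X" and Y: "arep Y"
  shows "dbraid Aff X Y * Jt X Y = Jt Y X * dbraid Aff (Fob X) (Fob Y)"
proof (rule aff.mat_eqI_tens_flux[OF X Y])
  let ?m = "ddim X" and ?n = "ddim Y"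
  note FX = is_drep_Fob[OF X] and FY = is_drep_Fob[OF Y]
  have c: "dbraid Aff X Y \<in> carrier_mat (?n * ?m) (?m * ?n)"
    "dbraid Aff (Fob X) (Fob Y) \<in> carrier_mat (?n * ?m) (?m * ?n)"
    using aff.dbraid_carrier[OF X Y] aff.dbraid_carrier[OF FX FY] by simp_all
  show "dbraid Aff X Y * Jt X Y \<in> carrier_mat (?n * ?m) (?m * ?n)"
    "Jt Y X * dbraid Aff (Fob X) (Fob Y) \<in> carrier_mat (?n * ?m) (?m * ?n)"
    by (rule mult_carrier_mat[OF c(1) Jm_carrier] mult_carrier_mat[OF Jm_carrier c(2)])+
  fix h k :: "'k \<times> 'k" and v w
  assume hk: "h \<in> gcar Aff" "k \<in> gcar Aff" and vw: "v \<in> Fl X h" "w \<in> Fl Y k"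
  obtain b1 \<beta>1 b2 \<beta>2 where e: "h = (b1, \<beta>1)" "k = (b2, \<beta>2)" by (metis surj_pair)
  have nz: "\<beta>1 \<noteq> 0" "\<beta>2 \<noteq> 0" and v: "v \<in> Fl X (b1, \<beta>1)" and w: "w \<in> Fl Y (b2, \<beta>2)"
    using hk vw by (auto simp: e)
  note vn = aff.flux_vspace[OF v] and wn = aff.flux_vspace[OF w]
  have "mv (dbraid Aff X Y * Jt X Y) (tens ?n v w) = tens ?m (U Y b1 \<beta>1 (U Y (- 1 * b1 / \<beta>1) 1 w)) v"
    unfolding mv_mult[OF c(1) Jm_carrier] mv_Jm[OF X Y v nz(1)]
    by (rule aff.dbraid_tens_flux[OF X Y v]) (use nz Y in auto)
  also have "\<dots> = tens ?m (U Y 0 \<beta>1 w) v"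
    using nz by (simp add: U_U[OF Y])
  finally have L: "mv (dbraid Aff X Y * Jt X Y) (tens ?n v w) = tens ?m (U Y 0 \<beta>1 w) v" .
  have "mv (dbraid Aff (Fob X) (Fob Y)) (tens ?n v w) =
    (\<Sum>b\<in>UNIV. \<Sum>\<beta>\<in>-{0}. tens ?m (U (Fob Y) b \<beta> w) (act (Fob X) (0, 1) (b, \<beta>) v))"
    using aff.dbraid_tens[OF FX FY, of v w] vn wn by (simp add: sum_affine)
  also have "\<dots> = (\<Sum>b\<in>UNIV. \<Sum>\<beta>\<in>-{0}. if \<beta> = 1 / \<beta>1 then favg (\<lambda>x. sc (\<psi> (b * (b2 * \<beta>1 / \<beta>2 - x)))
      (tens ?m (U Y 0 \<beta>1 w) (U X x 1 v))) else 0)"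
  proof (intro sum.cong refl)
    fix b \<beta> :: 'k assume "\<beta> \<in> - {0}"
    then have nb: "\<beta> \<noteq> 0" by simp
    show "tens ?m (U (Fob Y) b \<beta> w) (act (Fob X) (0, 1) (b, \<beta>) v) = (if \<beta> = 1 / \<beta>1 then
        favg (\<lambda>x. sc (\<psi> (b * (b2 * \<beta>1 / \<beta>2 - x))) (tens ?m (U Y 0 \<beta>1 w) (U X x 1 v))) else 0)"
    proof (cases "\<beta> = 1 / \<beta>1")
      case True
      have E: "b * b2 / (\<beta>2 * \<beta>) + - (x * b) = b * (b2 * \<beta>1 / \<beta>2 - x)" for x
        using nz by (simp add: True field_simps)
      have "tens ?m (U (Fob Y) b \<beta> w) (act (Fob X) (0, 1) (b, \<beta>) v) =
          sc (\<psi> (b * b2 / (\<beta>2 * \<beta>))) (tens ?m (U Y 0 \<beta>1 w) (favg (\<lambda>x. sc (\<psi> (- (x * b))) (U X x 1 v))))"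
      proof -
        have "\<beta> * \<beta>1 = 1" "1 / \<beta> = \<beta>1" using True nz by simp_all
        then show ?thesis
          unfolding gact_Fob_flux[OF Y w nz(2) nb] act_one_Fob_flux[OF X v nz(1) nb] by simp
      qed
      also have "\<dots> = favg (\<lambda>x. sc (\<psi> (b * b2 / (\<beta>2 * \<beta>) + - (x * b))) (tens ?m (U Y 0 \<beta>1 w) (U X x 1 v)))"
        by (simp only: tens_favg tens_sc favg_sc[symmetric] sc_sc \<psi>_add)
      finally show ?thesis unfolding E using True by simp
    next
      case False
      then have "\<beta> * \<beta>1 \<noteq> 1" using nz by (simp add: field_simps)
      then show ?thesis using False by (simp add: act_one_Fob_flux[OF X v nz(1) nb])
    qed
  qed
  also have "\<dots> = (\<Sum>b\<in>UNIV. favg (\<lambda>x. sc (\<psi> (b * (b2 * \<beta>1 / \<beta>2 - x))) (tens ?m (U Y 0 \<beta>1 w) (U X x 1 v))))"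
    using nz by (intro sum.cong refl) (simp add: sum.delta)
  also have "\<dots> = tens ?m (U Y 0 \<beta>1 w) (U X (b2 * \<beta>1 / \<beta>2) 1 v)"
    by (rule fourier_inversion) auto
  finally have R: "mv (dbraid Aff (Fob X) (Fob Y)) (tens ?n v w) = \<dots>" .
  have Uw: "U Y 0 \<beta>1 w \<in> Fl Y (b2 * \<beta>1, \<beta>2)"
    by (rule U_flux[OF Y w nz]) (simp add: mult.commute)
  show "mv (dbraid Aff X Y * Jt X Y) (tens ?n v w) =
      mv (Jt Y X * dbraid Aff (Fob X) (Fob Y)) (tens ?n v w)"
    unfolding L mv_mult[OF Jm_carrier c(2)] R mv_Jm[OF Y X Uw nz(2)] using nz X vn by (simp add: U_U[OF X])
qed

section \<open>The unit object and the assembled autoequivalence\<close>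

lemma gact_dunit: "g \<in> gcar Aff \<Longrightarrow> w \<in> vspace 1 \<Longrightarrow> aff.gact (dunit Aff) g w = w"
  for g :: "'k::{finite,field} \<times> 'k"
  using aff.fin by (simp add: aff.gact_def aff.act_dunit[simplified])

text \<open>The unit has trivial flux on the left and trivial action on the right, so no correction
  arises.\<close>

lemma Jm_dunit:
  fixes X :: "'k::{finite,field} arep"
  assumes X: "arep X"
  shows "Jm c (dunit Aff) X = 1\<^sub>m (ddim X)" "Jm c X (dunit Aff) = 1\<^sub>m (ddim X)"
proof -
  let ?I = "dunit Aff :: 'k arep"
  have I: "arep ?I" by (rule aff.is_drep_dunit)
  have "Jm c ?I X = 1\<^sub>m (ddim ?I * ddim X)"
  proof (rule aff.mat_eqI_tens_flux[OF I X])
    fix h k :: "'k \<times> 'k" and v w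
    assume h: "h \<in> gcar Aff" and v: "v \<in> Fl ?I h" and w: "w \<in> Fl X k"
    obtain b \<beta> where e: "h = (b, \<beta>)" by fastforce
    have nz: "\<beta> \<noteq> 0" and v': "v \<in> Fl ?I (b, \<beta>)" using h v by (auto simp: e)
    have "v = 0 \<or> b = 0" using v aff.act_dunit[of v "(0, 1)" h] by (auto simp: e aff.flux_def split: if_splits)
    then show "mv (Jm c ?I X) (tens (ddim X) v w) = mv (1\<^sub>m (ddim ?I * ddim X)) (tens (ddim X) v w)"
      unfolding mv_Jm[OF I X v' nz] mv_one[OF tens_vspace[OF aff.flux_vspace[OF v] aff.flux_vspace[OF w]]]
      using aff.flux_vspace[OF w] X by auto
  qed (use Jm_carrier in \<open>auto simp del: aff.ddim_simps\<close>)
  then show "Jm c ?I X = 1\<^sub>m (ddim X)" by simp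
  have "Jm c X ?I = 1\<^sub>m (ddim X * ddim ?I)"
  proof (rule aff.mat_eqI_tens_flux[OF X I])
    fix h k :: "'k \<times> 'k" and v w
    assume h: "h \<in> gcar Aff" and v: "v \<in> Fl X h" and w: "w \<in> Fl ?I k"
    obtain b \<beta> where e: "h = (b, \<beta>)" by fastforce
    have nz: "\<beta> \<noteq> 0" and v': "v \<in> Fl X (b, \<beta>)" using h v by (auto simp: e)
    show "mv (Jm c X ?I) (tens (ddim ?I) v w) = mv (1\<^sub>m (ddim X * ddim ?I)) (tens (ddim ?I) v w)"
      unfolding mv_Jm[OF X I v' nz] mv_one[OF tens_vspace[OF aff.flux_vspace[OF v] aff.flux_vspace[OF w]]]
      using aff.flux_vspace[OF w] by (simp add: gact_dunit)
  qed (use Jm_carrier in \<open>auto simp del: aff.ddim_simps\<close>)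
  then show "Jm c X ?I = 1\<^sub>m (ddim X)" by simp
qed

lemma kron_one: "kron (1\<^sub>m m) (1\<^sub>m n) = 1\<^sub>m (m * n)"
  by (rule mat_eqI_tens[of _ "m * n"])
    (auto simp: mv_kron_tens[OF one_carrier_mat one_carrier_mat] kron_carrier[OF one_carrier_mat one_carrier_mat]
      mv_one[OF tens_vspace])

text \<open>Trivial flux and trivial A-character are exchanged with each other, so the unit keeps
  its matrices.\<close>

lemma dunit_iso: "is_iso_mor Aff (dunit Aff) (Fob (dunit Aff)) (1\<^sub>m 1)"
proof -
  let ?I = "dunit Aff :: 'a::{finite,field} arep"
  have I: "arep ?I" by (rule aff.is_drep_dunit)
  have e: "dact (Fob ?I) (a, \<alpha>) (b, \<beta>) = dact ?I (a, \<alpha>) (b, \<beta>)" if nz: "\<alpha> \<noteq> 0" "\<beta> \<noteq> 0" for a \<alpha> b \<beta>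
  proof (rule mat_eqI_mv[where m=1 and n=1])
    show "dact (Fob ?I) (a, \<alpha>) (b, \<beta>) \<in> carrier_mat 1 1" using Fob_carrier[of ?I] by simp
    show "dact ?I (a, \<alpha>) (b, \<beta>) \<in> carrier_mat 1 1" using aff.dact_carrier[OF I, of "(a, \<alpha>)" "(b, \<beta>)"] nz by simp
    fix v :: "nat \<Rightarrow> complex" assume v: "v \<in> vspace 1"
    have fl: "v \<in> Fl ?I (0, 1)" using v aff.act_dunit[of v "(0, 1)" "(0, 1)"] by (simp add: aff.flux_def)
    have "act (Fob ?I) (a, \<alpha>) (b, \<beta>) v = (if \<beta> = 1 then favg (\<lambda>x. sc (\<psi> (x * (- b))) v) else 0)"
      unfolding act_Fob_flux[OF I fl one_neq_zero nz] using v nz by (simp add: gact_dunit)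
    then show "act (Fob ?I) (a, \<alpha>) (b, \<beta>) v = act ?I (a, \<alpha>) (b, \<beta>) v"
      using aff.act_dunit[OF v, of "(a, \<alpha>)" "(b, \<beta>)"] unfolding favg_\<psi> by auto
  qed
  have "1\<^sub>m 1 \<in> dhom Aff ?I (Fob ?I)"
  proof -
    have "dact ?I (a, \<alpha>) (b, \<beta>) \<in> carrier_mat 1 1" if "\<alpha> \<noteq> 0" "\<beta> \<noteq> 0" for a \<alpha> b \<beta>
      using aff.dact_carrier[OF I, of "(a, \<alpha>)" "(b, \<beta>)"] that by simp
    note c = left_mult_one_mat[OF this] right_mult_one_mat[OF this]
    show ?thesis by (auto simp: dhom_def gcar_affine e c simp del: One_nat_def)
  qed
  then show ?thesis
    by (rule aff.is_iso_morI[OF _ I is_drep_Fob[OF I], where S="1\<^sub>m 1"]) auto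
qed

theorem braided_autoequiv_Fob:
  "braided_autoequiv (Aff :: ('k::{finite,field} \<times> 'k) fgrp) Fob (\<lambda>X Y T. T) (Jt) (1\<^sub>m 1)"
proof -
  let ?G = "Aff :: ('k \<times> 'k) fgrp" and ?F = "Fob :: 'k arep \<Rightarrow> _"
  \<comment> \<open>Up to isomorphism, every Y is the image of its own image.\<close>
  have ess: "\<exists>X. is_drep ?G X \<and> diso ?G (?F X) Y" if "is_drep ?G Y" for Y
    using that aff.diso_sym[OF diso_Fob_Fob[OF that]] is_drep_Fob by blast
  have c1: "1\<^sub>m (ddim X * ddim Y * ddim Z) * Jt (dtensor ?G X Y) Z = Jt (dtensor ?G X Y) Z"
    for X Y Z :: "'k arep"
    using Jm_carrier[of "- 1" "dtensor ?G X Y" Z] by simp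
  have bij: "bij_betw (\<lambda>T. T) A A" for A :: "complex mat set"
    by (rule bij_betwI[where g="\<lambda>T. T"]) auto
  note I = dunit_iso[where 'a='k]
  show ?thesis
    unfolding braided_autoequiv_def
    by (intro conjI allI impI; (elim conjE)?;
        (rule ess I | (rule Jm_natural; assumption) |
          simp add: is_drep_Fob dhom_Fob c1 bij Jm_iso Jm_assoc Jm_braided Jm_dunit kron_one del: One_nat_def);
        assumption?)
qed

subsection \<open>The fluxion of the nontrivial translations and its image\<close>

text \<open>The basis |b> is labelled by nonzero field elements while matrices need numbers; any
  enumeration will do.\<close>

definition en :: "nat \<Rightarrow> 'k::{finite,field}" where
  "en = (SOME f. bij_betw f {..<card (- {0 :: 'k})} (- {0}))"

definition idx :: "'k::{finite,field} \<Rightarrow> nat" where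
  "idx = inv_into {..<card (- {0 :: 'k})} en"

lemma bij_en: "bij_betw (en :: nat \<Rightarrow> 'k::{finite,field}) {..<card (- {0 :: 'k})} (- {0})"
proof -
  obtain f where "bij_betw f {0..<card (- {0 :: 'k})} (- {0 :: 'k})"
    using ex_bij_betw_nat_finite[of "- {0 :: 'k}"] by auto
  then have "\<exists>f. bij_betw f {..<card (- {0 :: 'k})} (- {0 :: 'k})" by (auto simp: atLeast0LessThan)
  from someI_ex[OF this] show ?thesis unfolding en_def .
qed

lemma
  fixes b :: "'k::{finite,field}"
  shows en_idx [simp]: "b \<noteq> 0 \<Longrightarrow> en (idx b) = b"
    and idx_less [simp]: "b \<noteq> 0 \<Longrightarrow> idx b < card (- {0 :: 'k})"
    and en_nonzero: "i < card (- {0 :: 'k}) \<Longrightarrow> (en i :: 'k) \<noteq> 0"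
    and idx_en [simp]: "i < card (- {0 :: 'k}) \<Longrightarrow> idx (en i :: 'k) = i"
proof -
  note b = bij_en[where 'k='k]
  show "b \<noteq> 0 \<Longrightarrow> en (idx b) = b"
    unfolding idx_def using bij_betw_inv_into_right[OF b] by simp
  show "b \<noteq> 0 \<Longrightarrow> idx b < card (- {0 :: 'k})"
    unfolding idx_def using bij_betwE[OF bij_betw_inv_into[OF b]] by auto
  show "i < card (- {0 :: 'k}) \<Longrightarrow> (en i :: 'k) \<noteq> 0"
    using bij_betwE[OF b] by auto
  show "i < card (- {0 :: 'k}) \<Longrightarrow> idx (en i :: 'k) = i"
    unfolding idx_def using bij_betw_inv_into_left[OF b] by simp
qed

lemma unitv_apply: "unitv j i = (if i = j then 1 else 0)"
  by (simp add: unitv_def)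

lemma idx_eq_iff: "b \<noteq> 0 \<Longrightarrow> c \<noteq> 0 \<Longrightarrow> idx b = idx c \<longleftrightarrow> b = c"
  by (metis en_idx)

text \<open>The simple object for the conjugacy class of (1, 1), which consists of all (b, 1) with b
  nonzero, and the trivial representation of the centralizer A: (a, \<alpha>) sends |b> to |\<alpha>
  b>.\<close>

definition fluxD :: "'k::{finite,field} arep" where
  "fluxD = (card (- {0 :: 'k}), \<lambda>(a, \<alpha>) (b, \<beta>). mat (card (- {0 :: 'k})) (card (- {0 :: 'k}))
     (\<lambda>(i, j). if \<beta> = 1 \<and> b = en j \<and> en i = \<alpha> * b then 1 else 0))"

lemma ddim_fluxD: "ddim (fluxD :: 'k::{finite,field} arep) = card (- {0 :: 'k})"
  by (simp add: ddim_def fluxD_def)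

lemma act_fluxD:
  fixes a \<alpha> b \<beta> :: "'k::{finite,field}"
  assumes "\<alpha> \<noteq> 0"
  shows "act fluxD (a, \<alpha>) (b, \<beta>) v = (if \<beta> = 1 \<and> b \<noteq> 0 then sc (v (idx b)) (unitv (idx (\<alpha> * b))) else 0)"
proof
  fix i
  let ?n = "card (- {0 :: 'k})"
  have "act fluxD (a, \<alpha>) (b, \<beta>) v i = (if i < ?n then \<Sum>j<?n. if \<beta> = 1 \<and> b = en j \<and> en i = \<alpha> * b then v j else 0 else 0)"
    by (auto simp: mv_def fluxD_def dact_def intro!: sum.cong)
  also have "\<dots> = (if i < ?n then \<Sum>j<?n. if j = idx b then (if \<beta> = 1 \<and> b \<noteq> 0 \<and> i = idx (\<alpha> * b) then v j else 0) else 0 else 0)"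
  proof (cases "i < ?n")
    case i: True
    have "(if \<beta> = 1 \<and> b = en j \<and> en i = \<alpha> * b then v j else 0) =
      (if j = idx b then (if \<beta> = 1 \<and> b \<noteq> 0 \<and> i = idx (\<alpha> * b) then v j else 0) else 0)" if j: "j < ?n" for j
    proof (cases "b = 0")
      case False
      have "b = en j \<longleftrightarrow> j = idx b" "en i = \<alpha> * b \<longleftrightarrow> i = idx (\<alpha> * b)"
        using idx_en[OF i] idx_en[OF j] en_idx[of b] en_idx[of "\<alpha> * b"] assms False
        by (metis, metis mult_eq_0_iff)
      then show ?thesis using False by auto
    qed (use en_nonzero[OF j] in auto)
    then show ?thesis using i by (simp cong: sum.cong_simp)
  qed simp
  also have "\<dots> = (if \<beta> = 1 \<and> b \<noteq> 0 then sc (v (idx b)) (unitv (idx (\<alpha> * b))) else 0) i"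
    using assms by (auto simp: sum.delta sc_apply unitv_def zero_fun_apply)
  finally show "act fluxD (a, \<alpha>) (b, \<beta>) v i = \<dots>" .
qed

lemma fluxD_carrier: "dact (fluxD :: 'k::{finite,field} arep) g h \<in> carrier_mat (ddim (fluxD :: 'k arep)) (ddim (fluxD :: 'k arep))"
  by (simp add: fluxD_def dact_def ddim_def split: prod.split)

lemma is_drep_fluxD: "arep (fluxD :: 'k::{finite,field} arep)"
proof (rule aff.is_drepI[OF fluxD_carrier])
  fix g1 h1 g2 h2 :: "'k \<times> 'k" and v
  assume g: "g1 \<in> gcar Aff" "h1 \<in> gcar Aff" "g2 \<in> gcar Aff" "h2 \<in> gcar Aff"
  obtain a1 \<alpha>1 b1 \<beta>1 a2 \<alpha>2 b2 \<beta>2 where e: "g1 = (a1, \<alpha>1)" "h1 = (b1, \<beta>1)" "g2 = (a2, \<alpha>2)" "h2 = (b2, \<beta>2)"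
    by (metis surj_pair)
  with g have nz: "\<alpha>1 \<noteq> 0" "\<alpha>2 \<noteq> 0" "\<beta>1 \<noteq> 0" "\<beta>2 \<noteq> 0" by auto
  let ?G = "Aff :: ('k \<times> 'k) fgrp"
  have cond: "h2 = gmul ?G (gmul ?G (ginv ?G g2) h1) g2 \<longleftrightarrow> b1 = \<alpha>2 * b2 + (1 - \<beta>2) * a2 \<and> \<beta>1 = \<beta>2"
    using aff.conj_iff[OF g(3,4,2)] nz by (auto simp: e algebra_simps)
  show "act fluxD g1 h1 (act fluxD g2 h2 v) =
      (if h2 = gmul ?G (gmul ?G (ginv ?G g2) h1) g2 then act fluxD (gmul ?G g1 g2) h2 v else 0)"
    unfolding cond using nz
    by (auto simp: e act_fluxD mv_sc sc_apply unitv_apply zero_fun_apply idx_eq_iff mult.assoc)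
next
  fix v assume v: "v \<in> vspace (ddim (fluxD :: 'k arep))"
  have "(\<Sum>h\<in>gcar Aff. act (fluxD :: 'k arep) (0, 1) h v) =
     (\<Sum>b\<in>UNIV. if b \<noteq> 0 then sc (v (idx (b :: 'k))) (unitv (idx b)) else 0)"
    unfolding sum_affine
  proof (rule sum.cong[OF refl])
    fix b :: 'k
    show "(\<Sum>\<beta>\<in>-{0}. act (fluxD :: 'k arep) (0, 1) (b, \<beta>) v) =
        (if b \<noteq> 0 then sc (v (idx b)) (unitv (idx b)) else 0)"
      by (cases "b = 0") (simp_all add: act_fluxD sum.delta)
  qed
  also have "\<dots> = (\<Sum>b\<in>-{0}. sc (v (idx (b :: 'k))) (unitv (idx b)))"
    by (rule sum.mono_neutral_cong_right) auto
  also have "\<dots> = (\<Sum>i<card (- {0 :: 'k}). sc (v i) (unitv i))"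
    by (rule sum.reindex_bij_witness[of _ en idx]) (auto simp: en_nonzero)
  also have "\<dots> = v" using vspace_expand[OF v] by (simp add: ddim_fluxD)
  finally show "(\<Sum>h\<in>gcar Aff. act (fluxD :: 'k arep) (gone Aff) h v) = v" by simp
qed

lemma flux_fluxD: "v \<in> Fl fluxD (b, \<beta>) \<Longrightarrow> v \<noteq> 0 \<Longrightarrow> \<beta> = 1 \<and> b \<noteq> 0"
  by (auto simp: aff.flux_def act_fluxD split: if_splits)

lemma U_fluxD: "v \<in> vspace (ddim (fluxD :: 'k::{finite,field} arep)) \<Longrightarrow> U (fluxD :: 'k arep) a 1 v = v"
proof -
  assume v: "v \<in> vspace (ddim (fluxD :: 'k arep))"
  have "U (fluxD :: 'k arep) a 1 v = U (fluxD :: 'k arep) 0 1 v"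
    unfolding aff.gact_def sum_affine by (intro sum.cong refl) (simp add: act_fluxD)
  then show ?thesis using U_one[OF is_drep_fluxD v] by simp
qed

text \<open>A flux projection isolates a nonzero coordinate, and H permutes the basis vectors
  transitively.\<close>

lemma dsimple_fluxD: "dsimple Aff (fluxD :: 'k::{finite,field} arep)"
proof (rule aff.dsimpleI[OF is_drep_fluxD])
  let ?D = "fluxD :: 'k arep" and ?n = "card (- {0 :: 'k})"
  have "(1 :: 'k) \<in> - {0}" by simp
  then show "ddim ?D > 0" unfolding ddim_fluxD by (metis card_gt_0_iff empty_iff finite)
  fix N v assume N: "aff.subrep ?D N" and v: "v \<in> N" "v \<noteq> 0"
  have inN: "act ?D (0, \<alpha>) (b, 1) w \<in> N" if "\<alpha> \<noteq> 0" "w \<in> N" for \<alpha> b w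
    using N that by (auto simp: aff.subrep_def)
  have scN: "sc c w \<in> N" if "w \<in> N" for c w using N that by (auto simp: aff.subrep_def)
  obtain i where i: "v i \<noteq> 0" using v by (auto simp: fun_eq_iff zero_fun_apply)
  have vv: "v \<in> vspace ?n" using v N by (auto simp: aff.subrep_def ddim_fluxD)
  have il: "i < ?n"
  proof (rule ccontr)
    assume "\<not> i < ?n"
    then have "v i = 0" using vv unfolding vspace_def by (simp only: mem_Collect_eq not_less)
    with i show False ..
  qed
  have "sc (v i) (unitv i) \<in> N"
    using inN[of 1 v "en i"] v il by (simp add: act_fluxD en_nonzero)
  from scN[OF this, of "1 / v i"] have u: "unitv i \<in> N" using i by simp
  have "unitv j \<in> N" if j: "j < ?n" for j
    using inN[of "en j / en i" "unitv i" "en i"] u il j by (simp add: act_fluxD en_nonzero) (simp add: unitv_def)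
  then have "(\<Sum>j<?n. sc (w j) (unitv j)) \<in> N" for w
    by (intro aff.subrep_sum[OF N] scN) auto
  then show "vspace (ddim ?D) \<subseteq> N" using vspace_expand by (metis ddim_fluxD subsetI)
qed

lemma fluxion_fluxD: "fluxion Aff (fluxD :: 'k::{finite,field} arep)"
  unfolding fluxion_def
proof (intro conjI ballI impI dsimple_fluxD)
  fix g h :: "'k \<times> 'k"
  assume gh: "g \<in> gcar Aff" "h \<in> gcar Aff" "gmul Aff g h = gmul Aff h g"
  obtain a \<alpha> b \<beta> where e: "g = (a, \<alpha>)" "h = (b, \<beta>)" by (metis surj_pair)
  have "act fluxD g h v = act fluxD (0, 1) h v" for v
    using gh by (auto simp: e act_fluxD)
  then show "dact (fluxD :: 'k arep) g h = dact fluxD (gone Aff) h"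
    by (intro mat_eqI_mv[OF fluxD_carrier fluxD_carrier]) simp
qed

text \<open>Concretely the irreducible representation of G of dimension q - 1 in which every
  nontrivial character of A occurs once. As an image under the functor it inherits simplicity and
  dimension from \<open>fluxD\<close>.\<close>

abbreviation chargeC :: "'k::{finite,field} arep" where "chargeC \<equiv> Fob fluxD"

text \<open>Translations act trivially on \<open>fluxD\<close> and its fluxes have H-part 1, so the
  new projections are averages of pure phases, which vanish unless b = 0 and \<beta> = 1.\<close>

lemma chargeon_chargeC: "chargeon Aff (chargeC :: 'k::{finite,field} arep)"
  unfolding chargeon_def
proof (intro conjI ballI impI dsimple_Fob dsimple_fluxD)
  let ?D = "fluxD :: 'k arep"
  fix h :: "'k \<times> 'k" assume h: "h \<in> gcar Aff" "h \<noteq> gone Aff"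
  obtain b \<beta> where e: "h = (b, \<beta>)" by fastforce
  with h have b: "\<beta> \<noteq> 0" and ne: "b \<noteq> 0 \<or> \<beta> \<noteq> 1" by auto
  show "dact (Fob ?D) (gone Aff) h = 0\<^sub>m (ddim (Fob ?D)) (ddim (Fob ?D))"
  proof (rule aff.mat_eqI_flux[OF is_drep_fluxD])
    fix k :: "'k \<times> 'k" and v assume k: "k \<in> gcar Aff" and v: "v \<in> Fl ?D k"
    obtain y \<eta> where ek: "k = (y, \<eta>)" by fastforce
    have nz: "\<eta> \<noteq> 0" and v: "v \<in> Fl ?D (y, \<eta>)" using k v by (auto simp: ek)
    have "v = 0 \<or> \<eta> = 1" using flux_fluxD[OF v] by auto
    then have "act (Fob ?D) (0, 1) (b, \<beta>) v = (if \<beta> = 1 then favg (\<lambda>x. sc (\<psi> (x * (- b))) v) else 0)"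
      unfolding act_one_Fob_flux[OF is_drep_fluxD v nz b]
      using aff.flux_vspace[OF v] by (auto simp: U_fluxD)
    then show "mv (dact (Fob ?D) (gone Aff) h) v = mv (0\<^sub>m (ddim (Fob ?D)) (ddim (Fob ?D))) v"
      using ne unfolding favg_\<psi> by (auto simp: e)
  qed (auto simp: Fob_carrier)
qed

lemma flux_chargeC:
  fixes v :: "nat \<Rightarrow> complex" and b \<beta> :: "'k::{finite,field}"
  assumes "v \<in> Fl (chargeC :: 'k arep) (b, \<beta>)" "v \<noteq> 0" "\<beta> \<noteq> 0"
  shows "b = 0 \<and> \<beta> = 1"
proof (rule ccontr)
  assume "\<not> ?thesis"
  then have "dact (chargeC :: 'k arep) (0, 1) (b, \<beta>) = 0\<^sub>m (ddim (chargeC :: 'k arep)) (ddim (chargeC :: 'k arep))"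
    using chargeon_chargeC[where 'k='k] assms(3) unfolding chargeon_def by fastforce
  then show False using assms by (simp add: aff.flux_def)
qed

text \<open>A vector of old flux (y, 1) acquires the A-character \<psi>(a y) with y nonzero, so
  averaging over A kills everything. This separates \<open>chargeC\<close> from the one-dimensional
  chargeons.\<close>

lemma invariant_chargeC:
  fixes v :: "nat \<Rightarrow> complex"
  assumes v: "v \<in> vspace (ddim (chargeC :: 'k::{finite,field} arep))"
    and inv: "\<And>a. U (chargeC :: 'k arep) a 1 v = v"
  shows "v = 0"
proof -
  let ?D = "fluxD :: 'k arep"
  have z: "favg (\<lambda>a. U (Fob ?D) a 1 w) = 0" if "h \<in> gcar Aff" "w \<in> Fl ?D h" for w h
  proof -
    obtain y \<eta> where e: "h = (y, \<eta>)" by fastforce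
    have nz: "\<eta> \<noteq> 0" and w: "w \<in> Fl ?D (y, \<eta>)" using that by (auto simp: e)
    show ?thesis
    proof (cases "w = 0")
      case False
      have "y \<noteq> 0" "\<eta> = 1" using flux_fluxD[OF w False] by auto
      then show ?thesis
        using aff.flux_vspace[OF w] by (simp add: gact_Fob_flux[OF is_drep_fluxD w nz] U_one[OF is_drep_fluxD] favg_\<psi>)
    qed simp
  qed
  have v': "v \<in> vspace (ddim ?D)" using v by simp
  have "v = favg (\<lambda>a. U (Fob ?D) a 1 (\<Sum>h\<in>gcar Aff. act ?D (gone Aff) h v))"
    by (simp only: aff.flux_expand[OF is_drep_fluxD v'] inv favg_const)
  also have "\<dots> = (\<Sum>h\<in>gcar Aff. favg (\<lambda>a. U (Fob ?D) a 1 (act ?D (gone Aff) h v)))"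
    unfolding aff.gact_sum favg_sum ..
  also have "\<dots> = 0" by (intro sum.neutral ballI z[OF _ aff.act_one_flux[OF is_drep_fluxD]])
  finally show ?thesis .
qed

subsection \<open>Types of simple objects\<close>

text \<open>Of the three shapes of type, \<open>typA\<close> is meant for flux (b, 1) and
  A-character x not both zero, with stabilizer A; \<open>typG\<close> for both trivial, with the
  whole group as stabilizer; \<open>typH\<close> for flux (0, \<beta>) with \<beta> different from
  1, whose centralizer is H. The side conditions are added where the types are used.\<close>

definition typA :: "'k::{finite,field} arep \<Rightarrow> 'k \<Rightarrow> 'k \<Rightarrow> (nat \<Rightarrow> complex) \<Rightarrow> bool" where
  "typA X b x v \<longleftrightarrow> aff.has_type X (b, 1) (UNIV \<times> {1}) (\<lambda>(a, \<alpha>). \<psi> (a * x)) v"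

definition typG :: "'k::{finite,field} arep \<Rightarrow> ('k \<Rightarrow> complex) \<Rightarrow> (nat \<Rightarrow> complex) \<Rightarrow> bool" where
  "typG X l v \<longleftrightarrow> aff.has_type X (0, 1) (gcar Aff) (\<lambda>(a, \<alpha>). l \<alpha>) v"

definition typH :: "'k::{finite,field} arep \<Rightarrow> 'k \<Rightarrow> ('k \<Rightarrow> complex) \<Rightarrow> (nat \<Rightarrow> complex) \<Rightarrow> bool" where
  "typH X \<beta> l v \<longleftrightarrow> aff.has_type X (0, \<beta>) ({0} \<times> - {0}) (\<lambda>(a, \<alpha>). l \<alpha>) v"

definition unit_char :: "('k::{finite,field} \<Rightarrow> complex) \<Rightarrow> bool" where
  "unit_char l \<longleftrightarrow> l 1 = 1 \<and> (\<forall>a b. a \<noteq> 0 \<longrightarrow> b \<noteq> 0 \<longrightarrow> l (a * b) = l a * l b)"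

lemma unit_char_inverse: "unit_char l \<Longrightarrow> unit_char (\<lambda>x. l (inverse x))"
  by (simp add: unit_char_def)

lemma typA_iff: "typA X b x v \<longleftrightarrow> v \<in> Fl X (b, 1) \<and> v \<noteq> 0 \<and> (\<forall>a. U X a 1 v = sc (\<psi> (a * x)) v)"
  by (auto simp: typA_def aff.has_type_def)
lemma typG_iff: "typG X l v \<longleftrightarrow> v \<in> Fl X (0, 1) \<and> v \<noteq> 0 \<and> (\<forall>a \<alpha>. \<alpha> \<noteq> 0 \<longrightarrow> U X a \<alpha> v = sc (l \<alpha>) v)"
  by (auto simp: typG_def aff.has_type_def gcar_affine)
lemma typH_iff: "typH X \<beta> l v \<longleftrightarrow> v \<in> Fl X (0, \<beta>) \<and> v \<noteq> 0 \<and> (\<forall>\<alpha>. \<alpha> \<noteq> 0 \<longrightarrow> U X 0 \<alpha> v = sc (l \<alpha>) v)"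
  by (auto simp: typH_def aff.has_type_def)

text \<open>An \<alpha> different from 1 moves b if b is nonzero, and otherwise moves the nontrivial
  character with parameter x.\<close>

lemma stab_A:
  fixes b x :: "'k::{finite,field}"
  assumes "b \<noteq> 0 \<or> x \<noteq> 0"
  shows "aff.stab (b, 1) (UNIV \<times> {1}) (\<lambda>(a, \<alpha>). \<psi> (a * x))"
proof -
  have "\<alpha> * b \<noteq> b \<or> (\<exists>t. \<psi> (t * x) \<noteq> \<psi> (t * x / \<alpha>))" if "\<alpha> \<noteq> 0" "\<alpha> \<noteq> 1" for \<alpha>
  proof (cases "b = 0")
    case True
    with assms have x: "x \<noteq> 0" by simp
    obtain c :: 'k where c: "\<psi> c \<noteq> 1" using \<psi>_nontrivial by blast
    \<comment> \<open>Solves t x - t x / \<alpha> = c, so that the two character values differ by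
      the factor \<psi>(c).\<close>
    define t where "t = c / (x * (1 - 1 / \<alpha>))"
    have "1 - 1 / \<alpha> \<noteq> 0" using that by (simp add: field_simps)
    then have "t * x = c + t * x / \<alpha>" using x that by (simp add: t_def field_simps)
    then have "\<psi> (t * x) = \<psi> c * \<psi> (t * x / \<alpha>)" by (metis \<psi>_add)
    moreover have "\<psi> (t * x / \<alpha>) \<noteq> 0" using \<psi>_add[of "t * x / \<alpha>" "- (t * x / \<alpha>)"] by auto
    ultimately have "\<psi> (t * x) \<noteq> \<psi> (t * x / \<alpha>)" using c by auto
    then show ?thesis by blast
  qed (use that in simp)
  then have 1: "\<exists>t. \<psi> (t * x) \<noteq> \<psi> (t * x / \<alpha>)" if "\<alpha> \<noteq> 0" "\<alpha> \<noteq> 1" "\<alpha> * b = b" for \<alpha> using that by blast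
  show ?thesis
    unfolding aff.stab_def
  proof (intro conjI ballI)
    fix g :: "'k \<times> 'k" assume g: "g \<in> gcar Aff - UNIV \<times> {1}"
    obtain a \<alpha> where e: "g = (a, \<alpha>)" by fastforce
    with g have nz: "\<alpha> \<noteq> 0" "\<alpha> \<noteq> 1" by auto
    show "gmul Aff (gmul Aff g (b, 1)) (ginv Aff g) \<noteq> (b, 1) \<or>
        (\<exists>s\<in>UNIV \<times> {1}. gmul Aff (gmul Aff (ginv Aff g) s) g \<in> UNIV \<times> {1} \<and>
          (case s of (a, \<alpha>) \<Rightarrow> \<psi> (a * x)) \<noteq>
          (case gmul Aff (gmul Aff (ginv Aff g) s) g of (a, \<alpha>) \<Rightarrow> \<psi> (a * x)))"
    proof (cases "\<alpha> * b = b")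
      case True
      then obtain t where t: "\<psi> (t * x) \<noteq> \<psi> (t * x / \<alpha>)" using 1 nz by blast
      have "gmul Aff (gmul Aff (ginv Aff g) (t, 1)) g = (t / \<alpha>, 1)"
        using nz by (simp add: e field_simps)
      then show ?thesis using t by (intro disjI2 bexI[of _ "(t, 1)"]) (auto simp del: affine_simps)
    qed (use nz in \<open>simp add: e\<close>)
  qed (auto simp: gcar_affine ring_distribs \<psi>_add)
qed

lemma stab_G: "unit_char l \<Longrightarrow> aff.stab (0, 1) (gcar Aff) (\<lambda>(a, \<alpha>). l \<alpha>)"
  unfolding aff.stab_def by (auto simp: gcar_affine unit_char_def)

lemma stab_H: "unit_char l \<Longrightarrow> \<beta> \<noteq> 0 \<Longrightarrow> \<beta> \<noteq> 1 \<Longrightarrow> aff.stab (0, \<beta>) ({0} \<times> - {0}) (\<lambda>(a, \<alpha>). l \<alpha>)"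
  unfolding aff.stab_def by (auto simp: gcar_affine unit_char_def field_simps)

text \<open>The witness is U(0, \<alpha>) v. It serves to normalise a nonzero parameter to 1, or to
  reach another nonzero pair with the same product.\<close>

lemma typA_conj:
  assumes X: "arep X" and v: "typA X b x v" and a: "\<alpha> \<noteq> 0"
  shows "\<exists>w. typA X (\<alpha> * b) (x / \<alpha>) w"
proof -
  have vf: "v \<in> Fl X (b, 1)" and v0: "v \<noteq> 0" and U: "\<And>a. U X a 1 v = sc (\<psi> (a * x)) v"
    using v by (auto simp: typA_iff)
  have "U X 0 (1 / \<alpha>) (U X 0 \<alpha> v) = v"
    using a aff.flux_vspace[OF vf] by (simp add: U_U[OF X] X)
  then have "U X 0 \<alpha> v \<noteq> 0" using v0 by auto
  moreover have "U X 0 \<alpha> v \<in> Fl X (\<alpha> * b, 1)"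
    by (rule U_flux[OF X vf a]) auto
  moreover have "U X c 1 (U X 0 \<alpha> v) = sc (\<psi> (c * (x / \<alpha>))) (U X 0 \<alpha> v)" for c
  proof -
    have "U X c 1 (U X 0 \<alpha> v) = U X 0 \<alpha> (U X (c / \<alpha>) 1 v)"
      using a by (simp add: U_U[OF X])
    then show ?thesis by (simp add: U aff.gact_sc)
  qed
  ultimately show ?thesis by (auto simp: typA_iff)
qed

lemma typA_Fob:
  assumes X: "arep X" and v: "typA X b x v"
  shows "typA (Fob X) x b v"
proof -
  have vf: "v \<in> Fl X (b, 1)" and v0: "v \<noteq> 0" and U: "\<And>a. U X a 1 v = sc (\<psi> (a * x)) v"
    using v by (auto simp: typA_iff)
  have "act (Fob X) (0, 1) (x, 1) v = v"
    unfolding act_one_Fob_flux[OF X vf one_neq_zero one_neq_zero] by (simp add: U flip: \<psi>_add)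
  then show ?thesis
    using v0 aff.flux_vspace[OF vf] gact_Fob_flux[OF X vf one_neq_zero one_neq_zero] X
    by (simp add: typA_iff aff.flux_def)
qed

lemma typG_Fob:
  assumes X: "arep X" and v: "typG X l v" and l: "unit_char l"
  shows "typG (Fob X) (\<lambda>x. l (inverse x)) v"
proof -
  have vf: "v \<in> Fl X (0, 1)" and v0: "v \<noteq> 0" and U: "\<And>a \<alpha>. \<alpha> \<noteq> 0 \<Longrightarrow> U X a \<alpha> v = sc (l \<alpha>) v"
    using v by (auto simp: typG_iff)
  have "act (Fob X) (0, 1) (0, 1) v = v"
    unfolding act_one_Fob_flux[OF X vf one_neq_zero one_neq_zero] using l by (simp add: U unit_char_def)
  then show ?thesis
    using v0 aff.flux_vspace[OF vf] gact_Fob_flux[OF X vf one_neq_zero] X U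
    by (simp add: typG_iff aff.flux_def inverse_eq_divide)
qed

text \<open>\<open>v\<close> is not homogeneous for the new grading; its new component is the
  average of the vectors U(x, 1) v. It is nonzero because these have distinct old fluxes ((1 -
  \<beta>) x, \<beta>), and only x = 0 contributes to (0, \<beta>).\<close>

lemma typH_Fob:
  assumes X: "arep X" and v: "typH X \<beta> l v" and b: "\<beta> \<noteq> 0" "\<beta> \<noteq> 1"
  shows "\<exists>w. typH (Fob X) (inverse \<beta>) (\<lambda>x. l (inverse x)) w"
proof -
  have vf: "v \<in> Fl X (0, \<beta>)" and v0: "v \<noteq> 0" and U: "\<And>\<alpha>. \<alpha> \<noteq> 0 \<Longrightarrow> U X 0 \<alpha> v = sc (l \<alpha>) v"
    using v by (auto simp: typH_iff)
  note FX = is_drep_Fob[OF X]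
  define w where "w = act (Fob X) (0, 1) (0, inverse \<beta>) v"
  have ib: "inverse \<beta> \<noteq> 0" using b by simp
  have w: "w = favg (\<lambda>x. U X x 1 v)"
    unfolding w_def act_one_Fob_flux[OF X vf b(1) ib] using b by simp
  have "act X (0, 1) (0, \<beta>) w = favg (\<lambda>x::'a. if x = 0 then v else 0)"
    unfolding w mv_favg
  proof (rule favg_cong)
    fix x :: 'a
    have "U X x 1 v \<in> Fl X ((1 - \<beta>) * x, \<beta>)" by (rule U_flux[OF X vf]) (use b in auto)
    from act_flux[OF X this _ b(1) b(1), of 1 0 0] show "act X (0, 1) (0, \<beta>) (U X x 1 v) = (if x = 0 then v else 0)"
      using b X aff.flux_vspace[OF vf] by auto
  qed
  also have "\<dots> = sc (1 / of_nat (card (UNIV :: 'a set))) v"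
    by (simp add: favg_def sum.delta)
  finally have "w \<noteq> 0" using v0 by (auto dest: arg_cong[where f="\<lambda>f. f"])
  moreover have "w \<in> Fl (Fob X) (0, inverse \<beta>)"
    unfolding w_def using aff.act_one_flux[OF FX, of "(0, inverse \<beta>)" v] b by simp
  moreover have "U (Fob X) 0 \<alpha> w = sc (l (inverse \<alpha>)) w" if a: "\<alpha> \<noteq> 0" for \<alpha>
  proof -
    \<comment> \<open>H fixes the flux (0, 1 / \<beta>), so its new action commutes with the
      projection and the eigenvalue passes from \<open>v\<close> to \<open>w\<close>.\<close>
    have e: "gmul Aff (gmul Aff (ginv Aff (0, \<alpha>)) (0, inverse \<beta>)) (0, \<alpha>) = (0, inverse \<beta>)"
      using a by (simp add: field_simps)
    have "act (Fob X) (gone Aff) (0, inverse \<beta>) (U (Fob X) 0 \<alpha> v) =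
        U (Fob X) 0 \<alpha> (act (Fob X) (gone Aff) (0, inverse \<beta>) v)"
      by (subst e[symmetric], rule aff.act_gact[OF FX]) (use a b in auto)
    then have "U (Fob X) 0 \<alpha> w = act (Fob X) (0, 1) (0, inverse \<beta>) (U (Fob X) 0 \<alpha> v)"
      by (simp add: w_def)
    also have "U (Fob X) 0 \<alpha> v = sc (l (inverse \<alpha>)) v"
      using gact_Fob_flux[OF X vf b(1) a, of 0] U[of "1 / \<alpha>"] a by (simp add: inverse_eq_divide)
    finally show ?thesis by (simp add: w_def mv_sc)
  qed
  ultimately show ?thesis by (auto simp: typH_iff)
qed

lemma typA_ddual:
  assumes X: "arep X" and v: "typA X b x v" and "b \<noteq> 0 \<or> x \<noteq> 0"
  shows "\<exists>w. typA (ddual Aff X) (- b) (- x) w"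
  using aff.has_type_ddual[OF X stab_A[OF assms(3)] v[unfolded typA_def]]
  by (auto simp: typA_iff aff.has_type_def)

lemma typG_ddual:
  assumes X: "arep X" and v: "typG X l v" and l: "unit_char l"
  shows "\<exists>w. typG (ddual Aff X) (\<lambda>x. l (inverse x)) w"
  using aff.has_type_ddual[OF X stab_G[OF l] v[unfolded typG_def]]
  by (auto simp: typG_iff aff.has_type_def gcar_affine)

lemma typH_ddual:
  assumes X: "arep X" and v: "typH X \<beta> l v" and l: "unit_char l" and b: "\<beta> \<noteq> 0" "\<beta> \<noteq> 1"
  shows "\<exists>w. typH (ddual Aff X) (inverse \<beta>) (\<lambda>x. l (inverse x)) w"
  using aff.has_type_ddual[OF X stab_H[OF l b] v[unfolded typH_def]]
  by (auto simp: typH_iff aff.has_type_def)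

text \<open>Projects \<open>w\<close> to an isotypic component of H, for a character with nonzero
  Fourier coefficient of a coordinate of U(0, x) w. H preserves the flux (0, \<beta>) and normalises
  A, so A-invariance survives.\<close>

lemma ex_unit_eigenvector:
  assumes X: "arep X" and w: "w \<in> Fl X (0, \<beta>)" "w \<noteq> 0" and b: "\<beta> \<noteq> 0"
  obtains l u where "unit_char l" "u \<in> Fl X (0, \<beta>)" "u \<noteq> 0"
    "\<And>\<gamma>. \<gamma> \<noteq> 0 \<Longrightarrow> U X 0 \<gamma> u = sc (l \<gamma>) u"
    "(\<And>a. U X a 1 w = w) \<Longrightarrow> (\<And>a. U X a 1 u = u)"
proof -
  obtain i where i: "w i \<noteq> 0" using w by (auto simp: fun_eq_iff zero_fun_apply)
  have "U X 0 1 w i \<noteq> 0" using i X aff.flux_vspace[OF w(1)] by simp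
  then obtain l where l: "l 1 = 1" "\<And>a b. a \<noteq> 0 \<Longrightarrow> b \<noteq> 0 \<Longrightarrow> l (a * b) = l a * l b"
    and nz: "(\<Sum>x\<in>-{0}. l (inverse x) * U X 0 x w i) \<noteq> 0"
    using ex_unit_char[of 1 "\<lambda>x. U X 0 x w i"] by auto
  define u where "u = (\<Sum>x\<in>-{0}. sc (l (inverse x)) (U X 0 x w))"
  show thesis
  proof (rule that)
    show "unit_char l" using l by (simp add: unit_char_def)
    have fl: "U X 0 x w \<in> Fl X (0, \<beta>)" if "x \<noteq> 0" for x
      by (rule U_flux[OF X w(1) that b]) simp
    then show "u \<in> Fl X (0, \<beta>)" unfolding u_def by (intro aff.flux_sum aff.flux_sc) auto
    have "u i \<noteq> 0" using nz by (simp add: u_def sum_fun_apply sc_apply)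
    then show "u \<noteq> 0" by (auto simp: zero_fun_apply)
    show "U X 0 \<gamma> u = sc (l \<gamma>) u" if g: "\<gamma> \<noteq> 0" for \<gamma>
    proof -
      have "U X 0 \<gamma> u = (\<Sum>x\<in>-{0}. sc (l (inverse x)) (U X 0 (\<gamma> * x) w))"
        unfolding u_def aff.gact_sum aff.gact_sc using g by (intro sum.cong refl) (simp add: U_U[OF X])
      also have "\<dots> = (\<Sum>x\<in>-{0}. sc (l (\<gamma> * inverse x)) (U X 0 x w))"
      proof (rule sum.reindex_bij_witness[of _ "\<lambda>x. x / \<gamma>" "\<lambda>x. \<gamma> * x"])
        fix x
        have "\<gamma> * inverse (\<gamma> * x) = inverse x" using g by (simp add: mult.assoc[symmetric])
        then show "sc (l (\<gamma> * inverse (\<gamma> * x))) (U X 0 (\<gamma> * x) w) = sc (l (inverse x)) (U X 0 (\<gamma> * x) w)"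
          by (simp only:)
      qed (use g in auto)
      also have "\<dots> = sc (l \<gamma>) u"
        unfolding u_def sc_sum using g by (intro sum.cong refl) (simp add: l(2))
      finally show ?thesis .
    qed
    show "U X a 1 u = u" if inv: "\<And>a. U X a 1 w = w" for a
      unfolding u_def aff.gact_sum aff.gact_sc
    proof (intro sum.cong refl arg_cong[where f="sc _"])
      fix x :: 'a assume "x \<in> - {0}"
      then have x: "x \<noteq> 0" by simp
      have "U X a 1 (U X 0 x w) = U X 0 x (U X (a / x) 1 w)" using x by (simp add: U_U[OF X])
      then show "U X a 1 (U X 0 x w) = U X 0 x w" by (simp add: inv)
    qed
  qed
qed

text \<open>Starting from a nonzero flux component: if \<beta> is not 1, the flux is moved to (0,
  \<beta>) and an H-eigenvector is found; if \<beta> = 1, translations keep the flux and an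
  A-eigenvector is found, then an H-eigenvector as well when flux and A-character are both
  trivial.\<close>

lemma dsimple_cases:
  fixes X :: "'k::{finite,field} arep"
  assumes Xs: "dsimple Aff X"
  obtains (A) b x v where "typA X b x v" "b \<noteq> 0 \<or> x \<noteq> 0"
    | (G) l v where "unit_char l" "typG X l v"
    | (H) \<beta> l v where "unit_char l" "\<beta> \<noteq> 0" "\<beta> \<noteq> 1" "typH X \<beta> l v"
proof -
  have X: "arep X" by (rule aff.dsimple_drep[OF Xs])
  have u: "unitv 0 \<in> vspace (ddim X)" using Xs by (intro vspace_unitv) (simp add: dsimple_def)
  have "unitv 0 \<noteq> 0" by (auto simp: unitv_def fun_eq_iff zero_fun_apply)
  then have "(\<Sum>h\<in>gcar Aff. act X (gone Aff) h (unitv 0)) \<noteq> 0"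
    by (simp only: aff.flux_expand[OF X u] not_False_eq_True)
  then obtain h where h: "h \<in> gcar Aff" "act X (gone Aff) h (unitv 0) \<noteq> 0"
    by (meson sum.neutral)
  obtain b \<beta> where e: "h = (b, \<beta>)" by fastforce
  define v where "v = act X (gone Aff) h (unitv 0)"
  have v: "v \<in> Fl X (b, \<beta>)" "v \<noteq> 0" and nb: "\<beta> \<noteq> 0"
    using aff.act_one_flux[OF X h(1), of "unitv 0"] h by (auto simp: v_def e)
  show thesis
  proof (cases "\<beta> = 1")
    case False
    \<comment> \<open>The translation a solves b + (1 - \<beta>) a = 0, which clears the A-part of
      the flux.\<close>
    define w where "w = U X (- b / (1 - \<beta>)) 1 v"
    have wf: "w \<in> Fl X (0, \<beta>)"
      unfolding w_def by (rule U_flux[OF X v(1) _ nb]) (use False in auto)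
    have "U X (b / (1 - \<beta>)) 1 w = v"
      using X aff.flux_vspace[OF v(1)] by (simp add: w_def U_U[OF X])
    then have "w \<noteq> 0" using v by auto
    from ex_unit_eigenvector[OF X wf this nb] obtain l u where "unit_char l" "u \<in> Fl X (0, \<beta>)" "u \<noteq> 0"
      "\<And>\<gamma>. \<gamma> \<noteq> 0 \<Longrightarrow> U X 0 \<gamma> u = sc (l \<gamma>) u" by metis
    then show ?thesis using H[of l \<beta> u] nb False by (auto simp: typH_iff)
  next
    case True
    note vf = v(1)[unfolded True]
    \<comment> \<open>\<open>w x\<close> is the component of \<open>v\<close> with A-character x;
      the components add up to \<open>v\<close>, so one of them is nonzero.\<close>
    define w where "w x = favg (\<lambda>a. sc (\<psi> (x * (- a))) (U X a 1 v))" for x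
    have "(\<Sum>x\<in>UNIV. w x) = U X 0 1 v"
      unfolding w_def by (rule fourier_inversion) simp
    also have "\<dots> = v" using X aff.flux_vspace[OF vf] by simp
    finally obtain x where x: "w x \<noteq> 0" using v(2) by (metis sum.neutral)
    have "w x \<in> Fl X (b, 1)"
      unfolding w_def by (intro flux_favg aff.flux_sc U_flux[OF X vf]) auto
    moreover have "U X c 1 (w x) = sc (\<psi> (c * x)) (w x)" for c
    proof -
      have "U X c 1 (w x) = favg (\<lambda>a. (\<lambda>a. sc (\<psi> (c * x)) (sc (\<psi> (x * (- a))) (U X a 1 v))) (1 * a + c))"
        unfolding w_def gact_favg
        by (intro favg_cong) (simp add: aff.gact_sc U_U[OF X] add.commute algebra_simps flip: \<psi>_add)
      also have "\<dots> = sc (\<psi> (c * x)) (w x)"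
        unfolding w_def favg_sc[symmetric] by (rule favg_reindex) (rule bij_mult_add, simp)
      finally show ?thesis .
    qed
    ultimately have t: "typA X b x (w x)" using x by (simp add: typA_iff)
    show ?thesis
    proof (cases "b = 0 \<and> x = 0")
      case True
      then have wf: "w x \<in> Fl X (0, 1)" and inv: "\<And>a. U X a 1 (w x) = w x" using t by (auto simp: typA_iff)
      obtain l u where u: "unit_char l" "u \<in> Fl X (0, 1)" "u \<noteq> 0"
        "\<And>\<gamma>. \<gamma> \<noteq> 0 \<Longrightarrow> U X 0 \<gamma> u = sc (l \<gamma>) u" "\<And>a. U X a 1 u = u"
        using ex_unit_eigenvector[OF X wf x one_neq_zero] inv by metis
      have "U X a \<alpha> u = sc (l \<alpha>) u" if "\<alpha> \<noteq> 0" for a \<alpha>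
      proof -
        have "U X a \<alpha> u = U X a 1 (U X 0 \<alpha> u)" using that by (simp add: U_U[OF X])
        then show ?thesis using that u by (simp add: aff.gact_sc)
      qed
      then show ?thesis using G[of l u] u by (auto simp: typG_iff)
    qed (use A t in blast)
  qed
qed

text \<open>S T and T S have the same trace, and over the complex numbers the trace of an identity
  matrix determines its size.\<close>

lemma diso_ddim:
  assumes "diso G X Y"
  shows "ddim X = ddim Y"
proof -
  obtain T S where "T \<in> dhom G X Y" "S \<in> dhom G Y X"
    and ST: "S * T = 1\<^sub>m (ddim X)" and TS: "T * S = 1\<^sub>m (ddim Y)"
    using assms by (auto simp: diso_def is_iso_mor_def)
  then have T: "T \<in> carrier_mat (ddim Y) (ddim X)" and S: "S \<in> carrier_mat (ddim X) (ddim Y)"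
    by (auto simp: dhom_def)
  have tr: "(\<Sum>i<n. (A * B) $$ (i, i)) = (\<Sum>i<n. \<Sum>j<m. A $$ (i, j) * B $$ (j, i))"
    if "A \<in> carrier_mat n m" "B \<in> carrier_mat m n" for A B :: "complex mat" and n m
    using that by (intro sum.cong refl) (auto simp: scalar_prod_def atLeast0LessThan)
  have "of_nat (ddim X) = (\<Sum>i<ddim X. (S * T) $$ (i, i))" by (simp add: ST)
  also have "\<dots> = (\<Sum>j<ddim Y. \<Sum>i<ddim X. S $$ (i, j) * T $$ (j, i))"
    unfolding tr[OF S T] by (rule sum.swap)
  also have "\<dots> = (\<Sum>j<ddim Y. (T * S) $$ (j, j))"
    unfolding tr[OF T S] by (simp add: mult.commute)
  also have "\<dots> = of_nat (ddim Y)" by (simp add: TS)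
  finally show ?thesis using of_nat_eq_iff[where 'a=complex] by blast
qed

section \<open>The exchanged objects and the comparison with charge conjugation\<close>

lemma typA_fluxD: "typA (fluxD :: 'k::{finite,field} arep) 1 0 (unitv (idx (1 :: 'k)))"
proof -
  have v: "unitv (idx (1 :: 'k)) \<in> vspace (ddim (fluxD :: 'k arep))" by (simp add: ddim_fluxD)
  have "unitv (idx (1 :: 'k)) \<noteq> 0" by (auto simp: unitv_def fun_eq_iff zero_fun_apply)
  moreover have "unitv (idx (1 :: 'k)) \<in> Fl (fluxD :: 'k arep) (1, 1)"
    using v by (simp add: aff.flux_def act_fluxD) (simp add: unitv_def)
  ultimately show ?thesis using v by (simp add: typA_iff U_fluxD)
qed

lemma typA_chargeC: "typA (chargeC :: 'k::{finite,field} arep) 0 1 (unitv (idx (1 :: 'k)))"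
  by (rule typA_Fob[OF is_drep_fluxD typA_fluxD])

lemma typA_diso:
  assumes "diso Aff X Y" "arep X" "arep Y" "typA X b x v"
  shows "\<exists>w. typA Y b x w"
  unfolding typA_def
  by (rule aff.diso_has_type[OF assms(1-3) _ _ assms(4)[unfolded typA_def]]) (auto simp: gcar_affine)

lemma typG_diso:
  assumes "diso Aff X Y" "arep X" "arep Y" "typG X l v"
  shows "\<exists>w. typG Y l w"
  unfolding typG_def
  by (rule aff.diso_has_type[OF assms(1-3) _ _ assms(4)[unfolded typG_def]]) (auto simp: gcar_affine)

lemma typH_diso:
  assumes "diso Aff X Y" "arep X" "arep Y" "typH X \<beta> l v" "\<beta> \<noteq> 0"
  shows "\<exists>w. typH Y \<beta> l w"
  unfolding typH_def
  by (rule aff.diso_has_type[OF assms(1-3) _ _ assms(4)[unfolded typH_def]])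
    (use assms(5) in \<open>auto simp: gcar_affine\<close>)

lemma typA_iso:
  assumes "dsimple Aff X" "arep Y" "b \<noteq> 0 \<or> x \<noteq> 0" "typA X b x v" "typA Y b x w"
    "dsimple Aff Y \<or> ddim Y = ddim X"
  shows "diso Aff X Y"
  by (rule aff.type_iso[OF assms(1,2) stab_A[OF assms(3)] assms(4,5)[unfolded typA_def] assms(6)])

lemma not_diso_chargeC_fluxD: "\<not> diso Aff (chargeC :: 'k::{finite,field} arep) fluxD"
proof
  assume "diso Aff (chargeC :: 'k arep) fluxD"
  from typA_diso[OF this is_drep_Fob[OF is_drep_fluxD] is_drep_fluxD typA_chargeC]
  obtain w where "typA (fluxD :: 'k arep) 0 1 w" by blast
  then show False using flux_fluxD[of w 0 1] by (auto simp: typA_iff)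
qed

text \<open>In the first case the image has parameters (x, b) and the dual (- b, - x). If b x = 0,
  one of the two is isomorphic to the fluxion and the other to the chargeon; if b x is nonzero,
  \<open>typA_conj\<close> matches them. In the other cases image and dual share a type, and fluxes
  or the lack of A-invariants exclude the two exceptional objects.\<close>

lemma Fob_swap:
  fixes X :: "'k::{finite,field} arep"
  assumes Xs: "dsimple Aff X"
  shows "diso Aff (Fob X) (swap_cls Aff chargeC fluxD (ddual Aff X))"
proof -
  let ?G = "Aff :: ('k \<times> 'k) fgrp" and ?C = "chargeC :: 'k arep" and ?D = "fluxD :: 'k arep"
  let ?Y = "ddual ?G X"
  note X = aff.dsimple_drep[OF Xs]
  note FX = is_drep_Fob[OF X] and FXs = dsimple_Fob[OF Xs] and Y = aff.is_drep_ddual[OF X]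
  note D = is_drep_fluxD[where 'k='k] and Ds = dsimple_fluxD[where 'k='k]
  note C = is_drep_Fob[OF D] and Cs = dsimple_Fob[OF Ds]
  have dY: "ddim ?Y = ddim (Fob X)" by simp
  from Xs show ?thesis
  proof (cases rule: dsimple_cases)
    case (A b x v)
    have F: "typA (Fob X) x b v" by (rule typA_Fob[OF X A(1)])
    obtain w where w: "typA ?Y (- b) (- x) w" using typA_ddual[OF X A] by blast
    show ?thesis
    proof (cases "b = 0")
      case b: True
      with A have x: "x \<noteq> 0" by simp
      obtain v' where v': "typA (Fob X) 1 0 v'"
        using typA_conj[OF FX F, of "1 / x"] x b by auto
      have FD: "diso ?G (Fob X) ?D"
        by (rule typA_iso[OF FXs D _ v' typA_fluxD]) (use Ds in auto)
      obtain w' where w': "typA ?Y 0 1 w'"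
        using typA_conj[OF Y w, of "- x"] x b by auto
      \<comment> \<open>The dual has the dimension of X, hence of its image, which was just
        identified with the fluxion; the chargeon has that dimension too.\<close>
      have "diso ?G ?C ?Y"
        by (rule typA_iso[OF Cs Y _ typA_chargeC w']) (use diso_ddim[OF FD] in auto)
      then have "diso ?G ?Y ?C" by (rule aff.diso_sym)
      then show ?thesis using FD by (simp add: swap_cls_def)
    next
      case b: False
      have nC: "\<not> diso ?G ?Y ?C"
      proof
        assume "diso ?G ?Y ?C"
        from typA_diso[OF this Y C w] obtain u where "typA ?C (- b) (- x) u" by blast
        then show False using flux_chargeC[of u "- b" 1] b by (auto simp: typA_iff)
      qed
      show ?thesis
      proof (cases "x = 0")
        case x: True
        obtain v' where v': "typA X 1 0 v'" using typA_conj[OF X A(1), of "1 / b"] b x by auto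
        have XD: "diso ?G X ?D"
          by (rule typA_iso[OF Xs D _ v' typA_fluxD]) (use Ds in auto)
        obtain w' where w': "typA ?Y 1 0 w'" using typA_conj[OF Y w, of "- 1 / b"] b x by auto
        have "diso ?G ?D ?Y"
          by (rule typA_iso[OF Ds Y _ typA_fluxD w']) (use diso_ddim[OF XD] in auto)
        then have YD: "diso ?G ?Y ?D" by (rule aff.diso_sym)
        obtain u where u: "typA (Fob X) 0 1 u" using typA_conj[OF FX F, of b] b x by auto
        have "diso ?G (Fob X) ?C"
          by (rule typA_iso[OF FXs C _ u typA_chargeC]) (use Cs in auto)
        then show ?thesis using YD nC by (simp add: swap_cls_def)
      next
        case x: False
        \<comment> \<open>Translations are trivial on the fluxion, but act on \<open>w\<close> by
          the nontrivial character with parameter - x.\<close>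
        have nD: "\<not> diso ?G ?Y ?D"
        proof
          assume "diso ?G ?Y ?D"
          from typA_diso[OF this Y D w] obtain u where u: "u \<in> Fl ?D (- b, 1)" "u \<noteq> 0"
            "\<And>a. U ?D a 1 u = sc (\<psi> (a * (- x))) u" by (auto simp: typA_iff)
          obtain c :: 'k where c: "\<psi> c \<noteq> 1" using \<psi>_nontrivial by blast
          have "sc (\<psi> c) u = u" using u(3)[of "- c / x"] x U_fluxD[OF aff.flux_vspace[OF u(1)]] by simp
          moreover obtain i where "u i \<noteq> 0" using u(2) by (auto simp: fun_eq_iff zero_fun_apply)
          ultimately show False using c by (metis sc_apply mult_cancel_right1)
        qed
        \<comment> \<open>\<alpha> = - x / b takes (- b, - x) to (x, b); both pairs have product b
          x.\<close>
        obtain w' where w': "typA ?Y x b w'" using typA_conj[OF Y w, of "- x / b"] b x by auto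
        have "diso ?G (Fob X) ?Y"
          by (rule typA_iso[OF FXs Y _ F w']) (use x dY in auto)
        then show ?thesis using nC nD by (simp add: swap_cls_def)
      qed
    qed
  next
    case (G l v)
    obtain w where w: "typG ?Y (\<lambda>x. l (inverse x)) w" using typG_ddual[OF X G(2,1)] by blast
    have "diso ?G (Fob X) ?Y"
      by (rule aff.type_iso[OF FXs Y stab_G[OF unit_char_inverse[OF G(1)]]
        typG_Fob[OF X G(2,1), unfolded typG_def] w[unfolded typG_def]]) (use dY in auto)
    moreover have "\<not> diso ?G ?Y ?C"
    proof
      assume "diso ?G ?Y ?C"
      from typG_diso[OF this Y C w] obtain u where u: "typG ?C (\<lambda>x. l (inverse x)) u" by blast
      then have fl: "u \<in> Fl ?C (0, 1)" and u0: "u \<noteq> 0" and inv: "U ?C a 1 u = u" for a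
        using G(1) by (auto simp: typG_iff unit_char_def)
      from invariant_chargeC[OF aff.flux_vspace[OF fl] inv] u0 show False by simp
    qed
    moreover have "\<not> diso ?G ?Y ?D"
    proof
      assume "diso ?G ?Y ?D"
      from typG_diso[OF this Y D w] obtain u where "typG ?D (\<lambda>x. l (inverse x)) u" by blast
      then show False using flux_fluxD[of u 0 1] by (auto simp: typG_iff)
    qed
    ultimately show ?thesis by (simp add: swap_cls_def)
  next
    case (H \<beta> l v)
    have ib: "inverse \<beta> \<noteq> 0" "inverse \<beta> \<noteq> 1" using H by auto
    obtain w where w: "typH ?Y (inverse \<beta>) (\<lambda>x. l (inverse x)) w" using typH_ddual[OF X H(4,1-3)] by blast
    obtain u where u: "typH (Fob X) (inverse \<beta>) (\<lambda>x. l (inverse x)) u" using typH_Fob[OF X H(4,2,3)] by blast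
    have "diso ?G (Fob X) ?Y"
      by (rule aff.type_iso[OF FXs Y stab_H[OF unit_char_inverse[OF H(1)] ib]
        u[unfolded typH_def] w[unfolded typH_def]]) (use dY in auto)
    moreover have "\<not> diso ?G ?Y ?C"
    proof
      assume "diso ?G ?Y ?C"
      from typH_diso[OF this Y C w ib(1)] obtain z where "typH ?C (inverse \<beta>) (\<lambda>x. l (inverse x)) z" by blast
      then show False using flux_chargeC[of z 0 "inverse \<beta>"] ib by (auto simp: typH_iff)
    qed
    moreover have "\<not> diso ?G ?Y ?D"
    proof
      assume "diso ?G ?Y ?D"
      from typH_diso[OF this Y D w ib(1)] obtain z where "typH ?D (inverse \<beta>) (\<lambda>x. l (inverse x)) z" by blast
      then show False using flux_fluxD[of z 0 "inverse \<beta>"] ib by (auto simp: typH_iff)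
    qed
    ultimately show ?thesis by (simp add: swap_cls_def)
  qed
qed

theorem theorem4:
  fixes G :: "('k::{finite,field} \<times> 'k) fgrp"
  assumes "G = affine_grp"
  shows "\<exists>F Fm Jt \<phi> C D.
           braided_autoequiv G F Fm Jt \<phi> \<and>
           chargeon G C \<and> fluxion G D \<and> \<not> diso G C D \<and>
           (\<forall>X. dsimple G X \<longrightarrow> diso G (F X) (swap_cls G C D (ddual G X)))"
  unfolding assms
  using braided_autoequiv_Fob chargeon_chargeC fluxion_fluxD not_diso_chargeC_fluxD Fob_swap by blast

end
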